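(* Let $p\in\{1,\infty\}$ and let $f:\mathbb{R}^n\to\mathbb{R}^n$ be real analytic and nonexpansive with respect to the $p$-norm, with $\operatorname{Fix}(f)\neq\varnothing$. Then there exists a positive integer $q$ such that: (i) for each $x\in\mathbb{R}^n$ the sequence $(f^{kq}(x))_{k\ge0}$ converges; (ii) the limit of $(f^{kq}(x))_k$ is a periodic point of $f$ whose minimal period divides $q$; (iii) there is a permutation $\pi$ of $\{1,\dots,n\}$ such that $q$ equals either the order of $\pi$ or twice the order of $\pi$.
   Context: $\|x\|_1=\sum_i|x_i|$ and $\|x\|_\infty=\max_i|x_i|$. $f$ is $p$-norm nonexpansive if $\|f(x)-f(y)\|_p\le\|x-y\|_p$ for all $x,y$. Real analytic means each component of $f$ is a real analytic function. $f^k$ is the $k$-fold composition. A point $x$ is periodic if its orbit $\{f^k(x):k\ge0\}$ is finite; its minimal period is the number of elements of its orbit. *)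

theory Defs
  imports "HOL-Analysis.Analysis" "HOL-Library.Extended_Real"
begin

text \<open>The p-norm on R^n for p in {1, infinity} (p given as an extended real).
  For other values of p it is left unspecified (0); the theorem assumes p in {1, infinity}.\<close>
definition p_norm :: "ereal \<Rightarrow> real^'n \<Rightarrow> real" where
  "p_norm p x = (if p = \<infinity> then Max (range (\<lambda>i. \<bar>x $ i\<bar>))
                 else if p = 1 then (\<Sum>i\<in>UNIV. \<bar>x $ i\<bar>) else 0)"

text \<open>Real analyticity of g : R^n -> R: around every point a, g is given on a ball
  by an (unconditionally, i.e. absolutely) convergent multivariate power series
  in (x - a), indexed by multi-indices alpha : 'n => nat.\<close>
definition real_analytic :: "(real^'n \<Rightarrow> real) \<Rightarrow> bool" where
  "real_analytic g \<longleftrightarrow> (\<forall>a. \<exists>r>0. \<exists>c :: ('n \<Rightarrow> nat) \<Rightarrow> real.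
     \<forall>x\<in>ball a r. ((\<lambda>\<alpha>. c \<alpha> * (\<Prod>i\<in>UNIV. (x $ i - a $ i) ^ \<alpha> i)) has_sum g x) UNIV)"

definition orbit_of :: "('a \<Rightarrow> 'a) \<Rightarrow> 'a \<Rightarrow> 'a set" where
  "orbit_of f x = {(f ^^ k) x | k. True}"

definition periodic_point :: "('a \<Rightarrow> 'a) \<Rightarrow> 'a \<Rightarrow> bool" where
  "periodic_point f x \<longleftrightarrow> finite (orbit_of f x)"

definition minimal_period :: "('a \<Rightarrow> 'a) \<Rightarrow> 'a \<Rightarrow> nat" where
  "minimal_period f x = card (orbit_of f x)"

definition perm_order :: "('a \<Rightarrow> 'a) \<Rightarrow> nat" where
  "perm_order \<pi> = (LEAST k. 0 < k \<and> \<pi> ^^ k = id)"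

end

theory Submission
  imports Defs "HOL-Complex_Analysis.Conformal_Mappings" "HOL-Combinatorics.Cycles"
begin

text \<open>Both norms are polyhedral: the norm of \<open>x\<close> is the maximum of \<open>x \<bullet>
  a\<close> over a finite symmetric set \<open>P\<close>. A pigeonhole argument on norming functionals shows that
  recurrent points are periodic. For fixed points \<open>x, z\<close> of a power \<open>g\<close> of
  \<open>f\<close> and a functional norming \<open>x - z\<close>, the iterates of \<open>(g + id) / 2\<close>
  composed with that functional are affine on the segment from \<open>z\<close> to \<open>x\<close>, hence, by
  analyticity, on the whole line. So the limit \<open>R\<close> of these iterates is a retraction onto the fixed
  points of \<open>g\<close> with the same property, and this forces the set of fixed points to be isometric to a
  normed space, on which \<open>f\<close> acts as a linear isometry. Blowing up at a fixed point
  \<open>x\<^sub>0\<close> of \<open>f\<close> shows that the \<open>q\<close>-th power of this isometry is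
  trivial as soon as the iterates of the \<open>q\<close>-th power of the derivative \<open>A\<close> of
  \<open>f\<close> at \<open>x\<^sub>0\<close> converge. For the sup norm, \<open>A\<close> permutes up to sign a
  minimal set of coordinates norming its periodic vectors, and the 1-norm is treated by duality; in both cases
  \<open>q\<close> can be taken to be twice the order of a permutation.\<close>

section \<open>Polyhedral norms and recurrent points\<close>

text \<open>Neither norm is strictly convex, and this shapes the argument. Geodesics are not unique
  and fixed point sets bend: for the sup norm on the plane, (x, y) |-> (x, sin x) is analytic and
  nonexpansive, and it fixes exactly a sine curve. So chords between fixed points leave the fixed
  point set, and Mazur-Ulam does not apply directly. The chord from z to x is replaced by the curve
  t |-> R (z + t (x - z)), which stays among the fixed points. In return, polyhedrality turns
  asymptotics into equalities: far along a ray only the functionals norming its direction matter, so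
  Busemann functions are attained at finite parameters. The periods of single points give no common
  q. But contraction along the curves towards x0 commutes with f, so every periodic point, however
  far away, leaves a trace in the derivative at x0, and one linear map controls all periods. It
  permutes coordinates up to signs; doubling the order of the permutation squares the signs
  away.\<close>

locale polyhedral_norm =
  fixes P :: "'a::euclidean_space set"
  assumes finite_P: "finite P"
    and nonempty_P: "P \<noteq> {}"
    and uminus_P: "a \<in> P \<Longrightarrow> - a \<in> P"
    and separating_P: "x \<noteq> 0 \<Longrightarrow> \<exists>a\<in>P. x \<bullet> a \<noteq> 0"
begin

definition N :: "'a \<Rightarrow> real" where
  "N x = Max ((\<lambda>a. x \<bullet> a) ` P)"

definition norming :: "'a \<Rightarrow> 'a set" where
  "norming x = {a \<in> P. x \<bullet> a = N x}"

definition nonexp :: "('a \<Rightarrow> 'a) \<Rightarrow> bool" where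
  "nonexp h \<longleftrightarrow> (\<forall>x y. N (h x - h y) \<le> N (x - y))"

lemma inner_le_N: "a \<in> P \<Longrightarrow> x \<bullet> a \<le> N x"
  unfolding N_def using finite_P by auto

lemma N_attained: "\<exists>a\<in>P. x \<bullet> a = N x"
proof -
  have "N x \<in> (\<lambda>a. x \<bullet> a) ` P"
    unfolding N_def using finite_P nonempty_P by (intro Max_in) auto
  then show ?thesis by auto
qed

lemma norming_nonempty: "norming x \<noteq> {}"
  using N_attained by (auto simp: norming_def)

lemma N_le_iff: "N x \<le> r \<longleftrightarrow> (\<forall>a\<in>P. x \<bullet> a \<le> r)"
  unfolding N_def using finite_P nonempty_P by auto

lemma N_minus [simp]: "N (- x) = N x"
proof -
  have "N (- x) \<le> N x" for x
    unfolding N_le_iff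
  proof
    fix a assume "a \<in> P"
    then show "- x \<bullet> a \<le> N x" using inner_le_N[OF uminus_P, of a x] by simp
  qed
  from this[of x] this[of "- x"] show ?thesis by simp
qed

lemma N_commute: "N (x - y) = N (y - x)"
  using N_minus[of "x - y"] by simp

lemma N_add_le: "N (x + y) \<le> N x + N y"
  unfolding N_le_iff by (auto simp: inner_add_left intro!: add_mono inner_le_N)

lemma N_diff_triangle: "N (x - z) \<le> N (x - y) + N (y - z)"
  using N_add_le[of "x - y" "y - z"] by simp

lemma N_diff_triangle4: "N (x - w) \<le> N (x - y) + N (y - z) + N (z - w)"
  using N_diff_triangle[of x w y] N_diff_triangle[of y w z] by simp

lemma N_zero [simp]: "N 0 = 0"
  using N_attained[of 0] by auto

lemma N_nonneg [simp]: "0 \<le> N x"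
  using N_add_le[of x "- x"] by simp

lemma N_eq_0_iff [simp]: "N x = 0 \<longleftrightarrow> x = 0"
proof
  assume "N x = 0"
  show "x = 0"
  proof (rule ccontr)
    assume "x \<noteq> 0"
    then obtain a where "a \<in> P" "x \<bullet> a \<noteq> 0" using separating_P by blast
    moreover have "x \<bullet> a \<le> 0" "- (x \<bullet> a) \<le> 0"
      using inner_le_N[of a x] inner_le_N[of "- a" x] uminus_P \<open>a \<in> P\<close> \<open>N x = 0\<close> by auto
    ultimately show False by simp
  qed
qed simp

lemma N_pos_iff: "0 < N x \<longleftrightarrow> x \<noteq> 0"
  using N_nonneg[of x] N_eq_0_iff[of x] by linarith

lemma N_scaleR_nonneg: "0 \<le> c \<Longrightarrow> N (c *\<^sub>R x) = c * N x"
proof (rule antisym)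
  assume c: "0 \<le> c"
  show "N (c *\<^sub>R x) \<le> c * N x"
    unfolding N_le_iff by (auto intro!: mult_left_mono inner_le_N c)
  obtain a where "a \<in> P" "x \<bullet> a = N x" using N_attained by blast
  then show "c * N x \<le> N (c *\<^sub>R x)"
    using inner_le_N[of a "c *\<^sub>R x"] by simp
qed

lemma N_scaleR [simp]: "N (c *\<^sub>R x) = \<bar>c\<bar> * N x"
  using N_scaleR_nonneg[of c x] N_scaleR_nonneg[of "- c" x] by (cases "c \<ge> 0") auto

lemma abs_inner_le_N: "a \<in> P \<Longrightarrow> \<bar>x \<bullet> a\<bar> \<le> N x"
  using inner_le_N[of a x] inner_le_N[of "- a" x] uminus_P by auto

lemma norming_uminus: "a \<in> norming x \<Longrightarrow> - a \<in> norming (- x)"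
  unfolding norming_def using uminus_P by auto

lemma N_le_norm: "\<exists>K>0. \<forall>x. N x \<le> K * norm x"
proof -
  define K where "K = Max (norm ` P) + 1"
  have K: "norm a \<le> K" if "a \<in> P" for a
  proof -
    have "norm a \<le> Max (norm ` P)" using finite_P that by simp
    then show ?thesis unfolding K_def by linarith
  qed
  obtain a where "a \<in> P" using nonempty_P by blast
  then have "norm a \<le> Max (norm ` P)" using finite_P by auto
  then have "0 \<le> Max (norm ` P)" using norm_ge_zero[of a] by linarith
  then have "K > 0" unfolding K_def by linarith
  moreover have "N x \<le> K * norm x" for x
    unfolding N_le_iff
  proof
    fix a assume "a \<in> P"
    have "x \<bullet> a \<le> norm x * norm a" by (rule norm_cauchy_schwarz)
    also have "\<dots> \<le> norm x * K" using K[OF \<open>a \<in> P\<close>] by (intro mult_left_mono) auto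
    finally show "x \<bullet> a \<le> K * norm x" by (simp add: mult.commute)
  qed
  ultimately show ?thesis by blast
qed

lemma continuous_on_N [continuous_intros]:
  assumes "continuous_on S g"
  shows "continuous_on S (\<lambda>x. N (g x))"
proof -
  obtain K where K: "K > 0" "\<And>x. N x \<le> K * norm x" using N_le_norm by blast
  have "K-lipschitz_on UNIV N"
  proof (rule lipschitz_onI)
    fix x y :: 'a
    have "N x \<le> N (x - y) + N y" "N y \<le> N (x - y) + N x"
      using N_add_le[of "x - y" y] N_add_le[of "y - x" x] N_commute[of x y] by auto
    then show "dist (N x) (N y) \<le> K * dist x y"
      using K(2)[of "x - y"] by (auto simp: dist_norm)
  qed (use K in auto)
  then have "continuous_on UNIV N" by (rule lipschitz_on_continuous_on)
  then show ?thesis using continuous_on_compose2[OF _ assms] by blast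
qed

lemma tendsto_N [tendsto_intros]: "(g \<longlongrightarrow> l) F \<Longrightarrow> ((\<lambda>x. N (g x)) \<longlongrightarrow> N l) F"
  using continuous_on_N[OF continuous_on_id, of UNIV]
  by (simp add: continuous_on_eq_continuous_at isCont_tendsto_compose)

lemma norm_le_N: "\<exists>K>0. \<forall>x. norm x \<le> K * N x"
proof -
  have "\<exists>x\<in>sphere 0 1. \<forall>y\<in>sphere (0::'a) 1. N x \<le> N y"
    by (intro continuous_attains_inf continuous_intros) auto
  then obtain z where z: "norm z = 1" "\<And>y. norm y = 1 \<Longrightarrow> N z \<le> N y" by auto
  have pos: "N z > 0" using z(1) by (auto simp: N_pos_iff)
  have "norm x \<le> inverse (N z) * N x" for x
  proof (cases "x = 0")
    case False
    then have "N z \<le> N (inverse (norm x) *\<^sub>R x)" by (intro z) auto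
    then have "N z \<le> inverse (norm x) * N x" by simp
    then show ?thesis using pos False by (simp add: field_simps)
  qed simp
  then show ?thesis using pos by (intro exI[of _ "inverse (N z)"]) auto
qed

lemma tendsto_iff_N: "(X \<longlongrightarrow> l) F \<longleftrightarrow> ((\<lambda>n. N (X n - l)) \<longlongrightarrow> 0) F"
proof
  assume "(X \<longlongrightarrow> l) F"
  then have "((\<lambda>n. N (X n - l)) \<longlongrightarrow> N (l - l)) F" by (intro tendsto_intros)
  then show "((\<lambda>n. N (X n - l)) \<longlongrightarrow> 0) F" by simp
next
  assume *: "((\<lambda>n. N (X n - l)) \<longlongrightarrow> 0) F"
  obtain K where K: "\<And>x. norm x \<le> K * N x" using norm_le_N by blast
  have "((\<lambda>n. X n - l) \<longlongrightarrow> 0) F"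
    by (rule Lim_null_comparison[OF _ tendsto_mult_right_zero[OF *, of K]]) (simp add: K)
  then show "(X \<longlongrightarrow> l) F" by (rule LIM_zero_cancel)
qed

section \<open>Nonexpansive maps, recurrent points and orbit closures\<close>

lemma nonexpD: "nonexp h \<Longrightarrow> N (h x - h y) \<le> N (x - y)"
  by (auto simp: nonexp_def)

lemma nonexp_funpow: "nonexp h \<Longrightarrow> nonexp (h ^^ k)"
proof (induction k)
  case (Suc k)
  show ?case
    unfolding nonexp_def
  proof (intro allI)
    fix x y
    have "N (h ((h ^^ k) x) - h ((h ^^ k) y)) \<le> N ((h ^^ k) x - (h ^^ k) y)"
      by (rule nonexpD[OF Suc.prems])
    also have "\<dots> \<le> N (x - y)" by (rule nonexpD[OF Suc.IH[OF Suc.prems]])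
    finally show "N ((h ^^ Suc k) x - (h ^^ Suc k) y) \<le> N (x - y)" by simp
  qed
qed (simp add: nonexp_def)

lemma funpow_commute: "(h ^^ k) ((h ^^ j) w) = (h ^^ j) ((h ^^ k) w)"
proof -
  have "h ^^ (k + j) = h ^^ (j + k)" by (simp add: add.commute)
  then show ?thesis by (simp only: funpow_add o_def fun_eq_iff)
qed

text \<open>One return time \<open>k \<ge> 1\<close> per tolerance suffices: passing to powers of
  \<open>h\<close> yields arbitrarily late returns, as in \<open>recurrent_large\<close>.\<close>

definition recurrent :: "('a \<Rightarrow> 'a) \<Rightarrow> 'a \<Rightarrow> bool" where
  "recurrent h w \<longleftrightarrow> (\<forall>e>0. \<exists>k\<ge>1. N ((h ^^ k) w - w) < e)"

definition orbit_closure :: "('a \<Rightarrow> 'a) \<Rightarrow> 'a \<Rightarrow> 'a set" where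
  "orbit_closure h w = closure (range (\<lambda>k. (h ^^ k) w))"

lemma orbit_closure_iff:
  "u \<in> orbit_closure h w \<longleftrightarrow> (\<forall>e>0. \<exists>k. N ((h ^^ k) w - u) < e)"
proof
  assume u: "u \<in> orbit_closure h w"
  obtain K where K: "K > 0" "\<And>x. N x \<le> K * norm x" using N_le_norm by blast
  show "\<forall>e>0. \<exists>k. N ((h ^^ k) w - u) < e"
  proof (intro allI impI)
    fix e :: real assume "e > 0"
    then have "e / K > 0" using K by simp
    then obtain k where "dist ((h ^^ k) w) u < e / K"
      using u unfolding orbit_closure_def closure_approachable by blast
    then have "K * norm ((h ^^ k) w - u) < e" using K by (simp add: dist_norm field_simps)
    then have "N ((h ^^ k) w - u) < e" using K(2)[of "(h ^^ k) w - u"] by linarith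
    then show "\<exists>k. N ((h ^^ k) w - u) < e" by blast
  qed
next
  assume u: "\<forall>e>0. \<exists>k. N ((h ^^ k) w - u) < e"
  obtain K where K: "K > 0" "\<And>x. norm x \<le> K * N x" using norm_le_N by blast
  show "u \<in> orbit_closure h w"
    unfolding orbit_closure_def closure_approachable
  proof (intro allI impI)
    fix e :: real assume "e > 0"
    then have "e / K > 0" using K by simp
    then obtain k where "N ((h ^^ k) w - u) < e / K" using u by blast
    then have "K * N ((h ^^ k) w - u) < e" using K by (simp add: field_simps)
    then have "dist ((h ^^ k) w) u < e" using K(2)[of "(h ^^ k) w - u"] by (simp add: dist_norm)
    then show "\<exists>y\<in>range (\<lambda>k. (h ^^ k) w). dist y u < e" by blast
  qed
qed

lemma orbit_in_orbit_closure: "(h ^^ k) w \<in> orbit_closure h w"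
  unfolding orbit_closure_def by (meson closure_subset rangeI subsetD)

lemma self_in_orbit_closure: "w \<in> orbit_closure h w"
  using orbit_in_orbit_closure[where k = 0] by simp

lemma orbit_closure_invariant:
  assumes h: "nonexp h" and u: "u \<in> orbit_closure h w"
  shows "(h ^^ j) u \<in> orbit_closure h w"
  unfolding orbit_closure_iff
proof (intro allI impI)
  fix e :: real assume "e > 0"
  then obtain k where k: "N ((h ^^ k) w - u) < e" using u orbit_closure_iff by blast
  have "N ((h ^^ j) ((h ^^ k) w) - (h ^^ j) u) \<le> N ((h ^^ k) w - u)"
    by (rule nonexpD[OF nonexp_funpow[OF h]])
  then have "N ((h ^^ (j + k)) w - (h ^^ j) u) < e" using k by (simp add: funpow_add)
  then show "\<exists>k. N ((h ^^ k) w - (h ^^ j) u) < e" by blast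
qed

lemma orbit_closure_trans:
  assumes h: "nonexp h" and v: "v \<in> orbit_closure h w" and u: "u \<in> orbit_closure h v"
  shows "u \<in> orbit_closure h w"
proof -
  have "range (\<lambda>k. (h ^^ k) v) \<subseteq> orbit_closure h w"
    using orbit_closure_invariant[OF h v] by auto
  then have "orbit_closure h v \<subseteq> orbit_closure h w"
    unfolding orbit_closure_def by (intro closure_minimal) auto
  then show ?thesis using u by auto
qed

text \<open>Powers of \<open>h\<close> commute, so \<open>h ^^ j\<close> carries the displacement of
  \<open>w\<close> under \<open>h ^^ k\<close> to that of \<open>(h ^^ j) w\<close> without
  enlarging it; the bound then passes to limits of the orbit.\<close>

lemma displacement_le:
  assumes h: "nonexp h" and u: "u \<in> orbit_closure h w"
  shows "N ((h ^^ k) u - u) \<le> N ((h ^^ k) w - w)"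
proof (rule field_le_epsilon)
  fix e :: real assume "e > 0"
  then have "e / 2 > 0" by simp
  then obtain j where j: "N ((h ^^ j) w - u) < e / 2" using u orbit_closure_iff by blast
  have "N ((h ^^ k) u - u)
     \<le> N ((h ^^ k) u - (h ^^ k) ((h ^^ j) w)) + N ((h ^^ k) ((h ^^ j) w) - (h ^^ j) w)
       + N ((h ^^ j) w - u)"
    by (rule N_diff_triangle4)
  also have "N ((h ^^ k) u - (h ^^ k) ((h ^^ j) w)) \<le> N (u - (h ^^ j) w)"
    by (rule nonexpD[OF nonexp_funpow[OF h]])
  also have "(h ^^ k) ((h ^^ j) w) = (h ^^ j) ((h ^^ k) w)"
    by (rule funpow_commute)
  also have "N ((h ^^ j) ((h ^^ k) w) - (h ^^ j) w) \<le> N ((h ^^ k) w - w)"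
    by (rule nonexpD[OF nonexp_funpow[OF h]])
  finally show "N ((h ^^ k) u - u) \<le> N ((h ^^ k) w - w) + e"
    using j N_commute[of u "(h ^^ j) w"] by simp
qed

lemma displacement_mult_le:
  assumes h: "nonexp h"
  shows "N ((h ^^ (k * m)) w - w) \<le> m * N ((h ^^ k) w - w)"
proof (induction m)
  case (Suc m)
  have "N ((h ^^ (k * Suc m)) w - w)
      \<le> N ((h ^^ (k * m)) ((h ^^ k) w) - (h ^^ (k * m)) w) + N ((h ^^ (k * m)) w - w)"
    using N_diff_triangle[of "(h ^^ (k * m)) ((h ^^ k) w)" w "(h ^^ (k * m)) w"]
      funpow_add[of "k * m" k h] by (simp add: add.commute)
  also have "N ((h ^^ (k * m)) ((h ^^ k) w) - (h ^^ (k * m)) w) \<le> N ((h ^^ k) w - w)"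
    by (rule nonexpD[OF nonexp_funpow[OF h]])
  finally show ?case using Suc.IH by (simp add: algebra_simps)
qed simp

lemma recurrent_orbit_closure:
  assumes "nonexp h" "recurrent h w" "u \<in> orbit_closure h w"
  shows "recurrent h u"
  unfolding recurrent_def
proof (intro allI impI)
  fix e :: real assume "e > 0"
  then obtain k where "k \<ge> 1" "N ((h ^^ k) w - w) < e" using assms(2) recurrent_def by blast
  then show "\<exists>k\<ge>1. N ((h ^^ k) u - u) < e"
    using displacement_le[OF assms(1,3), of k] by (intro exI[of _ k]) simp
qed

lemma recurrent_funpow:
  assumes h: "nonexp h" and w: "recurrent h w" and m: "m \<ge> 1"
  shows "recurrent (h ^^ m) w"
  unfolding recurrent_def
proof (intro allI impI)
  fix e :: real assume "e > 0"
  then have "e / m > 0" using m by simp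
  then obtain k where k: "k \<ge> 1" "N ((h ^^ k) w - w) < e / m" using w recurrent_def by blast
  have "N ((h ^^ (k * m)) w - w) \<le> m * N ((h ^^ k) w - w)"
    by (rule displacement_mult_le[OF h])
  also have "\<dots> < e" using k m by (simp add: field_simps)
  finally show "\<exists>k\<ge>1. N (((h ^^ m) ^^ k) w - w) < e"
    using k by (auto simp: funpow_mult mult.commute)
qed

lemma recurrent_large:
  assumes h: "nonexp h" and w: "recurrent h w" and e: "e > 0"
  shows "\<exists>k\<ge>n. N ((h ^^ k) w - w) < e"
proof -
  have "recurrent (h ^^ Suc n) w" by (rule recurrent_funpow[OF h w]) simp
  then obtain k where "k \<ge> 1" "N (((h ^^ Suc n) ^^ k) w - w) < e" using e recurrent_def by blast
  moreover have "n \<le> Suc n * k" using mult_le_mono2[OF \<open>k \<ge> 1\<close>, of "Suc n"] by simp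
  ultimately show ?thesis
    by (intro exI[of _ "Suc n * k"]) (simp only: funpow_mult simp_thms)
qed

text \<open>After passing near \<open>u\<close> at time \<open>k\<close>, the orbit of
  \<open>w\<close> comes back to \<open>w\<close> at a later time \<open>n\<close>; so
  \<open>n - k\<close> steps from \<open>u\<close> lead near \<open>w\<close>.\<close>

lemma orbit_closure_sym:
  assumes h: "nonexp h" and w: "recurrent h w" and u: "u \<in> orbit_closure h w"
  shows "w \<in> orbit_closure h u"
  unfolding orbit_closure_iff
proof (intro allI impI)
  fix e :: real assume "e > 0"
  then have e2: "e / 2 > 0" by simp
  then obtain k where k: "N ((h ^^ k) w - u) < e / 2" using u orbit_closure_iff by blast
  obtain n where n: "n \<ge> k" "N ((h ^^ n) w - w) < e / 2" using recurrent_large[OF h w e2] by blast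
  have "(h ^^ n) w = (h ^^ (n - k)) ((h ^^ k) w)"
    using n(1) funpow_add[of "n - k" k h] by simp
  then have "N ((h ^^ (n - k)) u - (h ^^ n) w) \<le> N (u - (h ^^ k) w)"
    using nonexpD[OF nonexp_funpow[OF h], of "n - k" u "(h ^^ k) w"] by simp
  then have "N ((h ^^ (n - k)) u - w) < e"
    using N_diff_triangle[of "(h ^^ (n - k)) u" w "(h ^^ n) w"] n k N_commute[of u "(h ^^ k) w"]
    by linarith
  then show "\<exists>k. N ((h ^^ k) u - w) < e" by blast
qed

text \<open>By \<open>displacement_le\<close> a late return \<open>h ^^ n\<close> hardly moves any
  point of the closure, and it factors through \<open>h ^^ j\<close>; so \<open>h ^^ j\<close>
  cannot have shortened a distance.\<close>

lemma isometric_on_orbit_closure: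
  assumes h: "nonexp h" and w: "recurrent h w"
    and u: "u \<in> orbit_closure h w" and v: "v \<in> orbit_closure h w"
  shows "N ((h ^^ j) u - (h ^^ j) v) = N (u - v)"
proof (rule antisym)
  show "N ((h ^^ j) u - (h ^^ j) v) \<le> N (u - v)" by (rule nonexpD[OF nonexp_funpow[OF h]])
  show "N (u - v) \<le> N ((h ^^ j) u - (h ^^ j) v)"
  proof (rule field_le_epsilon)
    fix e :: real assume "e > 0"
    then have e2: "e / 2 > 0" by simp
    obtain n where n: "n \<ge> j" "N ((h ^^ n) w - w) < e / 2" using recurrent_large[OF h w e2] by blast
    have eq: "(h ^^ n) x = (h ^^ (n - j)) ((h ^^ j) x)" for x
      using n(1) funpow_add[of "n - j" j h] by simp
    have "N (u - v) \<le> N (u - (h ^^ n) u) + N ((h ^^ n) u - (h ^^ n) v) + N ((h ^^ n) v - v)"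
      by (rule N_diff_triangle4)
    also have "N ((h ^^ n) u - (h ^^ n) v) \<le> N ((h ^^ j) u - (h ^^ j) v)"
      unfolding eq by (rule nonexpD[OF nonexp_funpow[OF h]])
    also have "N (u - (h ^^ n) u) \<le> e / 2"
      using displacement_le[OF h u, of n] n N_commute[of u] by simp
    also have "N ((h ^^ n) v - v) \<le> e / 2"
      using displacement_le[OF h v, of n] n by simp
    finally show "N (u - v) \<le> N ((h ^^ j) u - (h ^^ j) v) + e" by simp
  qed
qed

lemma orbit_bounded:
  assumes h: "nonexp h" and x0: "h x0 = x0"
  shows "N ((h ^^ k) w - x0) \<le> N (w - x0)"
proof -
  have "(h ^^ k) x0 = x0" by (induction k) (auto simp: x0)
  then show ?thesis using nonexpD[OF nonexp_funpow[OF h], of k w x0] by simp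
qed

lemma compact_orbit_closure:
  assumes h: "nonexp h" and x0: "h x0 = x0"
  shows "compact (orbit_closure h w)"
proof -
  obtain K where K: "K > 0" "\<And>x. norm x \<le> K * N x" using norm_le_N by blast
  have "norm ((h ^^ k) w) \<le> norm x0 + K * N (w - x0)" for k
  proof -
    have "norm ((h ^^ k) w - x0) \<le> K * N ((h ^^ k) w - x0)" by (rule K)
    also have "\<dots> \<le> K * N (w - x0)" using K orbit_bounded[of h x0, OF h x0] by (intro mult_left_mono) auto
    finally show ?thesis using norm_triangle_sub[of "(h ^^ k) w" x0] by linarith
  qed
  then have "bounded (range (\<lambda>k. (h ^^ k) w))" unfolding bounded_iff by blast
  then show ?thesis unfolding orbit_closure_def compact_closure .
qed

end

lemma finite_common_radius:
  assumes "finite A" "\<And>a. a \<in> A \<Longrightarrow> \<exists>r>0::real. \<forall>u. d u < r \<longrightarrow> Q a u"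
  shows "\<exists>r>0. \<forall>a\<in>A. \<forall>u. d u < r \<longrightarrow> Q a u"
  using assms
proof (induction A rule: finite_induct)
  case empty
  show ?case by (intro exI[of _ 1]) auto
next
  case (insert a A)
  then obtain r where r: "r > 0" "\<forall>a\<in>A. \<forall>u. d u < r \<longrightarrow> Q a u" by auto
  obtain s where s: "s > 0" "\<forall>u. d u < s \<longrightarrow> Q a u" using insert.prems[of a] by auto
  show ?case using r s by (intro exI[of _ "min r s"]) auto
qed

context polyhedral_norm
begin

text \<open>If \<open>(u, v)\<close> realises the diameter of the orbit closure, two of the pairs \<open>(h\<^sup>j u, h\<^sup>j v)\<close>, \<open>j \<le> card P\<close>, are normed by the same
  functional, so \<open>(h\<^sup>l u, v)\<close> realises it as well for some \<open>1 \<le> l \<le> card P\<close>. Iterating,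
  \<open>u\<close> can be moved close to \<open>v\<close>.\<close>

lemma diameter_orbit_closure_le:
  assumes h: "nonexp h" and x0: "h x0 = x0" and w: "recurrent h w"
    and u: "u \<in> orbit_closure h w" and v: "v \<in> orbit_closure h w"
  shows "N (u - v) \<le> card P * N (h w - w)"
proof -
  let ?C = "orbit_closure h w"
  have "\<exists>p\<in>?C \<times> ?C. \<forall>q\<in>?C \<times> ?C. N (fst q - snd q) \<le> N (fst p - snd p)"
    using u v
    by (intro continuous_attains_sup compact_Times compact_orbit_closure[of h x0, OF h x0]
        continuous_intros) auto
  then obtain v0 u0 where uv0: "v0 \<in> ?C" "u0 \<in> ?C"
    and max: "\<And>x y. x \<in> ?C \<Longrightarrow> y \<in> ?C \<Longrightarrow> N (x - y) \<le> N (v0 - u0)"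
    by (metis fst_conv snd_conv SigmaE mem_Sigma_iff)
  define D where "D = N (v0 - u0)"
  have step: "\<exists>l\<in>{1..card P}. N (v0 - (h ^^ l) x) = D"
    if x: "x \<in> ?C" "N (v0 - x) = D" for x
  proof -
    have inC: "(h ^^ j) v0 \<in> ?C" "(h ^^ j) x \<in> ?C" for j
      using orbit_closure_invariant[OF h] uv0 x by auto
    have "\<exists>a\<in>P. ((h ^^ j) v0 - (h ^^ j) x) \<bullet> a = D" for j
      using N_attained[of "(h ^^ j) v0 - (h ^^ j) x"]
        isometric_on_orbit_closure[OF h w uv0(1) x(1), of j] x(2) by simp
    then obtain \<phi> where \<phi>: "\<And>j. \<phi> j \<in> P" "\<And>j. ((h ^^ j) v0 - (h ^^ j) x) \<bullet> \<phi> j = D" by metis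
    have "card (\<phi> ` {..card P}) \<le> card P" using \<phi>(1) finite_P by (intro card_mono) auto
    then have "\<not> inj_on \<phi> {..card P}" by (intro pigeonhole) simp
    then obtain a b where ab: "a < b" "b \<le> card P" "\<phi> a = \<phi> b"
      by (auto simp: inj_on_def) (metis linorder_neqE_nat)
    \<comment> \<open>Under the shared functional the two crossed differences sum to
      \<open>2 * D\<close>, while neither exceeds the diameter \<open>D\<close>; hence both equal
      \<open>D\<close>.\<close>
    have "((h ^^ a) v0 - (h ^^ b) x) \<bullet> \<phi> a \<le> N ((h ^^ a) v0 - (h ^^ b) x)"
         "((h ^^ b) v0 - (h ^^ a) x) \<bullet> \<phi> a \<le> N ((h ^^ b) v0 - (h ^^ a) x)"
      by (rule inner_le_N[OF \<phi>(1)])+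
    moreover have "N ((h ^^ a) v0 - (h ^^ b) x) \<le> D" "N ((h ^^ b) v0 - (h ^^ a) x) \<le> D"
      unfolding D_def using max inC by auto
    moreover have "((h ^^ a) v0 - (h ^^ a) x) \<bullet> \<phi> a = D" "((h ^^ b) v0 - (h ^^ b) x) \<bullet> \<phi> a = D"
      using \<phi>(2)[of a] \<phi>(2)[of b] ab(3) by auto
    ultimately have "N ((h ^^ a) v0 - (h ^^ b) x) = D"
      by (simp add: inner_diff_left)
    moreover have "(h ^^ b) x = (h ^^ a) ((h ^^ (b - a)) x)"
      using ab(1) funpow_add[of a "b - a" h] by simp
    ultimately have "N (v0 - (h ^^ (b - a)) x) = D"
      using isometric_on_orbit_closure[OF h w uv0(1) inC(2)[of "b - a"], of a] by simp
    then show ?thesis using ab by (intro bexI[of _ "b - a"]) auto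
  qed
  \<comment> \<open>The jumps given by \<open>step\<close> have length at most
    \<open>card P\<close>, so below every time \<open>j\<close> there is a suitable \<open>L\<close>
    within \<open>card P\<close> of it. When \<open>(h ^^ j) u0\<close> is close to
    \<open>v0\<close>, at most \<open>card P\<close> orbit steps account for
    \<open>D\<close>.\<close>
  have follow: "\<exists>L\<le>j. j - L \<le> card P \<and> N (v0 - (h ^^ L) u0) = D" for j
  proof (induction j)
    case 0
    show ?case by (intro exI[of _ 0]) (simp add: D_def)
  next
    case (Suc j)
    then obtain L where L: "L \<le> j" "j - L \<le> card P" "N (v0 - (h ^^ L) u0) = D" by blast
    show ?case
    proof (cases "Suc j - L \<le> card P")
      case True
      then show ?thesis using L by (intro exI[of _ L]) auto
    next
      case False
      obtain l where l: "l \<in> {1..card P}" "N (v0 - (h ^^ l) ((h ^^ L) u0)) = D"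
        using step[OF orbit_closure_invariant[OF h uv0(2)] L(3)] by blast
      then have "N (v0 - (h ^^ (l + L)) u0) = D" by (simp add: funpow_add)
      then show ?thesis using l False L by (intro exI[of _ "l + L"]) auto
    qed
  qed
  have "D \<le> card P * N (h w - w)"
  proof (rule field_le_epsilon)
    fix e :: real assume "e > 0"
    have "w \<in> orbit_closure h u0" by (rule orbit_closure_sym[OF h w uv0(2)])
    then have "v0 \<in> orbit_closure h u0" by (rule orbit_closure_trans[OF h _ uv0(1)])
    then obtain j where j: "N ((h ^^ j) u0 - v0) < e" using \<open>e > 0\<close> orbit_closure_iff by blast
    obtain L where L: "L \<le> j" "j - L \<le> card P" "N (v0 - (h ^^ L) u0) = D" using follow by blast
    have "(h ^^ j) u0 = (h ^^ L) ((h ^^ (j - L)) u0)"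
      using L(1) funpow_add[of L "j - L" h] by simp
    then have "N ((h ^^ j) u0 - (h ^^ L) u0) \<le> N ((h ^^ (j - L)) u0 - u0)"
      using nonexpD[OF nonexp_funpow[OF h], of L "(h ^^ (j - L)) u0" u0] by simp
    also have "\<dots> \<le> N ((h ^^ (j - L)) w - w)" by (rule displacement_le[OF h uv0(2)])
    also have "\<dots> \<le> real (j - L) * N (h w - w)"
      using displacement_mult_le[OF h, of 1 "j - L" w] by simp
    also have "\<dots> \<le> card P * N (h w - w)" using L(2) by (intro mult_right_mono) auto
    finally show "D \<le> card P * N (h w - w) + e"
      using L(3) j N_diff_triangle[of v0 "(h ^^ L) u0" "(h ^^ j) u0"] N_commute[of v0 "(h ^^ j) u0"]
      by linarith
  qed
  then show ?thesis using max[OF u v] D_def by simp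
qed

lemma inner_constant_on_orbit_closure:
  assumes "a \<in> P" "\<And>k. (h ^^ k) w \<bullet> a = w \<bullet> a" "u \<in> orbit_closure h w"
  shows "u \<bullet> a = w \<bullet> a"
proof -
  have "\<bar>u \<bullet> a - w \<bullet> a\<bar> \<le> 0"
  proof (rule field_le_epsilon)
    fix e :: real assume "e > 0"
    then obtain k where "N ((h ^^ k) w - u) < e" using assms(3) orbit_closure_iff by blast
    then show "\<bar>u \<bullet> a - w \<bullet> a\<bar> \<le> 0 + e"
      using abs_inner_le_N[OF assms(1), of "(h ^^ k) w - u"] assms(2)[of k]
      by (simp add: inner_diff_left)
  qed
  then show ?thesis by simp
qed

text \<open>Induction on the number of functionals that are not constant on the orbit: near a suitable
  orbit point some nonconstant functional stays at its minimum, and the orbit of a power of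
  \<open>h\<close> with short steps remains there.\<close>

theorem recurrent_imp_periodic:
  assumes "nonexp h" "h x0 = x0" "recurrent h w"
  shows "\<exists>k\<ge>1. (h ^^ k) w = w"
  using assms
proof (induction "card {a \<in> P. \<exists>k. (h ^^ k) w \<bullet> a \<noteq> w \<bullet> a}" arbitrary: h w rule: less_induct)
  case less
  note h = less.prems(1) and x0 = less.prems(2) and w = less.prems(3)
  let ?C = "orbit_closure h w"
  show ?case
  proof (cases "h w = w")
    case True
    then show ?thesis by (intro exI[of _ 1]) auto
  next
    case False
    have "\<exists>p\<in>?C \<times> ?C. \<forall>q\<in>?C \<times> ?C. N (fst q - snd q) \<le> N (fst p - snd p)"
      using self_in_orbit_closure[of w h]
      by (intro continuous_attains_sup compact_Times compact_orbit_closure[of h x0, OF h x0]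
        continuous_intros) auto
    then obtain v0 u0 where uv0: "v0 \<in> ?C" "u0 \<in> ?C"
      and max: "\<And>x y. x \<in> ?C \<Longrightarrow> y \<in> ?C \<Longrightarrow> N (x - y) \<le> N (v0 - u0)"
      by (metis fst_conv snd_conv SigmaE mem_Sigma_iff)
    define D where "D = N (v0 - u0)"
    have "D > 0"
      using max[OF orbit_in_orbit_closure[of 1] orbit_in_orbit_closure[of 0]] False
        N_pos_iff[of "h w - w"] by (simp add: D_def)
    \<comment> \<open>\<open>S\<close> describes the faces of the orbit closure through a point.
      Near a given point it can only shrink, so at an orbit point where its size is least it is
      locally constant along the orbit.\<close>
    define S where "S = (\<lambda>u. {a \<in> P. (\<exists>y\<in>?C. y \<bullet> a \<noteq> u \<bullet> a) \<and> (\<forall>y\<in>?C. u \<bullet> a \<le> y \<bullet> a)})"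
    have finS: "finite (S u)" for u unfolding S_def using finite_P by auto
    have uj: "(h ^^ j) u0 \<in> ?C" "(h ^^ j) v0 \<in> ?C" for j
      using orbit_closure_invariant[OF h] uv0 by auto
    have S_nonempty: "S ((h ^^ j) u0) \<noteq> {}" for j
    proof -
      have "N ((h ^^ j) v0 - (h ^^ j) u0) = D"
        using isometric_on_orbit_closure[OF h w uv0] by (simp add: D_def)
      then obtain a where a: "a \<in> P" "((h ^^ j) v0 - (h ^^ j) u0) \<bullet> a = D"
        using N_attained by metis
      have "(h ^^ j) u0 \<bullet> a \<le> y \<bullet> a" if "y \<in> ?C" for y
        using inner_le_N[OF a(1), of "(h ^^ j) v0 - y"] max[OF uj(2)[of j] that] a(2)
        by (simp add: D_def inner_diff_left)
      moreover have "(h ^^ j) v0 \<bullet> a \<noteq> (h ^^ j) u0 \<bullet> a"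
        using a(2) \<open>D > 0\<close> by (simp add: inner_diff_left)
      ultimately have "a \<in> S ((h ^^ j) u0)" unfolding S_def using a(1) uj by blast
      then show ?thesis by blast
    qed
    obtain j where j: "\<And>i. card (S ((h ^^ j) u0)) \<le> card (S ((h ^^ i) u0))"
      using ex_has_least_nat[of "\<lambda>_. True" 0 "\<lambda>j. card (S ((h ^^ j) u0))"] by auto
    define z where "z = (h ^^ j) u0"
    have zC: "z \<in> ?C" using uj z_def by simp
    have "\<exists>r>0. \<forall>a\<in>P. \<forall>u. N (u - z) < r \<longrightarrow> u \<in> ?C \<longrightarrow> a \<in> S u \<longrightarrow> a \<in> S z"
    proof (rule finite_common_radius[OF finite_P, where d = "\<lambda>u. N (u - z)"])
      fix a assume a: "a \<in> P"
      show "\<exists>r>0. \<forall>u. N (u - z) < r \<longrightarrow> u \<in> ?C \<longrightarrow> a \<in> S u \<longrightarrow> a \<in> S z"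
      proof (cases "\<exists>y\<in>?C. y \<bullet> a < z \<bullet> a")
        case True
        then obtain y where y: "y \<in> ?C" "y \<bullet> a < z \<bullet> a" by blast
        have "a \<notin> S u" if "N (u - z) < z \<bullet> a - y \<bullet> a" for u
          using that abs_inner_le_N[OF a, of "u - z"] y
          by (auto simp: S_def inner_diff_left intro!: bexI[of _ y])
        then show ?thesis using y by (intro exI[of _ "z \<bullet> a - y \<bullet> a"]) auto
      next
        case False
        have "a \<in> S z" if "a \<in> S u" "u \<in> ?C" for u
        proof -
          have "\<exists>y\<in>?C. y \<bullet> a \<noteq> z \<bullet> a"
          proof (cases "u \<bullet> a = z \<bullet> a")
            case True
            then show ?thesis using that(1) unfolding S_def by auto
          qed (use that(2) in blast)
          then show ?thesis using False a unfolding S_def by force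
        qed
        then show ?thesis by (intro exI[of _ 1]) auto
      qed
    qed
    then obtain r where r: "r > 0"
      "\<And>a u. N (u - z) < r \<Longrightarrow> u \<in> ?C \<Longrightarrow> a \<in> S u \<Longrightarrow> a \<in> S z"
      unfolding S_def by blast
    have S_eq: "S ((h ^^ i) u0) = S z" if "N ((h ^^ i) u0 - z) < r" for i
    proof (rule card_seteq[OF finS])
      show "S ((h ^^ i) u0) \<subseteq> S z" using r(2)[OF that uj(1)] by blast
      show "card (S z) \<le> card (S ((h ^^ i) u0))" unfolding z_def by (rule j)
    qed
    have u0r: "recurrent h u0" by (rule recurrent_orbit_closure[OF h w uv0(2)])
    have "card P > 0" using finite_P nonempty_P by (simp add: card_gt_0_iff)
    then have "r / card P > 0" using r by simp
    \<comment> \<open>By \<open>diameter_orbit_closure_le\<close> an orbit of \<open>h ^^ m\<close>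
      has diameter at most \<open>card P\<close> times its first step, so this \<open>m\<close>
      keeps it within \<open>r\<close> of \<open>z\<close>. The step is measured at
      \<open>u0\<close>; \<open>displacement_le\<close> transfers it to \<open>z\<close>.\<close>
    then obtain m where m: "m \<ge> 1" "N ((h ^^ m) u0 - u0) < r / card P"
      using u0r unfolding recurrent_def by blast
    define g where "g = h ^^ m"
    have g: "nonexp g" unfolding g_def by (rule nonexp_funpow[OF h])
    have gx0: "g x0 = x0" unfolding g_def by (induction m) (auto simp: x0)
    have zr: "recurrent g z"
      unfolding g_def using recurrent_funpow[OF h recurrent_orbit_closure[OF h w zC] m(1)] .
    have gz: "(g ^^ l) z = (h ^^ (m * l + j)) u0" for l
      unfolding g_def z_def by (simp add: funpow_mult funpow_add)
    have near: "N ((g ^^ l) z - z) < r" for l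
    proof -
      have "N ((g ^^ l) z - z) \<le> card P * N (g z - z)"
        by (rule diameter_orbit_closure_le[OF g gx0 zr orbit_in_orbit_closure self_in_orbit_closure])
      also have "N (g z - z) \<le> N (g u0 - u0)"
      proof -
        have "z \<in> orbit_closure h u0" unfolding z_def by (rule orbit_in_orbit_closure)
        from displacement_le[OF h this, of m] show ?thesis by (simp add: g_def)
      qed
      finally have "N ((g ^^ l) z - z) \<le> card P * N (g u0 - u0)" by (simp add: mult_left_mono)
      then show ?thesis using m(2) \<open>card P > 0\<close> by (simp add: g_def field_simps)
    qed
    obtain a where a: "a \<in> S z" using S_nonempty z_def by blast
    have const: "(g ^^ l) z \<bullet> a = z \<bullet> a" for l
    proof -
      have "S ((g ^^ l) z) = S z" using S_eq[of "m * l + j"] near[of l] gz by simp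
      then have "a \<in> S ((g ^^ l) z)" using a by simp
      moreover have "(g ^^ l) z \<in> ?C" unfolding gz by (rule uj)
      ultimately show ?thesis using a zC unfolding S_def by (auto intro: antisym)
    qed
    \<comment> \<open>Passing to the orbit of \<open>z\<close> under \<open>g\<close> creates no new
      varying functional, and it freezes \<open>a\<close>, which varies on the old orbit: the
      induction measure drops.\<close>
    have "{a \<in> P. \<exists>k. (g ^^ k) z \<bullet> a \<noteq> z \<bullet> a} \<subset> {a \<in> P. \<exists>k. (h ^^ k) w \<bullet> a \<noteq> w \<bullet> a}"
    proof (rule psubsetI)
      show "{a \<in> P. \<exists>k. (g ^^ k) z \<bullet> a \<noteq> z \<bullet> a} \<subseteq> {a \<in> P. \<exists>k. (h ^^ k) w \<bullet> a \<noteq> w \<bullet> a}"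
      proof (rule ccontr)
        assume "\<not> ?thesis"
        then obtain b k where b: "b \<in> P" "(g ^^ k) z \<bullet> b \<noteq> z \<bullet> b" "\<And>k. (h ^^ k) w \<bullet> b = w \<bullet> b"
          by blast
        have "(g ^^ k) z \<in> ?C" unfolding gz by (rule uj)
        then show False using inner_constant_on_orbit_closure[OF b(1,3)] zC b(2) by metis
      qed
      obtain y where y: "y \<in> ?C" "y \<bullet> a \<noteq> z \<bullet> a" "a \<in> P" using a unfolding S_def by blast
      have "\<exists>k. (h ^^ k) w \<bullet> a \<noteq> w \<bullet> a"
        using inner_constant_on_orbit_closure[OF y(3)] y zC by metis
      then show "{a \<in> P. \<exists>k. (g ^^ k) z \<bullet> a \<noteq> z \<bullet> a} \<noteq> {a \<in> P. \<exists>k. (h ^^ k) w \<bullet> a \<noteq> w \<bullet> a}"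
        using const y(3) by blast
    qed
    then have "card {a \<in> P. \<exists>k. (g ^^ k) z \<bullet> a \<noteq> z \<bullet> a} < card {a \<in> P. \<exists>k. (h ^^ k) w \<bullet> a \<noteq> w \<bullet> a}"
      using finite_P by (intro psubset_card_mono) auto
    from less.hyps[OF this g gx0 zr] obtain k where k: "k \<ge> 1" "(g ^^ k) z = z" by blast
    \<comment> \<open>\<open>w\<close> lies in the orbit closure of \<open>z\<close> by symmetry, so
      its displacement is bounded by that of \<open>z\<close>, which is zero.\<close>
    have "(h ^^ (m * k)) z = z" using k(2) unfolding g_def by (simp add: funpow_mult)
    then have "N ((h ^^ (m * k)) w - w) \<le> 0"
      using displacement_le[OF h orbit_closure_sym[OF h w zC], of "m * k"] by simp
    then have "(h ^^ (m * k)) w = w" using N_eq_0_iff[of "(h ^^ (m * k)) w - w"] N_nonneg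
      by (metis eq_iff_diff_eq_0 order_antisym)
    then show ?thesis using k m by (intro exI[of _ "m * k"]) auto
  qed
qed

text \<open>Compactness gives a convergent subsequence of the orbit; the gap between two consecutive
  late indices is a return time for its limit.\<close>

lemma recurrent_limit_point:
  assumes h: "nonexp h" and x0: "h x0 = x0"
  shows "\<exists>y. recurrent h y \<and> y \<in> orbit_closure h x"
proof -
  let ?X = "\<lambda>k. (h ^^ k) x"
  have "\<exists>l\<in>orbit_closure h x. \<exists>r. strict_mono r \<and> (?X \<circ> r) \<longlonglongrightarrow> l"
    using compact_orbit_closure[of h x0, OF h x0, of x] orbit_in_orbit_closure[of _ h x]
    unfolding compact_def by (auto dest!: spec[of _ ?X])
  then obtain y r where y: "y \<in> orbit_closure h x" and r: "strict_mono r" "(?X \<circ> r) \<longlonglongrightarrow> y" by blast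
  have lim: "(\<lambda>n. N (?X (r n) - y)) \<longlonglongrightarrow> 0" using r(2) tendsto_iff_N[of "?X \<circ> r"] by simp
  have "recurrent h y"
    unfolding recurrent_def
  proof (intro allI impI)
    fix e :: real assume "e > 0"
    then have "e / 2 > 0" by simp
    then obtain n where n: "\<And>i. i \<ge> n \<Longrightarrow> N (?X (r i) - y) < e / 2"
      using order_tendstoD(2)[OF lim] unfolding eventually_sequentially by blast
    define k where "k = r (Suc n) - r n"
    have rr: "r n < r (Suc n)" using r(1) by (simp add: strict_mono_Suc_iff)
    then have "(h ^^ k) (?X (r n)) = ?X (r (Suc n))"
      using funpow_add[of k "r n" h] unfolding k_def by simp
    then have "N ((h ^^ k) y - ?X (r (Suc n))) \<le> N (y - ?X (r n))"
      using nonexpD[OF nonexp_funpow[OF h], of k y "?X (r n)"] by simp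
    then have "N ((h ^^ k) y - y) < e"
      using n[of n] n[of "Suc n"] N_commute[of y "?X (r n)"]
        N_diff_triangle[of "(h ^^ k) y" y "?X (r (Suc n))"] by simp
    moreover have "k \<ge> 1" using rr k_def by simp
    ultimately show "\<exists>k\<ge>1. N ((h ^^ k) y - y) < e" by blast
  qed
  then show ?thesis using y by blast
qed

text \<open>Some limit point is recurrent, hence fixed. The distance of an orbit to a fixed point
  never grows, so one close visit already forces convergence.\<close>

lemma convergent_iterates:
  assumes h: "nonexp h" and x0: "h x0 = x0" and rec: "\<And>y. recurrent h y \<Longrightarrow> h y = y"
  shows "\<exists>y. h y = y \<and> (\<lambda>k. (h ^^ k) x) \<longlonglongrightarrow> y"
proof -
  obtain y where y: "recurrent h y" "y \<in> orbit_closure h x"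
    using recurrent_limit_point[of h x0, OF h x0] by blast
  have hy: "h y = y" by (rule rec[OF y(1)])
  have "(\<lambda>k. N ((h ^^ k) x - y)) \<longlonglongrightarrow> 0"
  proof (rule LIMSEQ_I)
    fix e :: real assume "e > 0"
    then obtain n where n: "N ((h ^^ n) x - y) < e" using y(2) orbit_closure_iff by blast
    have "N ((h ^^ k) x - y) < e" if "k \<ge> n" for k
    proof -
      have "(h ^^ k) x = (h ^^ (k - n)) ((h ^^ n) x)"
        using that funpow_add[of "k - n" n h] by simp
      then show ?thesis using orbit_bounded[of h y, OF h hy, of "k - n" "(h ^^ n) x"] n by simp
    qed
    then show "\<exists>no. \<forall>k\<ge>no. norm (N ((h ^^ k) x - y) - 0) < e" by (intro exI[of _ n]) simp
  qed
  then show ?thesis using hy tendsto_iff_N[of "\<lambda>k. (h ^^ k) x"] by blast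
qed

section \<open>Averaged maps and the retraction onto fixed points\<close>

definition average :: "('a \<Rightarrow> 'a) \<Rightarrow> 'a \<Rightarrow> 'a" where
  "average g x = (1/2) *\<^sub>R (g x + x)"

lemma average_fixed_iff: "average g x = x \<longleftrightarrow> g x = x"
proof -
  have "average g x = x \<longleftrightarrow> g x + x = 2 *\<^sub>R x"
    unfolding average_def
    by (metis (no_types, lifting) divide_self_if mult_1 nonzero_divide_eq_eq scaleR_scaleR
        scaleR_one times_divide_eq_left zero_neq_numeral mult.commute)
  then show ?thesis by (simp add: scaleR_2)
qed

lemma nonexp_average:
  assumes g: "nonexp g" shows "nonexp (average g)"
  unfolding nonexp_def
proof (intro allI)
  fix x y
  have "average g x - average g y = (1/2) *\<^sub>R ((g x - g y) + (x - y))"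
    unfolding average_def by (simp add: algebra_simps)
  then have "N (average g x - average g y) = (1/2) * N ((g x - g y) + (x - y))" by simp
  also have "\<dots> \<le> N (x - y)"
    using N_add_le[of "g x - g y" "x - y"] nonexpD[OF g, of x y] by simp
  finally show "N (average g x - average g y) \<le> N (x - y)" .
qed

text \<open>A recurrent point moves by a constant amount at every step; a functional norming the last
  displacement norms all the earlier ones, so the orbit would escape linearly.\<close>

lemma recurrent_average_fixed:
  assumes g: "nonexp g" and x0: "g x0 = x0" and y: "recurrent (average g) y"
  shows "g y = y"
proof -
  let ?h = "average g"
  define Y where "Y = (\<lambda>k. (?h ^^ k) y)"
  define d where "d = N (?h y - y)"
  have h: "nonexp ?h" by (rule nonexp_average[OF g])
  have hx0: "?h x0 = x0" using x0 average_fixed_iff by blast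
  have step: "N (Y (Suc k) - Y k) = d" for k
    using isometric_on_orbit_closure[OF h y orbit_in_orbit_closure[of 1] orbit_in_orbit_closure[of 0], of k]
    unfolding Y_def d_def by (simp add: funpow_swap1)
  have gY: "g (Y k) = Y (Suc k) + (Y (Suc k) - Y k)" for k
  proof -
    have "Y (Suc k) = (1/2) *\<^sub>R (g (Y k) + Y k)" by (simp add: Y_def average_def)
    then have "2 *\<^sub>R Y (Suc k) = g (Y k) + Y k" by simp
    then show ?thesis by (simp add: scaleR_2 algebra_simps)
  qed
  have lower: "real (Suc m) * d \<le> N (Y (Suc m) - Y 0)" for m
  proof -
    obtain a where a: "a \<in> P" "(Y (Suc m) - Y m) \<bullet> a = d" using N_attained step by metis
    have all: "(Y (Suc k) - Y k) \<bullet> a = d" if "k \<le> m" for k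
      using that
    proof (induction rule: inc_induct)
      case base
      show ?case by (rule a)
    next
      case (step k)
      \<comment> \<open>Twice the step at \<open>Suc k\<close> is a difference of
        \<open>g\<close>-values plus the step at \<open>k\<close>, each of norm at most
        \<open>d\<close>, so each is worth exactly \<open>d\<close> under \<open>a\<close>. The
        induction runs downwards from the last step \<open>m\<close>.\<close>
      have "g (Y (Suc k)) - Y (Suc k) = 2 *\<^sub>R (Y (Suc (Suc k)) - Y (Suc k))"
        using gY[of "Suc k"] by (simp add: algebra_simps scaleR_2)
      then have "(g (Y (Suc k)) - Y (Suc k)) \<bullet> a = 2 * d" using step.IH by simp
      moreover have "g (Y (Suc k)) - Y (Suc k) = (g (Y (Suc k)) - g (Y k)) + (Y (Suc k) - Y k)"
        using gY[of k] by simp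
      moreover have "(g (Y (Suc k)) - g (Y k)) \<bullet> a \<le> d"
        using inner_le_N[OF a(1)] nonexpD[OF g] \<open>\<And>k. N (Y (Suc k) - Y k) = d\<close> order_trans by metis
      moreover have "(Y (Suc k) - Y k) \<bullet> a \<le> d"
        using inner_le_N[OF a(1)] \<open>\<And>k. N (Y (Suc k) - Y k) = d\<close> by metis
      ultimately show ?case by (simp add: inner_add_left)
    qed
    have "(Y n - Y 0) \<bullet> a = real n * d" if "n \<le> Suc m" for n
      using that
    proof (induction n)
      case (Suc n)
      then show ?case using all[of n] by (simp add: inner_diff_left algebra_simps)
    qed simp
    from this[of "Suc m"] show ?thesis using inner_le_N[OF a(1), of "Y (Suc m) - Y 0"] by simp
  qed
  have "N (Y m - Y 0) \<le> 2 * N (y - x0)" for m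
    using N_diff_triangle[of "Y m" "Y 0" x0] orbit_bounded[of ?h x0, OF h hx0, of m y] N_commute[of x0 y]
    by (simp add: Y_def)
  then have bound: "real (Suc m) * d \<le> 2 * N (y - x0)" for m
    using lower[of m] order_trans by blast
  have "d = 0"
  proof (rule ccontr)
    assume "d \<noteq> 0"
    then have "d > 0" unfolding d_def using N_nonneg by (metis less_eq_real_def)
    then obtain m where "2 * N (y - x0) < real m * d" using reals_Archimedean3 by blast
    then show False using bound[of m] \<open>d > 0\<close> by (simp add: algebra_simps)
  qed
  then show ?thesis using average_fixed_iff[of g y] by (simp add: d_def)
qed

text \<open>Iterates of \<open>g\<close> itself may cycle, as those of \<open>- id\<close> do. Those
  of the average converge because its recurrent points are fixed.\<close>

lemma average_retraction:
  assumes g: "nonexp g" and x0: "g x0 = x0"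
  obtains R where "\<And>x. (\<lambda>k. (average g ^^ k) x) \<longlonglongrightarrow> R x" "\<And>x. g (R x) = R x"
    "\<And>x. g x = x \<Longrightarrow> R x = x" "nonexp R"
proof -
  have h: "nonexp (average g)" by (rule nonexp_average[OF g])
  have hx0: "average g x0 = x0" using x0 average_fixed_iff by blast
  have "\<exists>y. average g y = y \<and> (\<lambda>k. (average g ^^ k) x) \<longlonglongrightarrow> y" for x
    by (rule convergent_iterates[of _ x0, OF h hx0])
       (use recurrent_average_fixed[of g x0, OF g x0] average_fixed_iff in blast)
  then obtain R where R: "\<And>x. average g (R x) = R x" "\<And>x. (\<lambda>k. (average g ^^ k) x) \<longlonglongrightarrow> R x"
    by metis
  show ?thesis
  proof (rule that[OF R(2)])
    show "g (R x) = R x" for x using R(1) average_fixed_iff by blast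
    show "R x = x" if "g x = x" for x
    proof -
      have "average g x = x" using that average_fixed_iff by blast
      then have "(average g ^^ k) x = x" for k by (induction k) auto
      then have "(\<lambda>k. (average g ^^ k) x) \<longlonglongrightarrow> x" by simp
      then show ?thesis using R(2) LIMSEQ_unique by blast
    qed
    show "nonexp R"
      unfolding nonexp_def
    proof (intro allI)
      fix x y
      have "(\<lambda>k. N ((average g ^^ k) x - (average g ^^ k) y)) \<longlonglongrightarrow> N (R x - R y)"
        by (intro tendsto_N tendsto_diff R)
      then show "N (R x - R y) \<le> N (x - y)"
        by (rule LIMSEQ_le_const2) (use nonexpD[OF nonexp_funpow[OF h]] in blast)
    qed
  qed
qed

end

section \<open>Straight retractions\<close>

context polyhedral_norm
begin

section \<open>Functionals norming a ray\<close>

lemma norming_gap: "\<exists>g>0. \<forall>a\<in>P. a \<notin> norming e \<longrightarrow> e \<bullet> a + g \<le> N e"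
proof (cases "P - norming e = {}")
  case True
  then show ?thesis by (intro exI[of _ 1]) auto
next
  case False
  define M where "M = Max ((\<lambda>a. e \<bullet> a) ` (P - norming e))"
  have "M \<in> (\<lambda>a. e \<bullet> a) ` (P - norming e)"
    unfolding M_def using False finite_P by (intro Max_in) auto
  then obtain a where "a \<in> P" "a \<notin> norming e" "M = e \<bullet> a" by auto
  then have "M < N e" using inner_le_N[of a e] by (auto simp: norming_def)
  moreover have "e \<bullet> a \<le> M" if "a \<in> P" "a \<notin> norming e" for a
    unfolding M_def using that finite_P by (intro Max_ge) auto
  ultimately show ?thesis by (intro exI[of _ "N e - M"]) auto
qed

lemma N_ray_le: "\<forall>\<^sub>F t in at_top. \<exists>b\<in>norming e. N (t *\<^sub>R e + v) \<le> t * N e + v \<bullet> b"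
proof -
  obtain g where g: "g > 0" "\<And>a. a \<in> P \<Longrightarrow> a \<notin> norming e \<Longrightarrow> e \<bullet> a + g \<le> N e"
    using norming_gap by blast
  obtain b0 where b0: "b0 \<in> norming e" using norming_nonempty by blast
  \<comment> \<open>Two functionals differ on \<open>v\<close> by at most \<open>2 * N v\<close>.
    From \<open>t = 2 * N v / g\<close> on, this cannot make up for the loss \<open>t * g\<close> of
    a functional that does not norm \<open>e\<close>.\<close>
  have "\<exists>b\<in>norming e. N (t *\<^sub>R e + v) \<le> t * N e + v \<bullet> b" if t: "t \<ge> 2 * N v / g" for t
  proof -
    have t0: "t \<ge> 0" using t g(1) N_nonneg[of v] by (meson divide_nonneg_pos mult_nonneg_nonneg order_trans zero_le_numeral)
    obtain a where a: "a \<in> P" "(t *\<^sub>R e + v) \<bullet> a = N (t *\<^sub>R e + v)" using N_attained by blast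
    show ?thesis
    proof (cases "a \<in> norming e")
      case True
      then show ?thesis using a(2) by (intro bexI[of _ a]) (auto simp: norming_def inner_add_left)
    next
      case False
      have "t * (e \<bullet> a + g) \<le> t * N e" using g(2)[OF a(1) False] t0 by (rule mult_left_mono)
      moreover have "2 * N v \<le> t * g" using t g(1) by (simp add: field_simps)
      moreover have "v \<bullet> a \<le> N v" "- (v \<bullet> b0) \<le> N v"
        using inner_le_N[OF a(1)] abs_inner_le_N[of b0 v] b0 by (auto simp: norming_def)
      ultimately have "N (t *\<^sub>R e + v) \<le> t * N e + v \<bullet> b0"
        using a(2) by (simp add: inner_add_left algebra_simps)
      then show ?thesis using b0 by blast
    qed
  qed
  then show ?thesis unfolding eventually_at_top_linorder by blast
qed

lemma norming_uminus_eq: "norming (- e) = uminus ` norming e"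
proof
  show "norming (- e) \<subseteq> uminus ` norming e"
    using norming_uminus[of _ "- e"] by (metis image_eqI minus_minus subsetI)
  show "uminus ` norming e \<subseteq> norming (- e)" using norming_uminus by blast
qed

lemma finite_norming: "finite (norming e)"
  using finite_P by (simp add: norming_def)

end

text \<open>Nonexpansiveness alone gives \<open>R_straight\<close> for \<open>0 \<le> t \<le> 1\<close>; real analyticity is what extends it to
  the whole line.\<close>

locale straight_retraction = polyhedral_norm +
  fixes R :: "'a \<Rightarrow> 'a"
  assumes nonexp_R: "nonexp R"
    and R_idem: "R (R x) = R x"
    and R_straight: "R x = x \<Longrightarrow> R z = z \<Longrightarrow> a \<in> norming (x - z) \<Longrightarrow>
          R (z + t *\<^sub>R (x - z)) \<bullet> a = z \<bullet> a + t * N (x - z)"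
begin

lemma R_le: "R u = u \<Longrightarrow> N (R w - u) \<le> N (w - u)"
  using nonexpD[OF nonexp_R, of w u] by simp

text \<open>\<open>R w\<close> is compared with a far point of the line, whose value under
  \<open>a\<close> is known by straightness. The distance bound from \<open>N_ray_le\<close> is
  \<open>t * N (x - z)\<close> plus a term in some norming \<open>b\<close>, and the terms in
  \<open>t\<close> cancel.\<close>

lemma R_inner_lower:
  assumes x: "R x = x" and z: "R z = z" and a: "a \<in> norming (x - z)"
  shows "\<exists>b\<in>norming (x - z). z \<bullet> a + (w - z) \<bullet> b \<le> R w \<bullet> a"
proof -
  let ?e = "x - z"
  obtain t b where b: "b \<in> norming ?e" "N (t *\<^sub>R ?e + (z - w)) \<le> t * N ?e + (z - w) \<bullet> b"
    using eventually_happens[OF N_ray_le[of ?e "z - w"]] by auto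
  have "(R (z + t *\<^sub>R ?e) - R w) \<bullet> a \<le> N (R (z + t *\<^sub>R ?e) - R w)"
    using a by (intro inner_le_N) (simp add: norming_def)
  also have "\<dots> \<le> N (z + t *\<^sub>R ?e - w)" by (rule nonexpD[OF nonexp_R])
  also have "z + t *\<^sub>R ?e - w = t *\<^sub>R ?e + (z - w)" by simp
  also note b(2)
  finally have "z \<bullet> a + (w - z) \<bullet> b \<le> R w \<bullet> a"
    using R_straight[OF x z a, of t] by (simp add: inner_diff_left)
  then show ?thesis using b(1) by blast
qed

text \<open>The lower bound seen from the other end, with the functional negated. All norming
  functionals agree on \<open>x - z\<close>, which moves the base point back to
  \<open>z\<close>.\<close>

lemma R_inner_upper:
  assumes x: "R x = x" and z: "R z = z" and a: "a \<in> norming (x - z)"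
  shows "\<exists>b\<in>norming (x - z). R w \<bullet> a \<le> z \<bullet> a + (w - z) \<bullet> b"
proof -
  have "- a \<in> norming (z - x)" using norming_uminus[OF a] by simp
  from R_inner_lower[OF z x this, of w] obtain b where b: "b \<in> norming (z - x)"
    "x \<bullet> (- a) + (w - x) \<bullet> b \<le> R w \<bullet> (- a)" by blast
  have b': "- b \<in> norming (x - z)" using norming_uminus[OF b(1)] by simp
  have "(x - z) \<bullet> a = N (x - z)" "(x - z) \<bullet> (- b) = N (x - z)"
    using a b' by (auto simp: norming_def)
  then have "R w \<bullet> a \<le> z \<bullet> a + (w - z) \<bullet> (- b)"
    using b(2) by (simp add: inner_diff_left)
  then show ?thesis using b' by blast
qed

text \<open>If the two sets of norming functionals were disjoint, moving \<open>p\<close> slightly along the difference of the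
  two unit directions would decrease \<open>a\<close> and increase \<open>b\<close>, although they agree near \<open>p\<close>.\<close>

lemma norming_meet:
  assumes R1: "R x1 = x1" "R z1 = z1" and R2: "R x2 = x2" "R z2 = z2"
    and ne: "x1 \<noteq> z1" "x2 \<noteq> z2"
    and p1: "p = x1 \<or> p = z1" and p2: "p = x2 \<or> p = z2"
    and a: "a \<in> norming (x1 - z1)" and b: "b \<in> norming (x2 - z2)"
    and e: "e > 0" and agree: "\<And>u. R u = u \<Longrightarrow> N (u - p) < e \<Longrightarrow> (u - p) \<bullet> a = (u - p) \<bullet> b"
  shows "norming (x1 - z1) \<inter> norming (x2 - z2) \<noteq> {}"
proof
  assume disj: "norming (x1 - z1) \<inter> norming (x2 - z2) = {}"
  define n1 n2 where "n1 = N (x1 - z1)" and "n2 = N (x2 - z2)"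
  have n: "n1 > 0" "n2 > 0" using ne by (auto simp: n1_def n2_def N_pos_iff)
  define d where "d = (1 / n2) *\<^sub>R (x2 - z2) - (1 / n1) *\<^sub>R (x1 - z1)"
  define \<delta> where "\<delta> = e / (N d + 1)"
  have \<delta>: "\<delta> > 0" "\<delta> * N d < e"
  proof -
    have "N d + 1 > 0" using N_nonneg[of d] by linarith
    then show "\<delta> > 0" "\<delta> * N d < e" using e by (auto simp: \<delta>_def field_simps)
  qed
  define w where "w = p + \<delta> *\<^sub>R d"
  have Rp: "R p = p" using p1 R1 by auto
  have "N (R w - p) \<le> N (w - p)" by (rule R_le[OF Rp])
  also have "\<dots> < e" using \<delta> by (simp add: w_def)
  finally have ab: "(R w - p) \<bullet> a = (R w - p) \<bullet> b" using agree[of "R w"] R_idem by simp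
  have d1: "d \<bullet> c < 0" if "c \<in> norming (x1 - z1)" for c
  proof -
    have c: "c \<in> P" "(x1 - z1) \<bullet> c = n1" using that by (auto simp: norming_def n1_def)
    have "(x2 - z2) \<bullet> c \<noteq> n2" using that disj c(1) by (auto simp: norming_def n2_def)
    then have "(x2 - z2) \<bullet> c < n2" using inner_le_N[OF c(1), of "x2 - z2"] by (simp add: n2_def)
    then have "(1 / n2) * ((x2 - z2) \<bullet> c) < 1" using n by (simp add: field_simps)
    then show ?thesis using c(2) n by (simp add: d_def inner_diff_left[of "_ *\<^sub>R _"])
  qed
  have d2: "d \<bullet> c > 0" if "c \<in> norming (x2 - z2)" for c
  proof -
    have c: "c \<in> P" "(x2 - z2) \<bullet> c = n2" using that by (auto simp: norming_def n2_def)
    have "(x1 - z1) \<bullet> c \<noteq> n1" using that disj c(1) by (auto simp: norming_def n1_def)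
    then have "(x1 - z1) \<bullet> c < n1" using inner_le_N[OF c(1), of "x1 - z1"] by (simp add: n1_def)
    then have "(1 / n1) * ((x1 - z1) \<bullet> c) < 1" using n by (simp add: field_simps)
    then show ?thesis using c(2) n by (simp add: d_def inner_diff_left[of "_ *\<^sub>R _"])
  qed
  obtain c where c: "c \<in> norming (x1 - z1)" "R w \<bullet> a \<le> z1 \<bullet> a + (w - z1) \<bullet> c"
    using R_inner_upper[OF R1 a] by blast
  \<comment> \<open>Both functionals take the value \<open>n1\<close> on \<open>x1 - z1\<close>, so
    the bound can be based at \<open>p\<close>, whichever end of the secant \<open>p\<close>
    is.\<close>
  have "(x1 - z1) \<bullet> a = (x1 - z1) \<bullet> c" using a c(1) by (simp add: norming_def)
  then have "(R w - p) \<bullet> a \<le> (w - p) \<bullet> c"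
    using p1 c(2) by (auto simp: inner_diff_left)
  also have "\<dots> < 0" using d1[OF c(1)] \<delta> by (simp add: w_def mult_pos_neg)
  finally have "(R w - p) \<bullet> a < 0" .
  moreover obtain c' where c': "c' \<in> norming (x2 - z2)" "z2 \<bullet> b + (w - z2) \<bullet> c' \<le> R w \<bullet> b"
    using R_inner_lower[OF R2 b] by blast
  have "(x2 - z2) \<bullet> b = (x2 - z2) \<bullet> c'" using b c'(1) by (simp add: norming_def)
  then have "(w - p) \<bullet> c' \<le> (R w - p) \<bullet> b"
    using p2 c'(2) by (auto simp: inner_diff_left)
  moreover have "(w - p) \<bullet> c' > 0" using d2[OF c'(1)] \<delta> by (simp add: w_def)
  ultimately show False using ab by simp
qed

section \<open>Straight lines, their Busemann functions and their ends\<close>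

definition straight_line :: "'a \<Rightarrow> 'a \<Rightarrow> bool" where
  "straight_line z e \<longleftrightarrow> R z = z \<and> e \<noteq> 0 \<and>
     (\<forall>a\<in>norming e. \<forall>t. R (z + t *\<^sub>R e) \<bullet> a = z \<bullet> a + t * N e)"

text \<open>Up to sign this is the Busemann function of the line on fixed points: by
  \<open>N_line_eventually\<close>, what remains of the distance from \<open>u\<close> to a far
  point after subtracting \<open>t * N e\<close>.\<close>

definition low :: "'a \<Rightarrow> 'a \<Rightarrow> 'a \<Rightarrow> real" where
  "low z e u = Min ((\<lambda>a. (u - z) \<bullet> a) ` norming e)"

text \<open>The limit of the norming sets towards the end of the line; for a straight line and
  \<open>u\<close> fixed by \<open>R\<close> they are eventually constant by
  \<open>norming_line_eventually\<close>.\<close>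

definition ends :: "'a \<Rightarrow> 'a \<Rightarrow> 'a \<Rightarrow> 'a set" where
  "ends z e u = {a. \<forall>\<^sub>F t in at_top. a \<in> norming (R (z + t *\<^sub>R e) - u)}"

lemma ends_subset: "ends z e u \<subseteq> P"
proof
  fix a assume "a \<in> ends z e u"
  then have "\<forall>\<^sub>F t in at_top. a \<in> norming (R (z + t *\<^sub>R e) - u)" by (simp add: ends_def)
  from eventually_happens[OF this] show "a \<in> P" by (auto simp: norming_def)
qed

lemma straight_line_pair:
  "R x = x \<Longrightarrow> R z = z \<Longrightarrow> x \<noteq> z \<Longrightarrow> straight_line z (x - z)"
  unfolding straight_line_def using R_straight by auto

lemma straight_line_uminus:
  assumes "straight_line z e" shows "straight_line z (- e)"
  unfolding straight_line_def
proof (intro conjI ballI allI)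
  fix a t assume "a \<in> norming (- e)"
  then have "- a \<in> norming e" using norming_uminus[of a "- e"] by simp
  then have "R (z + (- t) *\<^sub>R e) \<bullet> (- a) = z \<bullet> (- a) + (- t) * N e"
    using assms unfolding straight_line_def by blast
  then show "R (z + t *\<^sub>R (- e)) \<bullet> a = z \<bullet> a + t * N (- e)" by simp
qed (use assms in \<open>auto simp: straight_line_def\<close>)

lemma low_le: "a \<in> norming e \<Longrightarrow> low z e u \<le> (u - z) \<bullet> a"
  unfolding low_def using finite_norming by (intro Min_le) auto

lemma low_attained: "\<exists>a\<in>norming e. (u - z) \<bullet> a = low z e u"
proof -
  have "low z e u \<in> (\<lambda>a. (u - z) \<bullet> a) ` norming e"
    unfolding low_def using finite_norming norming_nonempty by (intro Min_in) auto
  then show ?thesis by auto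
qed

lemma low_lipschitz: "\<bar>low z e u - low z e v\<bar> \<le> N (u - v)"
proof -
  have "low z e u \<le> low z e v + N (u - v)" for u v
  proof -
    obtain a where a: "a \<in> norming e" "(v - z) \<bullet> a = low z e v" using low_attained by blast
    have "(u - v) \<bullet> a \<le> N (u - v)" using a(1) by (intro inner_le_N) (simp add: norming_def)
    then show ?thesis using low_le[OF a(1), of z u] a(2) by (simp add: inner_diff_left)
  qed
  from this[of u v] this[of v u] show ?thesis using N_commute[of u v] by linarith
qed

lemma N_line_eventually:
  assumes l: "straight_line z e" and u: "R u = u"
  shows "\<forall>\<^sub>F t in at_top. N (R (z + t *\<^sub>R e) - u) = t * N e - low z e u"
  using N_ray_le[of e "z - u"]
proof eventually_elim
  case (elim t)
  then obtain b where b: "b \<in> norming e" "N (t *\<^sub>R e + (z - u)) \<le> t * N e + (z - u) \<bullet> b" by blast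
  have "N (R (z + t *\<^sub>R e) - u) \<le> N (t *\<^sub>R e + (z - u))"
    using R_le[OF u, of "z + t *\<^sub>R e"] by (simp add: algebra_simps)
  then have "N (R (z + t *\<^sub>R e) - u) \<le> t * N e - low z e u"
    using b(2) low_le[OF b(1), of z u] by (simp add: inner_diff_left)
  moreover obtain a where a: "a \<in> norming e" "(u - z) \<bullet> a = low z e u" using low_attained by blast
  have "R (z + t *\<^sub>R e) \<bullet> a = z \<bullet> a + t * N e" using l a(1) unfolding straight_line_def by blast
  then have "t * N e - low z e u \<le> N (R (z + t *\<^sub>R e) - u)"
    using inner_le_N[of a "R (z + t *\<^sub>R e) - u"] a by (simp add: norming_def inner_diff_left)
  ultimately show ?case by simp
qed

lemma N_line_pos_eventually:
  assumes l: "straight_line z e" and u: "R u = u"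
  shows "\<forall>\<^sub>F t in at_top. R (z + t *\<^sub>R e) \<noteq> u"
proof -
  have pos: "N e > 0" using l by (simp add: straight_line_def N_pos_iff)
  have "\<forall>\<^sub>F t in at_top. t * N e > low z e u"
    using eventually_gt_at_top[of "low z e u / N e"]
    by eventually_elim (use pos in \<open>simp add: field_simps\<close>)
  with N_line_eventually[OF l u] show ?thesis
  proof eventually_elim
    case (elim t)
    then show ?case using N_pos_iff[of "R (z + t *\<^sub>R e) - u"] by auto
  qed
qed

text \<open>From \<open>T\<close> on the distance to \<open>u\<close> grows at full speed
  \<open>N e\<close>, the most that one functional can gain. So a functional norming at a later
  parameter already norms at the earlier ones beyond \<open>T\<close>: the norming sets decrease
  within a finite set and stabilise.\<close>

lemma norming_line_eventually:
  assumes l: "straight_line z e" and u: "R u = u"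
  shows "\<forall>\<^sub>F t in at_top. norming (R (z + t *\<^sub>R e) - u) = ends z e u"
proof -
  let ?g = "\<lambda>t. R (z + t *\<^sub>R e)"
  obtain T where T: "\<And>t. t \<ge> T \<Longrightarrow> N (?g t - u) = t * N e - low z e u"
    using N_line_eventually[OF l u] unfolding eventually_at_top_linorder by blast
  have down: "a \<in> norming (?g t - u)" if "a \<in> norming (?g t' - u)" "T \<le> t" "t \<le> t'" for a t t'
  proof -
    have aP: "a \<in> P" using that(1) by (simp add: norming_def)
    have "(?g t' - ?g t) \<bullet> a \<le> N ((z + t' *\<^sub>R e) - (z + t *\<^sub>R e))"
      using inner_le_N[OF aP] nonexpD[OF nonexp_R] order_trans by blast
    also have "(z + t' *\<^sub>R e) - (z + t *\<^sub>R e) = (t' - t) *\<^sub>R e" by (simp add: algebra_simps)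
    also have "N ((t' - t) *\<^sub>R e) = (t' - t) * N e" using that by simp
    finally have "(?g t' - ?g t) \<bullet> a \<le> (t' - t) * N e" .
    moreover have "(?g t' - u) \<bullet> a = t' * N e - low z e u"
      using that T[of t'] by (simp add: norming_def)
    ultimately have "N (?g t - u) \<le> (?g t - u) \<bullet> a"
      using T[of t] that by (simp add: inner_diff_left left_diff_distrib)
    then show ?thesis using inner_le_N[OF aP, of "?g t - u"] aP by (simp add: norming_def)
  qed
  have "\<forall>a\<in>P. \<forall>\<^sub>F t in at_top. a \<in> norming (?g t - u) \<longleftrightarrow> a \<in> ends z e u"
  proof
    fix a assume "a \<in> P"
    show "\<forall>\<^sub>F t in at_top. a \<in> norming (?g t - u) \<longleftrightarrow> a \<in> ends z e u"
    proof (cases "a \<in> ends z e u")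
      case True
      then show ?thesis by (simp add: ends_def)
    next
      case False
      then obtain t1 where t1: "t1 \<ge> T" "a \<notin> norming (?g t1 - u)"
        unfolding ends_def eventually_at_top_linorder by blast
      have "a \<notin> norming (?g t - u)" if "t \<ge> t1" for t using down[of a t t1] down[of a t t] down t1 that by blast
      then show ?thesis using False unfolding eventually_at_top_linorder by blast
    qed
  qed
  then have "\<forall>\<^sub>F t in at_top. \<forall>a\<in>P. a \<in> norming (?g t - u) \<longleftrightarrow> a \<in> ends z e u"
    using finite_P by (simp add: eventually_ball_finite)
  then show ?thesis
    by eventually_elim (use ends_subset[of z e u] in \<open>auto simp: norming_def\<close>)
qed

lemma low_attained_in_ends:
  assumes l: "straight_line z e" and u: "R u = u"
    and a: "a \<in> norming e" "(u - z) \<bullet> a = low z e u"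
  shows "a \<in> ends z e u"
  unfolding ends_def mem_Collect_eq using N_line_eventually[OF l u]
proof eventually_elim
  case (elim t)
  have "R (z + t *\<^sub>R e) \<bullet> a = z \<bullet> a + t * N e" using l a(1) unfolding straight_line_def by blast
  then show ?case using elim a by (simp add: norming_def inner_diff_left)
qed

text \<open>Far-point distances to \<open>u\<close> and \<open>v\<close> are explicit, so membership
  in \<open>ends\<close> becomes one equation between Lipschitz functions, which continuity
  arguments can handle.\<close>

lemma ends_eq:
  assumes l: "straight_line z e" and u: "R u = u" and v: "R v = v"
    and a: "a \<in> ends z e u"
  shows "a \<in> ends z e v \<longleftrightarrow> (v - u) \<bullet> a = low z e v - low z e u"
proof
  assume av: "a \<in> ends z e v"
  have "\<forall>\<^sub>F t in at_top. a \<in> norming (R (z + t *\<^sub>R e) - u)"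
       "\<forall>\<^sub>F t in at_top. a \<in> norming (R (z + t *\<^sub>R e) - v)"
    using a av by (auto simp: ends_def)
  with N_line_eventually[OF l u] N_line_eventually[OF l v]
  have "\<forall>\<^sub>F t in at_top::real filter. (v - u) \<bullet> a = low z e v - low z e u"
    by eventually_elim (simp add: norming_def inner_diff_left)
  then show "(v - u) \<bullet> a = low z e v - low z e u" by simp
next
  assume eq: "(v - u) \<bullet> a = low z e v - low z e u"
  have "\<forall>\<^sub>F t in at_top. a \<in> norming (R (z + t *\<^sub>R e) - u)" using a by (auto simp: ends_def)
  with N_line_eventually[OF l u] N_line_eventually[OF l v]
  show "a \<in> ends z e v"
    unfolding ends_def mem_Collect_eq
    by eventually_elim (use eq in \<open>simp add: norming_def inner_diff_left\<close>)
qed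

lemma ends_upper_semicontinuous:
  assumes l: "straight_line z e" and u: "R u = u"
  shows "\<exists>r>0. \<forall>v. R v = v \<longrightarrow> N (v - u) < r \<longrightarrow> ends z e v \<subseteq> ends z e u"
proof -
  have "\<exists>r>0. \<forall>a\<in>P. \<forall>v. N (v - u) < r \<longrightarrow> R v = v \<longrightarrow> a \<in> ends z e v \<longrightarrow> a \<in> ends z e u"
  proof (rule finite_common_radius[OF finite_P, where d = "\<lambda>v. N (v - u)"])
    fix a assume aP: "a \<in> P"
    show "\<exists>r>0. \<forall>v. N (v - u) < r \<longrightarrow> R v = v \<longrightarrow> a \<in> ends z e v \<longrightarrow> a \<in> ends z e u"
    proof (cases "\<exists>u0. R u0 = u0 \<and> a \<in> ends z e u0 \<and> a \<notin> ends z e u")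
      case True
      then obtain u0 where u0: "R u0 = u0" "a \<in> ends z e u0" "a \<notin> ends z e u" by blast
      \<comment> \<open>Half the defect in the equation of \<open>ends_eq\<close>, both of whose
        sides are 1-Lipschitz in the point.\<close>
      define r where "r = \<bar>(u - u0) \<bullet> a - (low z e u - low z e u0)\<bar> / 2"
      have "r > 0" using ends_eq[OF l u0(1) u u0(2)] u0(3) by (simp add: r_def)
      moreover have "a \<notin> ends z e v" if v: "N (v - u) < r" "R v = v" for v
      proof
        assume "a \<in> ends z e v"
        then have "(v - u0) \<bullet> a = low z e v - low z e u0" using ends_eq[OF l u0(1) v(2) u0(2)] by simp
        then have "2 * r = \<bar>(u - v) \<bullet> a - (low z e u - low z e v)\<bar>"
          by (simp add: r_def inner_diff_left)
        also have "\<dots> \<le> 2 * N (v - u)"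
          using abs_inner_le_N[OF aP, of "u - v"] low_lipschitz[of z e u v] N_commute[of u v] by linarith
        finally show False using v(1) by simp
      qed
      ultimately show ?thesis by blast
    next
      case False
      then show ?thesis by (intro exI[of _ 1]) auto
    qed
  qed
  then show ?thesis using ends_subset by blast
qed

text \<open>The functionals in \<open>ends z e u\<close> all take the same value on
  \<open>v - u\<close>, and they norm the secant from \<open>u\<close> to a far point; so the lower
  and upper bounds for \<open>R\<close> from that secant coincide. Every real \<open>\<tau>\<close>
  is allowed, which permits extrapolation beyond \<open>v\<close>.\<close>

lemma R_inner_ends:
  assumes l: "straight_line z e" and u: "R u = u" and v: "R v = v"
    and sub: "ends z e u \<subseteq> ends z e v" and a: "a \<in> ends z e u"
  shows "(R (u + \<tau> *\<^sub>R (v - u)) - u) \<bullet> a = \<tau> * (low z e v - low z e u)"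
proof -
  let ?w = "u + \<tau> *\<^sub>R (v - u)"
  obtain t where t: "norming (R (z + t *\<^sub>R e) - u) = ends z e u"
    using eventually_happens[OF norming_line_eventually[OF l u]] by auto
  have b: "(?w - u) \<bullet> b = \<tau> * (low z e v - low z e u)" if "b \<in> ends z e u" for b
    using ends_eq[OF l u v that] sub that by (auto simp: inner_diff_left[symmetric])
  have at: "a \<in> norming (R (z + t *\<^sub>R e) - u)" using a t by simp
  obtain b1 where b1: "b1 \<in> ends z e u" "u \<bullet> a + (?w - u) \<bullet> b1 \<le> R ?w \<bullet> a"
    using R_inner_lower[OF R_idem u at] t by blast
  obtain b2 where b2: "b2 \<in> ends z e u" "R ?w \<bullet> a \<le> u \<bullet> a + (?w - u) \<bullet> b2"
    using R_inner_upper[OF R_idem u at] t by blast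
  show ?thesis using b1(2) b2(2) b[OF b1(1)] b[OF b2(1)] unfolding inner_diff_left[of "R ?w"] by linarith
qed

section \<open>Secants with a minimal set of norming functionals\<close>

definition minimal_secant :: "'a \<Rightarrow> 'a \<Rightarrow> bool" where
  "minimal_secant x z \<longleftrightarrow> R x = x \<and> R z = z \<and> x \<noteq> z \<and>
     (\<forall>x' z'. R x' = x' \<longrightarrow> R z' = z' \<longrightarrow> x' \<noteq> z' \<longrightarrow>
        norming (x' - z') \<subseteq> norming (x - z) \<longrightarrow> norming (x' - z') = norming (x - z))"

lemma minimal_secant_swap:
  assumes "minimal_secant x z" shows "minimal_secant z x"
  unfolding minimal_secant_def
proof (intro conjI allI impI)
  fix x' z' assume *: "R x' = x'" "R z' = z'" "x' \<noteq> z'" "norming (x' - z') \<subseteq> norming (z - x)"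
  have eq: "norming (b - a) = uminus ` norming (a - b)" for a b
    using norming_uminus_eq[of "a - b"] by simp
  have "norming (z' - x') \<subseteq> norming (x - z)"
    unfolding eq[of z' x'] eq[of x z] using *(4) by blast
  then have "norming (z' - x') = norming (x - z)"
    using assms * unfolding minimal_secant_def by blast
  then show "norming (x' - z') = norming (z - x)"
    unfolding eq[of x' z'] eq[of z x] by simp
qed (use assms in \<open>auto simp: minimal_secant_def\<close>)

lemma minimal_secant_line: "minimal_secant x z \<Longrightarrow> straight_line z (x - z)"
  unfolding minimal_secant_def using straight_line_pair by blast

text \<open>A functional outside \<open>norming (x - z)\<close> loses the gap \<open>g\<close>
  between \<open>z\<close> and \<open>x\<close> and cannot regain it beyond \<open>x\<close>, whence
  \<open>t \<ge> 1\<close>. So near the ray it does not norm \<open>u - z\<close>, and minimality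
  turns the inclusion of norming sets into equality.\<close>

lemma minimal_secant_near_ray:
  assumes m: "minimal_secant x z"
  shows "\<exists>\<delta>>0. \<forall>t\<ge>1. \<forall>u. R u = u \<longrightarrow> N (u - R (z + t *\<^sub>R (x - z))) < \<delta> \<longrightarrow>
           (\<forall>a\<in>norming (x - z). (u - z) \<bullet> a = N (u - z))"
proof -
  let ?e = "x - z"
  have x: "R x = x" and z: "R z = z" and ne: "x \<noteq> z" using m by (auto simp: minimal_secant_def)
  obtain g where g: "g > 0" "\<And>a. a \<in> P \<Longrightarrow> a \<notin> norming ?e \<Longrightarrow> ?e \<bullet> a + g \<le> N ?e"
    using norming_gap by blast
  have e: "N ?e > 0" using ne by (simp add: N_pos_iff)
  \<comment> \<open>Half the gap, as \<open>\<delta>\<close> enters both the lower and the upper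
    estimate; the bound \<open>N ?e\<close> excludes \<open>u = z\<close>.\<close>
  define \<delta> where "\<delta> = min (g / 2) (N ?e)"
  have "(u - z) \<bullet> a = N (u - z)"
    if t: "t \<ge> 1" and u: "R u = u" "N (u - R (z + t *\<^sub>R ?e)) < \<delta>" and a: "a \<in> norming ?e" for t u a
  proof -
    let ?v = "R (z + t *\<^sub>R ?e)"
    have lower: "t * N ?e - \<delta> < N (u - z)"
    proof -
      have "?v \<bullet> a = z \<bullet> a + t * N ?e" using R_straight[OF x z a] .
      moreover have "\<bar>(u - ?v) \<bullet> a\<bar> < \<delta>" "(u - z) \<bullet> a \<le> N (u - z)"
        using abs_inner_le_N[of a "u - ?v"] u(2) inner_le_N[of a "u - z"] a by (auto simp: norming_def)
      ultimately show ?thesis by (simp add: inner_diff_left)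
    qed
    have "norming (u - z) \<subseteq> norming ?e"
    proof (rule ccontr)
      assume "\<not> ?thesis"
      then obtain b where b: "b \<in> norming (u - z)" "b \<notin> norming ?e" by blast
      then have bP: "b \<in> P" by (simp add: norming_def)
      have "N (?v - x) \<le> N ((t - 1) *\<^sub>R ?e)"
        using R_le[OF x, of "z + t *\<^sub>R ?e"] by (simp add: algebra_simps)
      then have "(?v - x) \<bullet> b \<le> (t - 1) * N ?e" using inner_le_N[OF bP, of "?v - x"] t by simp
      moreover have "?e \<bullet> b + g \<le> N ?e" by (rule g(2)[OF bP b(2)])
      moreover have "(u - ?v) \<bullet> b < \<delta>" using abs_inner_le_N[OF bP, of "u - ?v"] u(2) by simp
      moreover have "(u - z) \<bullet> b = N (u - z)" using b(1) by (simp add: norming_def)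
      moreover have "2 * \<delta> \<le> g" by (simp add: \<delta>_def)
      ultimately show False using lower by (simp add: inner_diff_left left_diff_distrib)
    qed
    moreover have "u \<noteq> z"
    proof
      assume "u = z"
      then have "t * N ?e < \<delta>" using lower by simp
      moreover have "N ?e \<le> t * N ?e" using t e by simp
      ultimately show False by (simp add: \<delta>_def)
    qed
    ultimately have "norming (u - z) = norming ?e"
      using m u(1) z unfolding minimal_secant_def by blast
    then show ?thesis using a by (auto simp: norming_def)
  qed
  then show ?thesis using g e by (intro exI[of _ \<delta>]) (auto simp: \<delta>_def)
qed

text \<open>The spread \<open>c u\<close> of the functionals norming a minimal secant is the defect in the
  triangle inequality at \<open>u\<close> between the two ends of the line. If it is positive somewhere, then near a suitable point \<open>p\<close> it is the difference of two functionals
  and not constant (by \<open>norming_meet\<close> at \<open>p\<close>), so moving along a line through \<open>p\<close> makes this difference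
  negative, which contradicts \<open>norming_meet\<close> at a far point of the line through \<open>x\<close> and \<open>z\<close>.\<close>

theorem minimal_secant_functionals_agree:
  assumes m: "minimal_secant x z" and Ru0: "R u0 = u0"
    and a0: "a0 \<in> norming (x - z)" and b0: "b0 \<in> norming (x - z)"
  shows "(u0 - z) \<bullet> a0 = (u0 - z) \<bullet> b0"
proof (rule ccontr)
  assume differ: "(u0 - z) \<bullet> a0 \<noteq> (u0 - z) \<bullet> b0"
  define e where "e = x - z"
  have l1: "straight_line z e" unfolding e_def by (rule minimal_secant_line[OF m])
  have l2: "straight_line z (- e)" by (rule straight_line_uminus[OF l1])
  \<comment> \<open>Negation exchanges \<open>norming e\<close> and \<open>norming (- e)\<close>, so
    \<open>- low z (- e) u\<close> is the maximum where \<open>low z e u\<close> is the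
    minimum.\<close>
  define c where "c = (\<lambda>u. - low z (- e) u - low z e u)"
  have c_ge: "\<bar>(u - z) \<bullet> a - (u - z) \<bullet> b\<bar> \<le> c u" if "a \<in> norming e" "b \<in> norming e" for u a b
    using low_le[OF that(1), of z u] low_le[OF that(2), of z u]
      low_le[OF norming_uminus[OF that(1)], of z u] low_le[OF norming_uminus[OF that(2)], of z u]
    by (simp add: c_def)
  have "c u0 > 0" using c_ge[of a0 b0 u0] a0 b0 differ by (simp add: e_def)
  \<comment> \<open>Ends can only shrink near \<open>p\<close>, and shrinking would contradict the
    least total number; so they are constant near \<open>p\<close>.\<close>
  then obtain p where p: "R p = p" "c p > 0" and least:
    "\<And>u. R u = u \<Longrightarrow> c u > 0 \<Longrightarrow>
       card (ends z e p) + card (ends z (- e) p) \<le> card (ends z e u) + card (ends z (- e) u)"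
    using ex_has_least_nat[of "\<lambda>u. R u = u \<and> c u > 0" u0
        "\<lambda>u. card (ends z e u) + card (ends z (- e) u)"] Ru0 by auto
  obtain r1 where r1: "r1 > 0" "\<And>v. R v = v \<Longrightarrow> N (v - p) < r1 \<Longrightarrow> ends z e v \<subseteq> ends z e p"
    using ends_upper_semicontinuous[OF l1 p(1)] by blast
  obtain r2 where r2: "r2 > 0" "\<And>v. R v = v \<Longrightarrow> N (v - p) < r2 \<Longrightarrow> ends z (- e) v \<subseteq> ends z (- e) p"
    using ends_upper_semicontinuous[OF l2 p(1)] by blast
  define r where "r = min (min r1 r2) (c p / 2)"
  have r: "r > 0" using r1 r2 p by (simp add: r_def)
  have near: "ends z e v = ends z e p \<and> ends z (- e) v = ends z (- e) p"
    if v: "R v = v" "N (v - p) < r" for v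
  proof -
    have fin: "finite (ends z e' p)" for e' using finite_subset[OF ends_subset finite_P] .
    have sub: "ends z e v \<subseteq> ends z e p" "ends z (- e) v \<subseteq> ends z (- e) p"
      using r1(2) r2(2) v by (auto simp: r_def)
    have "\<bar>c v - c p\<bar> \<le> 2 * N (v - p)"
      using low_lipschitz[of z e v p] low_lipschitz[of z "- e" v p] by (simp add: c_def)
    moreover have "N (v - p) < c p / 2" using v(2) by (simp add: r_def)
    ultimately have "c v > 0" by linarith
    then have "card (ends z e p) + card (ends z (- e) p) \<le> card (ends z e v) + card (ends z (- e) v)"
      using least v(1) by blast
    moreover have "card (ends z e v) \<le> card (ends z e p)" "card (ends z (- e) v) \<le> card (ends z (- e) p)"
      using sub fin by (auto intro: card_mono)
    ultimately have "card (ends z e p) \<le> card (ends z e v)" "card (ends z (- e) p) \<le> card (ends z (- e) v)"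
      by auto
    then show ?thesis using sub fin card_seteq by metis
  qed
  obtain a where a: "a \<in> norming e" "(p - z) \<bullet> a = low z e p" using low_attained by blast
  have aE: "a \<in> ends z e p" by (rule low_attained_in_ends[OF l1 p(1) a])
  obtain b where b: "b \<in> norming (- e)" "(p - z) \<bullet> b = low z (- e) p" using low_attained by blast
  have bE: "b \<in> ends z (- e) p" by (rule low_attained_in_ends[OF l2 p(1) b])
  have "\<exists>v. R v = v \<and> N (v - p) < r \<and> c v \<noteq> c p"
  proof (rule ccontr)
    assume const: "\<nexists>v. R v = v \<and> N (v - p) < r \<and> c v \<noteq> c p"
    have agree: "(u - p) \<bullet> a = (u - p) \<bullet> (- b)" if u: "R u = u" "N (u - p) < r" for u
    proof -
      have "a \<in> ends z e u" "b \<in> ends z (- e) u" using near[OF u] aE bE by auto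
      then have "(u - p) \<bullet> a = low z e u - low z e p" "(u - p) \<bullet> b = low z (- e) u - low z (- e) p"
        using ends_eq[OF l1 p(1) u(1) aE] ends_eq[OF l2 p(1) u(1) bE] by auto
      then show ?thesis using const u by (auto simp: c_def)
    qed
    have "\<forall>\<^sub>F t :: real in at_top. t \<noteq> t"
      using norming_line_eventually[OF l1 p(1)] norming_line_eventually[OF l2 p(1)]
        N_line_pos_eventually[OF l1 p(1)] N_line_pos_eventually[OF l2 p(1)]
        N_line_eventually[OF l1 p(1)] N_line_eventually[OF l2 p(1)] eventually_ge_at_top[of 0]
    proof eventually_elim
      case (elim t)
      \<comment> \<open>The goal \<open>t \<noteq> t\<close> is plain falsity, so one large
        \<open>t\<close> suffices. A functional norming both halves of the path through
        \<open>p\<close> makes the far points \<open>2 * t * N e + c p\<close> apart, which is too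
        much by \<open>c p\<close>.\<close>
      let ?x = "R (z + t *\<^sub>R e)" and ?y = "R (z + t *\<^sub>R (- e))"
      have "- b \<in> norming (p - ?y)"
        using norming_uminus[of b "?y - p"] bE elim(2) by simp
      then have "norming (?x - p) \<inter> norming (p - ?y) \<noteq> {}"
        using aE elim(1,3,4) R_idem p(1) r agree
        by (intro norming_meet[where a = a and b = "- b" and p = p and e = r]) auto
      then obtain q where q: "q \<in> norming (?x - p)" "q \<in> norming (p - ?y)" by blast
      then have "(?x - ?y) \<bullet> q = N (?x - p) + N (p - ?y)"
        by (auto simp: norming_def inner_diff_left)
      also have "\<dots> = 2 * t * N e + c p"
        using elim(5,6) N_commute[of p ?y] by (simp add: c_def)
      finally have "2 * t * N e + c p \<le> N (?x - ?y)"
        using inner_le_N[of q "?x - ?y"] q(1) by (simp add: norming_def)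
      moreover have "N (?x - ?y) \<le> N ((2 * t) *\<^sub>R e)"
        using nonexpD[OF nonexp_R, of "z + t *\<^sub>R e" "z + t *\<^sub>R (- e)"]
        by (simp add: scaleR_2[symmetric] algebra_simps)
      ultimately show "t \<noteq> t" using p(2) elim(7) by simp
    qed
    then show False by simp
  qed
  then obtain p' where p': "R p' = p'" "N (p' - p) < r" "c p' \<noteq> c p" by blast
  \<comment> \<open>Extrapolates the difference of the two functionals from \<open>c p\<close> at
    \<open>p\<close> to \<open>- c p\<close> at \<open>q\<close>.\<close>
  define \<tau> where "\<tau> = 2 * c p / (c p - c p')"
  define q where "q = R (p + \<tau> *\<^sub>R (p' - p))"
  have Rq: "R q = q" by (simp add: q_def R_idem)
  have \<tau>: "\<tau> * (c p' - c p) = - 2 * c p" using p'(3) by (simp add: \<tau>_def field_simps)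
  have qa: "(q - p) \<bullet> d = \<tau> * (low z e p' - low z e p)" if "d \<in> ends z e p" for d
    unfolding q_def using R_inner_ends[OF l1 p(1) p'(1) _ that] near[OF p'(1,2)] by simp
  have qb: "(q - p) \<bullet> b = \<tau> * (low z (- e) p' - low z (- e) p)"
    unfolding q_def using R_inner_ends[OF l2 p(1) p'(1) _ bE] near[OF p'(1,2)] by simp
  have "(q - p) \<bullet> (- b) - (q - p) \<bullet> a = \<tau> * (c p' - c p)"
    using qa[OF aE] qb by (simp add: c_def algebra_simps)
  moreover have "(p - z) \<bullet> (- b) - (p - z) \<bullet> a = c p" using a b by (simp add: c_def)
  ultimately have less: "(q - z) \<bullet> (- b) < (q - z) \<bullet> a"
    using \<tau> p(2) by (simp add: inner_diff_left)
  have "- b \<in> norming e" using norming_uminus[OF b(1)] by simp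
  then have low_q: "low z e q < (q - z) \<bullet> a" using low_le[of "- b" e z q] less by simp
  obtain a' where a': "a' \<in> norming e" "(q - z) \<bullet> a' = low z e q" using low_attained by blast
  have a'E: "a' \<in> ends z e q" by (rule low_attained_in_ends[OF l1 Rq a'])
  obtain \<delta> where \<delta>: "\<delta> > 0" "\<And>t u d. t \<ge> 1 \<Longrightarrow> R u = u \<Longrightarrow> N (u - R (z + t *\<^sub>R e)) < \<delta> \<Longrightarrow>
      d \<in> norming e \<Longrightarrow> (u - z) \<bullet> d = N (u - z)"
    using minimal_secant_near_ray[OF m] unfolding e_def by blast
  have "\<forall>\<^sub>F t :: real in at_top. t \<noteq> t"
    using norming_line_eventually[OF l1 p(1)] norming_line_eventually[OF l1 Rq]
      N_line_pos_eventually[OF l1 p(1)] N_line_pos_eventually[OF l1 Rq] eventually_ge_at_top[of 1]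
  proof eventually_elim
    case (elim t)
    \<comment> \<open>Near this point \<open>a\<close> and \<open>a'\<close> agree by
      \<open>minimal_secant_near_ray\<close>, so \<open>norming_meet\<close> applies to the secants
      towards \<open>p\<close> and \<open>q\<close>. By \<open>qa\<close>, a common end
      \<open>d\<close> passes the change of \<open>low\<close> from \<open>p\<close> to
      \<open>q\<close> on to \<open>a\<close>, which would make \<open>a\<close> minimal at
      \<open>q\<close>.\<close>
    let ?x = "R (z + t *\<^sub>R e)"
    have agree: "(u - ?x) \<bullet> a = (u - ?x) \<bullet> a'" if u: "R u = u" "N (u - ?x) < \<delta>" for u
    proof -
      have "(u - z) \<bullet> a = (u - z) \<bullet> a'" using \<delta>(2)[OF elim(5) u] a(1) a'(1) by simp
      moreover have "(?x - z) \<bullet> a = (?x - z) \<bullet> a'"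
        using \<delta>(2)[OF elim(5) R_idem] \<delta>(1) a(1) a'(1) by simp
      ultimately show ?thesis by (simp add: inner_diff_left)
    qed
    have "norming (?x - p) \<inter> norming (?x - q) \<noteq> {}"
      using aE a'E elim R_idem p(1) Rq \<delta>(1) agree
      by (intro norming_meet[where a = a and b = a' and p = ?x and e = \<delta>]) auto
    then obtain d where d: "d \<in> ends z e p" "d \<in> ends z e q" using elim by blast
    have "(q - p) \<bullet> d = low z e q - low z e p" using ends_eq[OF l1 p(1) Rq d(1)] d(2) by simp
    then have "(q - p) \<bullet> a = low z e q - low z e p" using qa[OF d(1)] qa[OF aE] by simp
    then have "(q - z) \<bullet> a = low z e q" using a(2) by (simp add: inner_diff_left)
    then show "t \<noteq> t" using low_q by simp
  qed
  then show False by simp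
qed

section \<open>Affine coordinates of the fixed points\<close>

definition coordinates :: "'a set" where
  "coordinates = {a. \<exists>x z. minimal_secant x z \<and> a \<in> norming (x - z)}"

text \<open>Among the secants whose norming set lies in that of \<open>x - z\<close>, one with a
  smallest set is minimal. Hence coordinates recover all distances between fixed points.\<close>

lemma coordinates_norming:
  assumes x: "R x = x" and z: "R z = z" and ne: "x \<noteq> z"
  shows "\<exists>a\<in>coordinates. a \<in> norming (x - z)"
proof -
  let ?Q = "\<lambda>q. R (fst q) = fst q \<and> R (snd q) = snd q \<and> fst q \<noteq> snd q \<and>
              norming (fst q - snd q) \<subseteq> norming (x - z)"
  have "?Q (x, z)" using assms by simp
  from ex_has_least_nat[of ?Q, OF this, of "\<lambda>q. card (norming (fst q - snd q))"]
  obtain x1 z1 where q: "?Q (x1, z1)" and least: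
    "\<And>q. ?Q q \<Longrightarrow> card (norming (x1 - z1)) \<le> card (norming (fst q - snd q))" by auto
  have "minimal_secant x1 z1"
    unfolding minimal_secant_def
  proof (intro conjI allI impI)
    fix x' z' assume *: "R x' = x'" "R z' = z'" "x' \<noteq> z'" "norming (x' - z') \<subseteq> norming (x1 - z1)"
    then have "card (norming (x1 - z1)) \<le> card (norming (x' - z'))"
      using least[of "(x', z')"] q by auto
    then show "norming (x' - z') = norming (x1 - z1)" using *(4) finite_norming card_seteq by blast
  qed (use q in auto)
  moreover obtain a where "a \<in> norming (x1 - z1)" using norming_nonempty by blast
  ultimately show ?thesis using q unfolding coordinates_def by auto
qed

lemma coordinates_in_P: "coordinates \<subseteq> P"
  unfolding coordinates_def norming_def by auto

lemma coordinates_uminus: "a \<in> coordinates \<Longrightarrow> - a \<in> coordinates"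
  unfolding coordinates_def using minimal_secant_swap norming_uminus by fastforce

lemma eq_by_coordinates:
  assumes "R x = x" "R z = z" "\<And>a. a \<in> coordinates \<Longrightarrow> x \<bullet> a = z \<bullet> a"
  shows "x = z"
proof (rule ccontr)
  assume "x \<noteq> z"
  then obtain a where "a \<in> coordinates" "a \<in> norming (x - z)" using coordinates_norming assms by blast
  then show False using assms(3)[of a] \<open>x \<noteq> z\<close> N_pos_iff[of "x - z"]
    by (simp add: norming_def inner_diff_left)
qed

text \<open>All functionals norming one minimal secant agree on fixed points, hence on affine
  combinations of two of them. The lower and upper bounds for \<open>R\<close> then collapse to the
  value at the chord itself.\<close>

lemma R_inner_coordinate:
  assumes a: "a \<in> coordinates" and x: "R x = x" and u: "R u = u"
  shows "R (x + t *\<^sub>R (u - x)) \<bullet> a = x \<bullet> a + t * ((u - x) \<bullet> a)"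
proof -
  let ?w = "x + t *\<^sub>R (u - x)"
  obtain x1 z1 where m: "minimal_secant x1 z1" and a1: "a \<in> norming (x1 - z1)"
    using a unfolding coordinates_def by blast
  have R1: "R x1 = x1" "R z1 = z1" using m by (auto simp: minimal_secant_def)
  have agree: "(?w - z1) \<bullet> b = (?w - z1) \<bullet> a" if "b \<in> norming (x1 - z1)" for b
  proof -
    have "(x - z1) \<bullet> b = (x - z1) \<bullet> a" "(u - z1) \<bullet> b = (u - z1) \<bullet> a"
      using minimal_secant_functionals_agree[OF m _ that a1] x u by auto
    moreover have "?w - z1 = (1 - t) *\<^sub>R (x - z1) + t *\<^sub>R (u - z1)" by (simp add: algebra_simps)
    ultimately show ?thesis by (simp only: inner_add_left inner_scaleR_left)
  qed
  have "R ?w \<bullet> a = ?w \<bullet> a"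
    using R_inner_lower[OF R1 a1, of ?w] R_inner_upper[OF R1 a1, of ?w] agree
    by (force simp: inner_diff_left)
  then show ?thesis by (simp add: inner_add_left)
qed

lemma N_segment_ge:
  assumes x: "R x = x" and y: "R y = y" and y': "R y' = y'" and t: "t \<ge> 0"
  shows "t * N (y - y') \<le> N (R (x + t *\<^sub>R (y - x)) - R (x + t *\<^sub>R (y' - x)))"
proof (cases "y = y'")
  case False
  then obtain a where a: "a \<in> coordinates" "a \<in> norming (y - y')"
    using coordinates_norming y y' by blast
  have "(R (x + t *\<^sub>R (y - x)) - R (x + t *\<^sub>R (y' - x))) \<bullet> a = t * ((y - y') \<bullet> a)"
    unfolding inner_diff_left[of "R _"] R_inner_coordinate[OF a(1) x y] R_inner_coordinate[OF a(1) x y']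
    by (simp add: inner_diff_left algebra_simps)
  also have "\<dots> = t * N (y - y')" using a(2) by (simp add: norming_def)
  finally show ?thesis using inner_le_N[of a] a(2) unfolding norming_def by (metis (lifting) mem_Collect_eq)
qed simp

lemma N_segment_convex:
  assumes q: "R q = q" and x: "R x = x" and y: "R y = y" and t: "0 \<le> t" "t \<le> 1"
  shows "N (q - R (x + t *\<^sub>R (y - x))) \<le> (1 - t) * N (q - x) + t * N (q - y)"
proof (cases "q = R (x + t *\<^sub>R (y - x))")
  case True
  then have "N (q - R (x + t *\<^sub>R (y - x))) = 0" by simp
  then show ?thesis using t by (metis N_nonneg add_nonneg_nonneg diff_ge_0_iff_ge mult_nonneg_nonneg)
next
  case False
  then obtain a where a: "a \<in> coordinates" "a \<in> norming (q - R (x + t *\<^sub>R (y - x)))"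
    using coordinates_norming q R_idem by blast
  have aP: "a \<in> P" using a(1) coordinates_in_P by blast
  have "N (q - R (x + t *\<^sub>R (y - x))) = (1 - t) * ((q - x) \<bullet> a) + t * ((q - y) \<bullet> a)"
    using a(2) unfolding norming_def mem_Collect_eq inner_diff_left[of q] R_inner_coordinate[OF a(1) x y]
    by (simp add: inner_diff_left algebra_simps)
  also have "\<dots> \<le> (1 - t) * N (q - x) + t * N (q - y)"
    using t by (intro add_mono mult_left_mono inner_le_N aP) auto
  finally show ?thesis .
qed

text \<open>Coordinates are Busemann functions of lines, and \<open>f\<close> maps these lines to geodesics; convexity of the
  distance to both ends makes the coordinates of the inverse \<open>g\<close> of \<open>f\<close> affine (a substitute for the
  Mazur-Ulam theorem).\<close>

lemma isometry_preserves_segments: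
  assumes f: "\<And>x. R x = x \<Longrightarrow> R (f x) = f x" and g: "\<And>x. R x = x \<Longrightarrow> R (g x) = g x"
    and fg: "\<And>x. R x = x \<Longrightarrow> f (g x) = x"
    and iso: "\<And>x y. R x = x \<Longrightarrow> R y = y \<Longrightarrow> N (f x - f y) = N (x - y)"
    and x0: "R x0 = x0" "f x0 = x0" and x: "R x = x" and t: "0 \<le> t" "t \<le> 1"
  shows "f (R (x0 + t *\<^sub>R (x - x0))) = R (x0 + t *\<^sub>R (f x - x0))"
proof -
  define u where "u = R (x0 + t *\<^sub>R (f x - x0))"
  have Ru: "R u = u" by (simp add: u_def R_idem)
  define v where "v = g u"
  have Rv: "R v = v" and fv: "f v = u" using g fg Ru by (auto simp: v_def)
  have ge: "t * ((x - x0) \<bullet> a) \<le> (v - x0) \<bullet> a" if coord: "a \<in> coordinates" for a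
  proof -
    obtain x1 z1 where m: "minimal_secant x1 z1" and a: "a \<in> norming (x1 - z1)"
      using coord unfolding coordinates_def by blast
    define e where "e = x1 - z1"
    have l: "straight_line z1 e" unfolding e_def by (rule minimal_secant_line[OF m])
    \<comment> \<open>For a minimal secant the minimum in \<open>low\<close> runs over equal values,
      so up to sign and a constant the Busemann function of the line is the coordinate
      \<open>a\<close>.\<close>
    have low: "low z1 e y = (y - z1) \<bullet> a" if "R y = y" for y
      using low_attained[of e y z1] minimal_secant_functionals_agree[OF m that _ a]
      by (auto simp: e_def)
    have "\<forall>\<^sub>F s in at_top :: real filter. t * ((x - x0) \<bullet> a) \<le> (v - x0) \<bullet> a"
      using N_line_eventually[OF l Rv] N_line_eventually[OF l x0(1)] N_line_eventually[OF l x]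
    proof eventually_elim
      case (elim s)
      let ?y = "R (z1 + s *\<^sub>R e)"
      \<comment> \<open>Convexity is used on the image side, where \<open>u\<close> lies on a curve
        by construction; the isometry then pulls the three distances back.\<close>
      have "N (f ?y - u) \<le> (1 - t) * N (f ?y - x0) + t * N (f ?y - f x)"
        unfolding u_def by (intro N_segment_convex f R_idem x0 x t)
      moreover have "N (f ?y - u) = N (?y - v)" "N (f ?y - x0) = N (?y - x0)" "N (f ?y - f x) = N (?y - x)"
        using iso[OF R_idem Rv] iso[OF R_idem x0(1)] iso[OF R_idem x] fv x0(2) by auto
      ultimately have "s * N e - low z1 e v \<le> (1 - t) * (s * N e - low z1 e x0) + t * (s * N e - low z1 e x)"
        using elim by simp
      then show ?case unfolding low[OF Rv] low[OF x0(1)] low[OF x]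
        by (simp add: inner_diff_left algebra_simps)
    qed
    then show ?thesis by simp
  qed
  have "v = R (x0 + t *\<^sub>R (x - x0))"
  proof (rule eq_by_coordinates[OF Rv R_idem])
    fix a assume a: "a \<in> coordinates"
    have "t * ((x - x0) \<bullet> (- a)) \<le> (v - x0) \<bullet> (- a)" by (rule ge[OF coordinates_uminus[OF a]])
    then show "v \<bullet> a = R (x0 + t *\<^sub>R (x - x0)) \<bullet> a"
      unfolding R_inner_coordinate[OF a x0(1) x] using ge[OF a] by (simp add: inner_diff_left algebra_simps)
  qed
  then show ?thesis using fv u_def by simp
qed

end

section \<open>Iterates and the derivative at a fixed point\<close>

text \<open>Besides the derivative at one fixed point, this is all that the geometric argument takes
  from analyticity.\<close>

definition line_rigid :: "('a::euclidean_space \<Rightarrow> 'a) \<Rightarrow> bool" where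
  "line_rigid h \<longleftrightarrow> (\<forall>z e a c s. (\<forall>t\<in>{0..1}. h (z + t *\<^sub>R e) \<bullet> a = c + t * s) \<longrightarrow>
     (\<forall>t. h (z + t *\<^sub>R e) \<bullet> a = c + t * s))"

text \<open>The directions \<open>w i\<close> may vary, as the remainder of a Frechet derivative is
  uniformly small on bounded sets of directions. The blow-up below only supplies convergent
  directions.\<close>

lemma has_derivative_at_fixed_point_tendsto:
  fixes F :: "'a::real_normed_vector \<Rightarrow> 'a"
  assumes F: "(F has_derivative D) (at x0)" and x0: "F x0 = x0"
    and t: "\<And>i. t i > 0" "t \<longlonglongrightarrow> 0" and w: "w \<longlonglongrightarrow> \<xi>"
  shows "(\<lambda>i. (1 / t i) *\<^sub>R (F (x0 + t i *\<^sub>R w i) - x0)) \<longlonglongrightarrow> D \<xi>"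
proof -
  have D: "bounded_linear D" using F by (rule has_derivative_bounded_linear)
  obtain M where M: "M > 0" "\<And>i. norm (w i) \<le> M"
    using convergent_imp_Bseq[OF convergentI[OF w]] unfolding Bseq_def by blast
  have "(\<lambda>i. (1 / t i) *\<^sub>R (F (x0 + t i *\<^sub>R w i) - x0) - D (w i)) \<longlonglongrightarrow> 0"
  proof (rule LIMSEQ_I)
    fix e :: real assume "e > 0"
    then have "e / (2 * M) > 0" using M by simp
    then obtain \<delta> where \<delta>: "\<delta> > 0"
      "\<And>y. norm (y - x0) < \<delta> \<Longrightarrow> norm (F y - F x0 - D (y - x0)) \<le> e / (2 * M) * norm (y - x0)"
      using F unfolding has_derivative_at_alt by blast
    have "\<delta> / M > 0" using \<delta> M by simp
    then obtain n where n: "\<And>i. i \<ge> n \<Longrightarrow> t i < \<delta> / M"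
      using order_tendstoD(2)[OF t(2)] unfolding eventually_sequentially by blast
    have "norm ((1 / t i) *\<^sub>R (F (x0 + t i *\<^sub>R w i) - x0) - D (w i)) < e" if "i \<ge> n" for i
    proof -
      have "norm (t i *\<^sub>R w i) \<le> t i * M" using t(1)[of i] M by simp
      also have "\<dots> < \<delta>" using n[OF that] M by (simp add: field_simps)
      finally have "norm (F (x0 + t i *\<^sub>R w i) - x0 - D (t i *\<^sub>R w i)) \<le> e / (2 * M) * norm (t i *\<^sub>R w i)"
        using \<delta>(2)[of "x0 + t i *\<^sub>R w i"] x0 by simp
      also have "\<dots> \<le> e / (2 * M) * (t i * M)"
        using \<open>norm (t i *\<^sub>R w i) \<le> t i * M\<close> \<open>e / (2 * M) > 0\<close> by (intro mult_left_mono) auto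
      also have "\<dots> = t i * (e / 2)" using M by simp
      finally have *: "norm (F (x0 + t i *\<^sub>R w i) - x0 - D (t i *\<^sub>R w i)) \<le> t i * (e / 2)" .
      have "(1 / t i) *\<^sub>R (F (x0 + t i *\<^sub>R w i) - x0) - D (w i)
          = (1 / t i) *\<^sub>R (F (x0 + t i *\<^sub>R w i) - x0 - D (t i *\<^sub>R w i))"
        using t(1)[of i] by (simp add: bounded_linear.linear[OF D] linear_scale scaleR_diff_right)
      also have "norm \<dots> = (1 / t i) * norm (F (x0 + t i *\<^sub>R w i) - x0 - D (t i *\<^sub>R w i))"
        using t(1)[of i] by simp
      also have "\<dots> \<le> (1 / t i) * (t i * (e / 2))"
        using * t(1)[of i] by (intro mult_left_mono) auto
      also have "\<dots> < e" using t(1)[of i] \<open>e > 0\<close> by simp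
      finally show ?thesis .
    qed
    then show "\<exists>no. \<forall>i\<ge>no. norm ((1 / t i) *\<^sub>R (F (x0 + t i *\<^sub>R w i) - x0) - D (w i) - 0) < e"
      by (intro exI[of _ n]) simp
  qed
  moreover have "(\<lambda>i. D (w i)) \<longlonglongrightarrow> D \<xi>" by (rule bounded_linear.tendsto[OF D w])
  ultimately have "(\<lambda>i. (1 / t i) *\<^sub>R (F (x0 + t i *\<^sub>R w i) - x0) - D (w i) + D (w i)) \<longlonglongrightarrow> 0 + D \<xi>"
    by (rule tendsto_add)
  then show ?thesis by simp
qed

lemma has_derivative_funpow:
  assumes "(f has_derivative D) (at x0)" "f x0 = x0"
  shows "((f ^^ j) has_derivative (D ^^ j)) (at x0)"
proof (induction j)
  case 0
  show ?case by (simp add: id_def)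
next
  case (Suc j)
  have "(f ^^ j) x0 = x0" using assms(2) by (induction j) auto
  then have "((f \<circ> f ^^ j) has_derivative (D \<circ> D ^^ j)) (at x0)"
    using diff_chain_at[OF Suc.IH, of f D] assms(1) by simp
  then show ?case by (simp only: funpow.simps)
qed

context polyhedral_norm
begin

section \<open>Derivative and blow-up at a fixed point\<close>

lemma derivative_nonexp:
  assumes f: "nonexp f" and x0: "f x0 = x0" and D: "(f has_derivative D) (at x0)"
  shows "nonexp D"
proof -
  have lin: "linear D" using D by (rule has_derivative_linear)
  have "N (D v) \<le> N v" for v
  proof -
    let ?t = "\<lambda>i. inverse (real (Suc i))"
    have lim: "(\<lambda>i. (1 / ?t i) *\<^sub>R (f (x0 + ?t i *\<^sub>R v) - x0)) \<longlonglongrightarrow> D v"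
      by (rule has_derivative_at_fixed_point_tendsto[OF D x0 _ LIMSEQ_inverse_real_of_nat tendsto_const]) simp
    have "N ((1 / ?t i) *\<^sub>R (f (x0 + ?t i *\<^sub>R v) - x0)) \<le> N v" for i
    proof -
      have "N (f (x0 + ?t i *\<^sub>R v) - x0) \<le> ?t i * N v"
        using nonexpD[OF f, of "x0 + ?t i *\<^sub>R v" x0] x0 by simp
      then have "(1 / ?t i) * N (f (x0 + ?t i *\<^sub>R v) - x0) \<le> (1 / ?t i) * (?t i * N v)"
        by (intro mult_left_mono) auto
      also have "\<dots> = N v" by simp
      finally show ?thesis by (simp only: N_scaleR) simp
    qed
    then show ?thesis using LIMSEQ_le_const2[OF tendsto_N[OF lim]] by blast
  qed
  then show ?thesis unfolding nonexp_def by (simp add: linear_diff[OF lin, symmetric])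
qed

lemma average_straight_retraction:
  assumes g: "nonexp g" and x0: "g x0 = x0" and rigid: "\<And>k. line_rigid (average g ^^ k)"
  obtains R where "straight_retraction P R" "\<And>x. R x = x \<longleftrightarrow> g x = x"
proof -
  obtain R where R: "\<And>x. (\<lambda>k. (average g ^^ k) x) \<longlonglongrightarrow> R x" "\<And>x. g (R x) = R x"
    "\<And>x. g x = x \<Longrightarrow> R x = x" "nonexp R"
    using average_retraction[of g x0, OF g x0] by blast
  have fixed: "R x = x \<longleftrightarrow> g x = x" for x using R(2)[of x] R(3)[of x] by auto
  have "R (z + t *\<^sub>R (x - z)) \<bullet> a = z \<bullet> a + t * N (x - z)"
    if x: "R x = x" and z: "R z = z" and a: "a \<in> norming (x - z)" for x z a t
  proof -
    have aP: "a \<in> P" and eq: "(x - z) \<bullet> a = N (x - z)" using a by (auto simp: norming_def)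
    have "(average g ^^ k) (z + t *\<^sub>R (x - z)) \<bullet> a = z \<bullet> a + t * N (x - z)" for k t
    proof -
      let ?h = "average g ^^ k"
      have h: "nonexp ?h" by (rule nonexp_funpow[OF nonexp_average[OF g]])
      have fix_h: "?h y = y" if "R y = y" for y
      proof -
        have "average g y = y" using that fixed average_fixed_iff by blast
        then show ?thesis by (induction k) auto
      qed
      have "?h (z + t *\<^sub>R (x - z)) \<bullet> a = z \<bullet> a + t * N (x - z)" if t: "t \<in> {0..1}" for t
      proof -
        let ?w = "z + t *\<^sub>R (x - z)"
        \<comment> \<open>The bounds from the two ends add up to \<open>N (x - z)\<close>, the value
          of \<open>a\<close> on \<open>x - z\<close>, so neither can be strict.\<close>
        have "(?h ?w - z) \<bullet> a \<le> N (?w - z)"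
          using inner_le_N[OF aP, of "?h ?w - z"] nonexpD[OF h, of ?w z, unfolded fix_h[OF z]] by linarith
        also have "\<dots> = t * N (x - z)" using t by simp
        finally have upper: "?h ?w \<bullet> a \<le> z \<bullet> a + t * N (x - z)" by (simp add: inner_diff_left)
        have "x - ?w = (1 - t) *\<^sub>R (x - z)" by (simp add: algebra_simps)
        then have "N (x - ?w) = (1 - t) * N (x - z)" using t by simp
        moreover have "(x - ?h ?w) \<bullet> a \<le> N (x - ?w)"
          using inner_le_N[OF aP, of "x - ?h ?w"] nonexpD[OF h, of x ?w, unfolded fix_h[OF x]] by linarith
        ultimately have "(x - ?h ?w) \<bullet> a \<le> (1 - t) * N (x - z)" by simp
        then have "z \<bullet> a + t * N (x - z) \<le> ?h ?w \<bullet> a"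
          using eq unfolding inner_diff_left left_diff_distrib by linarith
        with upper show ?thesis by linarith
      qed
      \<comment> \<open>Rigidity is applied to each iterate before the limit, since \<open>R\<close>
        itself is not known to be analytic.\<close>
      then show ?thesis using rigid[of k] unfolding line_rigid_def by blast
    qed
    then have "(\<lambda>k. z \<bullet> a + t * N (x - z)) \<longlonglongrightarrow> R (z + t *\<^sub>R (x - z)) \<bullet> a"
      using tendsto_inner[OF R(1)[of "z + t *\<^sub>R (x - z)"] tendsto_const[of a]] by simp
    then show ?thesis using LIMSEQ_unique tendsto_const by blast
  qed
  then have "straight_retraction P R"
    using R fixed polyhedral_norm_axioms unfolding straight_retraction_def straight_retraction_axioms_def
    by blast
  then show ?thesis using that fixed by blast
qed

text \<open>Blow-up at \<open>x0\<close>: a periodic point that is not fixed yields, by scaling towards \<open>x0\<close>, a vector whose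
  orbit under the derivative has steps of constant positive length.\<close>

lemma periodic_imp_fixed:
  assumes f: "nonexp f" and x0: "f x0 = x0" and D: "(f has_derivative D) (at x0)"
    and conv: "\<And>v. convergent (\<lambda>k. (D ^^ k) v)"
    and rigid: "\<And>k. line_rigid (average (f ^^ m) ^^ k)"
    and m: "m \<ge> 1" and x: "(f ^^ m) x = x"
  shows "f x = x"
proof (rule ccontr)
  assume nfx: "f x \<noteq> x"
  have fpow_x0: "(f ^^ k) x0 = x0" for k by (induction k) (auto simp: x0)
  obtain R where "straight_retraction P R" and fixed: "\<And>x. R x = x \<longleftrightarrow> (f ^^ m) x = x"
    using average_straight_retraction[OF nonexp_funpow[OF f] fpow_x0 rigid] by blast
  then interpret straight_retraction P R by simp
  have Rx0: "R x0 = x0" and Rx: "R x = x" using fixed fpow_x0 x by auto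
  have Rf: "R ((f ^^ j) y) = (f ^^ j) y" if "R y = y" for j y
    using that unfolding fixed by (metis funpow_commute)
  have inv: "(f ^^ (m - 1)) (f y) = y" "f ((f ^^ (m - 1)) y) = y" if "R y = y" for y
  proof -
    have "f ^^ m = f ^^ (m - 1) \<circ> f" "f ^^ m = f \<circ> f ^^ (m - 1)"
      using m by (metis Suc_diff_1 funpow_Suc_right less_eq_Suc_le One_nat_def)
         (metis m Suc_diff_1 funpow.simps(2) less_eq_Suc_le One_nat_def)
    then show "(f ^^ (m - 1)) (f y) = y" "f ((f ^^ (m - 1)) y) = y"
      using that unfolding fixed by (metis comp_apply)+
  qed
  have iso: "N (f y - f y') = N (y - y')" if "R y = y" "R y' = y'" for y y'
    using nonexpD[OF f, of y y'] nonexpD[OF nonexp_funpow[OF f], of "m - 1" "f y" "f y'"]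
      inv(1)[OF that(1)] inv(1)[OF that(2)] by simp
  \<comment> \<open>Contraction towards \<open>x0\<close> inside the fixed points of
    \<open>f ^^ m\<close>; by \<open>f_seg\<close> it commutes with \<open>f\<close>.\<close>
  define seg where "seg = (\<lambda>y t. R (x0 + t *\<^sub>R (y - x0)))"
  have f_seg: "f (seg y t) = seg (f y) t" if "R y = y" "0 \<le> t" "t \<le> 1" for y t
    unfolding seg_def
    by (rule isometry_preserves_segments[where g = "f ^^ (m - 1)"])
       (use Rf[of _ 1] Rf[of _ "m - 1"] inv iso Rx0 x0 that in auto)
  have fj_seg: "(f ^^ j) (seg x t) = seg ((f ^^ j) x) t" if "0 \<le> t" "t \<le> 1" for j t
    using that by (induction j) (auto simp: f_seg Rf[OF Rx])
  define d where "d = N (f x - x)"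
  have "d > 0" using nfx by (simp add: d_def N_pos_iff)
  have step: "N ((f ^^ Suc j) x - (f ^^ j) x) = d" for j
  proof (induction j)
    case (Suc j)
    then show ?case using iso[OF Rf[OF Rx, of "Suc j"] Rf[OF Rx, of j]] by simp
  qed (simp add: d_def)
  let ?t = "\<lambda>i. inverse (real (Suc i))"
  have t: "0 < ?t i" "?t i \<le> 1" for i by (auto simp: field_simps)
  define w where "w = (\<lambda>i. (1 / ?t i) *\<^sub>R (seg x (?t i) - x0))"
  have segw: "seg x (?t i) = x0 + ?t i *\<^sub>R w i" for i using t[of i] by (simp add: w_def)
  obtain K where K: "K > 0" "\<And>x. norm x \<le> K * N x" using norm_le_N by blast
  have "norm (w i) \<le> K * N (x - x0)" for i
  proof -
    have "N (seg x (?t i) - x0) \<le> ?t i * N (x - x0)"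
      unfolding seg_def using R_le[OF Rx0, of "x0 + ?t i *\<^sub>R (x - x0)"] t(1)[of i] by simp
    then have "(1 / ?t i) * N (seg x (?t i) - x0) \<le> (1 / ?t i) * (?t i * N (x - x0))"
      by (intro mult_left_mono) auto
    also have "\<dots> = N (x - x0)" by simp
    finally have "N (w i) \<le> N (x - x0)" unfolding w_def by (simp only: N_scaleR) simp
    then show ?thesis using K(2)[of "w i"] K(1) by (meson mult_left_mono less_imp_le order_trans)
  qed
  then have "bounded (range w)" unfolding bounded_iff by blast
  \<comment> \<open>The curve is not known to have a tangent at \<open>x0\<close>; compactness
    yields a direction along a subsequence, which is enough.\<close>
  then obtain \<xi> r where r: "strict_mono r" "(w \<circ> r) \<longlonglongrightarrow> \<xi>"
    using bounded_imp_convergent_subsequence by blast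
  have tr: "(\<lambda>i. ?t (r i)) \<longlonglongrightarrow> 0"
    using LIMSEQ_subseq_LIMSEQ[OF LIMSEQ_inverse_real_of_nat r(1)] by (simp add: o_def)
  have ge: "d \<le> N ((D ^^ Suc j) \<xi> - (D ^^ j) \<xi>)" for j
  proof -
    let ?q = "\<lambda>j i. (1 / ?t (r i)) *\<^sub>R ((f ^^ j) (x0 + ?t (r i) *\<^sub>R w (r i)) - x0)"
    have lim: "?q j \<longlonglongrightarrow> (D ^^ j) \<xi>" for j
      by (rule has_derivative_at_fixed_point_tendsto[OF has_derivative_funpow[OF D x0] fpow_x0 t(1) tr])
         (use r(2) in \<open>simp add: o_def\<close>)
    have "d \<le> N (?q (Suc j) i - ?q j i)" for i
    proof -
      \<comment> \<open>By \<open>N_segment_ge\<close> the contraction shrinks distances by no more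
        than its factor, so after rescaling every step is still at least \<open>d\<close>.
        Convergent iterates of \<open>D\<close> cannot keep such steps.\<close>
      have "?t (r i) * d \<le> N (seg ((f ^^ Suc j) x) (?t (r i)) - seg ((f ^^ j) x) (?t (r i)))"
        using N_segment_ge[OF Rx0 Rf[OF Rx] Rf[OF Rx], of "?t (r i)" "Suc j" j] t(1)[of "r i"] step[of j]
        unfolding seg_def by simp
      also have "\<dots> = N ((f ^^ Suc j) (seg x (?t (r i))) - (f ^^ j) (seg x (?t (r i))))"
        using fj_seg[of "?t (r i)"] t[of "r i"] by (metis less_imp_le)
      finally have "?t (r i) * d \<le> N ((f ^^ Suc j) (seg x (?t (r i))) - (f ^^ j) (seg x (?t (r i))))" .
      moreover have "?q (Suc j) i - ?q j i
          = (1 / ?t (r i)) *\<^sub>R ((f ^^ Suc j) (seg x (?t (r i))) - (f ^^ j) (seg x (?t (r i))))"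
        unfolding segw by (simp add: scaleR_diff_right)
      then have "N (?q (Suc j) i - ?q j i)
          = (1 / ?t (r i)) * N ((f ^^ Suc j) (seg x (?t (r i))) - (f ^^ j) (seg x (?t (r i))))"
        using t(1)[of "r i"] by (simp only: N_scaleR) (simp add: abs_of_pos)
      ultimately show ?thesis using t(1)[of "r i"] by (simp add: field_simps)
    qed
    then show ?thesis using LIMSEQ_le_const[OF tendsto_N[OF tendsto_diff[OF lim[of "Suc j"] lim[of j]]]] by blast
  qed
  obtain \<eta> where \<eta>: "(\<lambda>k. (D ^^ k) \<xi>) \<longlonglongrightarrow> \<eta>" using conv[of \<xi>] unfolding convergent_def by blast
  have "(\<lambda>k. N ((D ^^ Suc k) \<xi> - (D ^^ k) \<xi>)) \<longlonglongrightarrow> N (\<eta> - \<eta>)"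
    by (intro tendsto_N tendsto_diff LIMSEQ_Suc[OF \<eta>] \<eta>)
  then have "d \<le> N (\<eta> - \<eta>)" using ge LIMSEQ_le_const by blast
  then show False using \<open>d > 0\<close> by simp
qed

text \<open>\<open>periodic_imp_fixed\<close> is applied to \<open>f ^^ q\<close> and its derivative
  \<open>D ^^ q\<close>, so recurrent points of \<open>f ^^ q\<close> are fixed at once and periods
  of single points never have to be combined.\<close>

theorem iterates_converge:
  assumes f: "nonexp f" and x0: "f x0 = x0" and D: "(f has_derivative D) (at x0)"
    and conv: "\<And>v. convergent (\<lambda>k. ((D ^^ q) ^^ k) v)"
    and rigid: "\<And>m k. line_rigid (average (f ^^ m) ^^ k)"
  shows "\<exists>y. (f ^^ q) y = y \<and> (\<lambda>k. (f ^^ (k * q)) x) \<longlonglongrightarrow> y"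
proof -
  let ?h = "f ^^ q"
  have h: "nonexp ?h" by (rule nonexp_funpow[OF f])
  have hx0: "?h x0 = x0" by (induction q) (auto simp: x0)
  have "?h y = y" if "recurrent ?h y" for y
  proof -
    obtain m where m: "m \<ge> 1" "(?h ^^ m) y = y"
      using recurrent_imp_periodic[OF h hx0 \<open>recurrent ?h y\<close>] by blast
    show ?thesis
      by (rule periodic_imp_fixed[OF h hx0 has_derivative_funpow[OF D x0] conv _ m])
         (simp only: funpow_mult rigid)
  qed
  from convergent_iterates[OF h hx0 this, of x] show ?thesis
    by (simp add: funpow_mult mult.commute)
qed

lemma linear_iterates_converge:
  assumes A: "linear A" "nonexp A" and per: "\<And>v k. k \<ge> 1 \<Longrightarrow> (A ^^ k) v = v \<Longrightarrow> (A ^^ q) v = v"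
    and q: "q \<ge> 1"
  shows "convergent (\<lambda>k. ((A ^^ q) ^^ k) v)"
proof -
  let ?h = "A ^^ q"
  have h: "nonexp ?h" by (rule nonexp_funpow[OF A(2)])
  have h0: "?h 0 = 0" by (induction q) (auto simp: linear_0[OF A(1)])
  have "?h y = y" if "recurrent ?h y" for y
  proof -
    obtain m where "m \<ge> 1" "(?h ^^ m) y = y"
      using recurrent_imp_periodic[OF h h0 \<open>recurrent ?h y\<close>] by blast
    then show ?thesis using per[of "q * m" y] q by (simp add: funpow_mult)
  qed
  from convergent_iterates[OF h h0 this, of v] show ?thesis unfolding convergent_def by blast
qed

end

section \<open>Real analytic maps on lines\<close>

text \<open>Real analyticity along curves, via local holomorphic extensions: this notion is stable
  under composition with maps given locally by multivariate power series.\<close>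

definition analytic_fun :: "(real \<Rightarrow> real) \<Rightarrow> bool" where
  "analytic_fun k \<longleftrightarrow> (\<forall>t0. \<exists>r>0. \<exists>G. G holomorphic_on ball (complex_of_real t0) r \<and>
     (\<forall>t. dist t0 t < r \<longrightarrow> G (complex_of_real t) = complex_of_real (k t)))"

definition analytic_curve :: "(real \<Rightarrow> real^'n) \<Rightarrow> bool" where
  "analytic_curve c \<longleftrightarrow> (\<forall>i. analytic_fun (\<lambda>t. c t $ i))"

definition preserves_analytic_curves :: "(real^'n \<Rightarrow> real^'n) \<Rightarrow> bool" where
  "preserves_analytic_curves h \<longleftrightarrow> (\<forall>c. analytic_curve c \<longrightarrow> analytic_curve (\<lambda>t. h (c t)))"

lemma analytic_fun_affine: "analytic_fun (\<lambda>t. b + t * s)"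
  unfolding analytic_fun_def
proof
  fix t0
  show "\<exists>r>0. \<exists>G. G holomorphic_on ball (complex_of_real t0) r \<and>
     (\<forall>t. dist t0 t < r \<longrightarrow> G (complex_of_real t) = complex_of_real (b + t * s))"
    by (intro exI[of _ 1] exI[of _ "\<lambda>z. of_real b + z * of_real s"] conjI holomorphic_intros) auto
qed

lemma analytic_fun_add:
  assumes "analytic_fun f" "analytic_fun g"
  shows "analytic_fun (\<lambda>t. f t + g t)"
  unfolding analytic_fun_def
proof
  fix t0
  obtain r F where F: "r > 0" "F holomorphic_on ball (complex_of_real t0) r"
    "\<And>t. dist t0 t < r \<Longrightarrow> F (complex_of_real t) = complex_of_real (f t)"
    using assms(1) unfolding analytic_fun_def by metis
  obtain s G where G: "s > 0" "G holomorphic_on ball (complex_of_real t0) s"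
    "\<And>t. dist t0 t < s \<Longrightarrow> G (complex_of_real t) = complex_of_real (g t)"
    using assms(2) unfolding analytic_fun_def by metis
  have "(\<lambda>z. F z + G z) holomorphic_on ball (complex_of_real t0) (min r s)"
    by (intro holomorphic_on_add holomorphic_on_subset[OF F(2)] holomorphic_on_subset[OF G(2)]) auto
  then show "\<exists>r>0. \<exists>H. H holomorphic_on ball (complex_of_real t0) r \<and>
     (\<forall>t. dist t0 t < r \<longrightarrow> H (complex_of_real t) = complex_of_real (f t + g t))"
    using F G by (intro exI[of _ "min r s"] exI[of _ "\<lambda>z. F z + G z"]) auto
qed

lemma analytic_fun_cmult:
  assumes "analytic_fun f"
  shows "analytic_fun (\<lambda>t. f t * b)"
  unfolding analytic_fun_def
proof
  fix t0
  obtain r F where F: "r > 0" "F holomorphic_on ball (complex_of_real t0) r"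
    "\<And>t. dist t0 t < r \<Longrightarrow> F (complex_of_real t) = complex_of_real (f t)"
    using assms unfolding analytic_fun_def by metis
  have "(\<lambda>z. F z * of_real b) holomorphic_on ball (complex_of_real t0) r"
    by (intro holomorphic_intros F)
  then show "\<exists>r>0. \<exists>H. H holomorphic_on ball (complex_of_real t0) r \<and>
     (\<forall>t. dist t0 t < r \<longrightarrow> H (complex_of_real t) = complex_of_real (f t * b))"
    using F by (intro exI[of _ r] exI[of _ "\<lambda>z. F z * of_real b"]) auto
qed

lemma analytic_fun_sum:
  assumes "finite I" "\<And>i. i \<in> I \<Longrightarrow> analytic_fun (f i)"
  shows "analytic_fun (\<lambda>t. \<Sum>i\<in>I. f i t)"
  using assms
proof (induction I rule: finite_induct)
  case empty
  show ?case using analytic_fun_affine[of 0 0] by simp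
next
  case (insert i I)
  then show ?case by (simp add: analytic_fun_add)
qed

text \<open>The identity theorem through connectedness of the line: the points near which the
  formula holds form a clopen set. The domain of a local extension at a limit point contains
  accumulating real points where the formula holds.\<close>

lemma analytic_fun_identity:
  assumes k: "analytic_fun k" and eq: "\<And>t. t \<in> {0..1} \<Longrightarrow> k t = b + t * s"
  shows "k t = b + t * s"
proof -
  define S where "S = {t. \<exists>e>0. \<forall>u. dist t u < e \<longrightarrow> k u = b + u * s}"
  have "open S"
    unfolding open_dist
  proof
    fix t assume "t \<in> S"
    then obtain e where e: "e > 0" "\<And>u. dist t u < e \<Longrightarrow> k u = b + u * s" unfolding S_def by blast
    have "y \<in> S" if "dist y t < e / 2" for y
    proof -
      have "dist t u < e" if "dist y u < e / 2" for u
        using that \<open>dist y t < e / 2\<close> dist_triangle[of t u y] by (simp add: dist_commute)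
      then have "\<forall>u. dist y u < e / 2 \<longrightarrow> k u = b + u * s" using e(2) by blast
      then show ?thesis unfolding S_def using e(1) by (auto intro!: exI[of _ "e / 2"])
    qed
    then show "\<exists>e>0. \<forall>y. dist y t < e \<longrightarrow> y \<in> S" using e(1) by (intro exI[of _ "e / 2"]) auto
  qed
  moreover have "closed S"
  proof (subst closure_subset_eq[symmetric], rule subsetI)
    fix t assume t: "t \<in> closure S"
    obtain r G where G: "r > 0" "G holomorphic_on ball (complex_of_real t) r"
      "\<And>u. dist t u < r \<Longrightarrow> G (complex_of_real u) = complex_of_real (k u)"
      using k unfolding analytic_fun_def by metis
    obtain t1 where t1: "t1 \<in> S" "dist t1 t < r" using t G(1) unfolding closure_approachable by blast
    then obtain e where e: "e > 0" "\<And>u. dist t1 u < e \<Longrightarrow> k u = b + u * s" unfolding S_def by blast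
    define U where "U = complex_of_real ` {u. dist t1 u < e \<and> dist t u < r}"
    have "complex_of_real t1 islimpt U"
      unfolding islimpt_approachable
    proof (intro allI impI)
      fix d :: real assume "d > 0"
      define x where "x = min (min d e) (r - dist t1 t) / 2"
      have x: "x > 0" "x < d" "x < e" "x < r - dist t1 t"
        using \<open>d > 0\<close> e(1) t1(2) by (auto simp: x_def)
      then have "dist t (t1 + x) < r" "dist t1 (t1 + x) < e" by (auto simp: dist_real_def)
      then have "complex_of_real (t1 + x) \<in> U" unfolding U_def by (intro imageI) auto
      moreover have "complex_of_real (t1 + x) \<noteq> complex_of_real t1" using x(1) by (simp add: of_real_eq_iff)
      moreover have "dist (complex_of_real (t1 + x)) (complex_of_real t1) < d"
        using x by (simp add: dist_of_real dist_real_def del: of_real_add)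
      ultimately show "\<exists>x'\<in>U. x' \<noteq> complex_of_real t1 \<and> dist x' (complex_of_real t1) < d" by blast
    qed
    moreover have "(\<lambda>z. G z - (of_real b + z * of_real s)) holomorphic_on ball (complex_of_real t) r"
      by (intro holomorphic_intros G)
    moreover have "U \<subseteq> ball (complex_of_real t) r"
      unfolding U_def by auto
    moreover have "complex_of_real t1 \<in> ball (complex_of_real t) r"
      using t1(2) by (simp add: dist_commute)
    moreover have "G z - (of_real b + z * of_real s) = 0" if "z \<in> U" for z
      using that G(3) e(2) by (auto simp: U_def)
    ultimately have zero: "G z - (of_real b + z * of_real s) = 0" if "z \<in> ball (complex_of_real t) r" for z
      using analytic_continuation[of "\<lambda>z. G z - (of_real b + z * of_real s)" "ball (complex_of_real t) r"
          U "complex_of_real t1" z] that by auto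
    have "k u = b + u * s" if "dist t u < r" for u
    proof -
      have "complex_of_real (k u) = complex_of_real (b + u * s)"
        using zero[of "complex_of_real u"] G(3)[OF that] that by simp
      then show ?thesis by (simp only: of_real_eq_iff)
    qed
    then show "t \<in> S" unfolding S_def using G(1) by blast
  qed
  moreover have "1 / 2 \<in> S"
    unfolding S_def by (auto intro!: exI[of _ "1/2"] eq simp: dist_real_def abs_if split: if_splits)
  ultimately have "S = UNIV" using clopen[of S] by auto
  then have "t \<in> S" by simp
  then show ?thesis unfolding S_def by auto
qed

text \<open>At the corner of a small cube all monomials are positive, and summability of reals is
  absolute; so the series at that corner dominates the series on the whole polydisc.\<close>

lemma power_series_majorant:
  fixes a :: "real^'n"
  assumes r: "r > 0" and sum: "\<And>x. x \<in> ball a r \<Longrightarrow>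
      ((\<lambda>\<alpha>. c \<alpha> * (\<Prod>i\<in>UNIV. (x $ i - a $ i) ^ \<alpha> i)) has_sum g x) UNIV"
  obtains \<rho> where "\<rho> > 0" "\<And>x. (\<And>i. \<bar>x $ i - a $ i\<bar> \<le> \<rho>) \<Longrightarrow> x \<in> ball a r"
    "(\<lambda>\<alpha>. \<bar>c \<alpha>\<bar> * (\<Prod>i\<in>UNIV. \<rho> ^ \<alpha> i)) summable_on UNIV"
proof
  \<comment> \<open>The dimension comes from bounding the norm by the sum of the coordinates; the
    factor 2 keeps the cube in the open ball.\<close>
  let ?\<rho> = "r / (2 * CARD('n))"
  show \<rho>: "?\<rho> > 0" using r by simp
  show ball: "x \<in> ball a r" if "\<And>i. \<bar>x $ i - a $ i\<bar> \<le> ?\<rho>" for x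
  proof -
    have "norm (x - a) \<le> (\<Sum>i\<in>UNIV. \<bar>(x - a) $ i\<bar>)" by (rule norm_le_l1_cart)
    also have "\<dots> \<le> (\<Sum>i\<in>(UNIV::'n set). ?\<rho>)" using that by (intro sum_mono) simp
    also have "\<dots> < r" using r by simp
    finally show ?thesis by (simp add: dist_norm norm_minus_commute)
  qed
  have "(\<lambda>\<alpha>. c \<alpha> * (\<Prod>i\<in>UNIV. ?\<rho> ^ \<alpha> i)) summable_on UNIV"
  proof -
    let ?x = "\<chi> i. a $ i + ?\<rho>"
    have "?x \<in> ball a r" by (rule ball) (use \<rho> in simp)
    then have "((\<lambda>\<alpha>. c \<alpha> * (\<Prod>i\<in>UNIV. (?x $ i - a $ i) ^ \<alpha> i)) has_sum g ?x) UNIV" by (rule sum)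
    then have "(\<lambda>\<alpha>. c \<alpha> * (\<Prod>i\<in>UNIV. (?x $ i - a $ i) ^ \<alpha> i)) summable_on UNIV"
      by (rule has_sum_imp_summable)
    then show ?thesis by (simp only: vec_lambda_beta add_diff_cancel_left')
  qed
  then have "(\<lambda>\<alpha>. norm (c \<alpha> * (\<Prod>i\<in>UNIV. ?\<rho> ^ \<alpha> i))) summable_on UNIV"
    by (rule summable_on_iff_abs_summable_on_real[THEN iffD1])
  then show "(\<lambda>\<alpha>. \<bar>c \<alpha>\<bar> * (\<Prod>i\<in>UNIV. ?\<rho> ^ \<alpha> i)) summable_on UNIV"
    using r by (simp add: abs_mult abs_prod power_abs)
qed

text \<open>Holomorphic extensions of the components of \<open>c\<close> are substituted into the
  power series of \<open>g\<close>. While they stay within \<open>\<rho>\<close> of the centre, the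
  majorant gives uniform convergence, so the sum is holomorphic.\<close>

lemma real_analytic_comp_analytic_curve:
  fixes c :: "real \<Rightarrow> real^'n"
  assumes g: "real_analytic g" and c: "analytic_curve c"
  shows "analytic_fun (\<lambda>t. g (c t))"
  unfolding analytic_fun_def
proof
  fix t0
  let ?t0 = "complex_of_real t0"
  define a where "a = c t0"
  obtain r cf where r: "r > 0" and sum: "\<And>x. x \<in> ball a r \<Longrightarrow>
      ((\<lambda>\<alpha>. cf \<alpha> * (\<Prod>i\<in>UNIV. (x $ i - a $ i) ^ \<alpha> i)) has_sum g x) UNIV"
    using g unfolding real_analytic_def by metis
  obtain \<rho> where \<rho>: "\<rho> > 0" "\<And>x. (\<And>i. \<bar>x $ i - a $ i\<bar> \<le> \<rho>) \<Longrightarrow> x \<in> ball a r"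
    "(\<lambda>\<alpha>. \<bar>cf \<alpha>\<bar> * (\<Prod>i\<in>UNIV. \<rho> ^ \<alpha> i)) summable_on UNIV"
    using power_series_majorant[OF r sum] by blast
  have "\<forall>i. \<exists>s>0. \<exists>G. G holomorphic_on ball ?t0 s \<and>
     (\<forall>t. dist t0 t < s \<longrightarrow> G (complex_of_real t) = complex_of_real (c t $ i))"
    using c unfolding analytic_curve_def analytic_fun_def by blast
  then obtain s G where s: "\<And>i. s i > 0" and hol: "\<And>i. G i holomorphic_on ball ?t0 (s i)"
    and ext: "\<And>i t. dist t0 t < s i \<Longrightarrow> G i (complex_of_real t) = complex_of_real (c t $ i)" by metis
  have "\<exists>d>0. \<forall>i\<in>UNIV. \<forall>z. dist ?t0 z < d \<longrightarrow> dist ?t0 z < s i \<and> norm (G i z - of_real (a $ i)) < \<rho>"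
  proof (rule finite_common_radius[where d = "dist ?t0"])
    fix i
    have "continuous_on (ball ?t0 (s i)) (G i)" using hol holomorphic_on_imp_continuous_on by blast
    then have "isCont (G i) ?t0" using s[of i] by (simp add: continuous_on_eq_continuous_at)
    then have "\<exists>d>0. \<forall>z. dist z ?t0 < d \<longrightarrow> dist (G i z) (G i ?t0) < \<rho>"
      using \<rho>(1) unfolding continuous_at_eps_delta by blast
    then obtain d where d: "d > 0" "\<And>z. dist z ?t0 < d \<Longrightarrow> dist (G i z) (G i ?t0) < \<rho>" by blast
    have "G i ?t0 = of_real (a $ i)" using ext[of t0 i] s[of i] by (simp add: a_def)
    then show "\<exists>d>0. \<forall>z. dist ?t0 z < d \<longrightarrow> dist ?t0 z < s i \<and> norm (G i z - of_real (a $ i)) < \<rho>"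
      using d s[of i] by (intro exI[of _ "min d (s i)"]) (auto simp: dist_norm norm_minus_commute)
  qed simp
  then obtain d where d: "d > 0" "\<And>i z. dist ?t0 z < d \<Longrightarrow> dist ?t0 z < s i"
    "\<And>i z. dist ?t0 z < d \<Longrightarrow> norm (G i z - of_real (a $ i)) < \<rho>" by blast
  define F where "F = (\<lambda>\<alpha> z. of_real (cf \<alpha>) * (\<Prod>i\<in>UNIV. (G i z - of_real (a $ i)) ^ \<alpha> i))"
  define H where "H = (\<lambda>z. \<Sum>\<^sub>\<infinity>\<alpha>. F \<alpha> z)"
  have sub: "cball ?t0 (d / 2) \<subseteq> ball ?t0 (s i)" for i using d(1,2) by force
  have "uniform_limit (cball ?t0 (d / 2)) (\<lambda>X z. \<Sum>\<alpha>\<in>X. F \<alpha> z) H (finite_subsets_at_top UNIV)"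
    unfolding H_def
  proof (rule Weierstrass_m_test_general[OF _ \<rho>(3)])
    fix \<alpha> z assume "z \<in> cball ?t0 (d / 2)"
    then have "dist ?t0 z < d" using d(1) by simp
    then have "norm (G i z - of_real (a $ i)) \<le> \<rho>" for i using d(3) less_imp_le by blast
    then have "(\<Prod>i\<in>UNIV. norm (G i z - of_real (a $ i)) ^ \<alpha> i) \<le> (\<Prod>i\<in>UNIV. \<rho> ^ \<alpha> i)"
      by (intro prod_mono conjI power_mono) auto
    then show "norm (F \<alpha> z) \<le> \<bar>cf \<alpha>\<bar> * (\<Prod>i\<in>UNIV. \<rho> ^ \<alpha> i)"
      unfolding F_def by (simp add: norm_mult norm_power prod_norm[symmetric] mult_left_mono)
  qed
  moreover have "(\<lambda>z. \<Sum>\<alpha>\<in>X. F \<alpha> z) holomorphic_on cball ?t0 (d / 2)" for X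
    unfolding F_def by (intro holomorphic_intros holomorphic_on_subset[OF hol sub])
  then have "\<forall>\<^sub>F X in finite_subsets_at_top UNIV. continuous_on (cball ?t0 (d / 2)) (\<lambda>z. \<Sum>\<alpha>\<in>X. F \<alpha> z) \<and>
      (\<lambda>z. \<Sum>\<alpha>\<in>X. F \<alpha> z) holomorphic_on ball ?t0 (d / 2)"
    by (intro always_eventually allI conjI)
      (blast intro: holomorphic_on_imp_continuous_on holomorphic_on_subset[OF _ ball_subset_cball])+
  ultimately have "H holomorphic_on ball ?t0 (d / 2)"
    using holomorphic_uniform_limit[of ?t0 "d / 2" "\<lambda>X z. \<Sum>\<alpha>\<in>X. F \<alpha> z" "finite_subsets_at_top UNIV" H]
    by auto
  moreover have "H (complex_of_real t) = complex_of_real (g (c t))" if t: "dist t0 t < d / 2" for t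
  proof -
    have dist: "dist ?t0 (complex_of_real t) < d" using t d(1) by simp
    have Gt: "G i (complex_of_real t) = complex_of_real (c t $ i)" for i
      using d(2)[OF dist, of i] ext[of t i] by simp
    have "\<bar>c t $ i - a $ i\<bar> \<le> \<rho>" for i
      using d(3)[OF dist, of i] unfolding Gt by (simp flip: of_real_diff)
    then have "((\<lambda>\<alpha>. cf \<alpha> * (\<Prod>i\<in>UNIV. (c t $ i - a $ i) ^ \<alpha> i)) has_sum g (c t)) UNIV"
      by (intro sum \<rho>(2))
    then have "((\<lambda>\<alpha>. complex_of_real (cf \<alpha> * (\<Prod>i\<in>UNIV. (c t $ i - a $ i) ^ \<alpha> i)))
        has_sum complex_of_real (g (c t))) UNIV"
      by (rule has_sum_of_real)
    moreover have "F \<alpha> (complex_of_real t) = complex_of_real (cf \<alpha> * (\<Prod>i\<in>UNIV. (c t $ i - a $ i) ^ \<alpha> i))" for \<alpha>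
      unfolding F_def Gt by simp
    ultimately show ?thesis unfolding H_def by (simp add: infsumI)
  qed
  ultimately show "\<exists>r>0. \<exists>G. G holomorphic_on ball ?t0 r \<and>
     (\<forall>t. dist t0 t < r \<longrightarrow> G (complex_of_real t) = complex_of_real (g (c t)))"
    using d(1) by (intro exI[of _ "d / 2"] exI[of _ H]) auto
qed

lemma real_analytic_preserves_analytic_curves:
  "\<forall>i. real_analytic (\<lambda>x. f x $ i) \<Longrightarrow> preserves_analytic_curves f"
  unfolding preserves_analytic_curves_def analytic_curve_def[of "\<lambda>t. f (_ t)"]
  using real_analytic_comp_analytic_curve by blast

lemma preserves_analytic_curves_funpow:
  "preserves_analytic_curves h \<Longrightarrow> preserves_analytic_curves (h ^^ k)"
  by (induction k) (auto simp: preserves_analytic_curves_def)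

lemma preserves_analytic_curves_line_rigid:
  assumes "preserves_analytic_curves h" shows "line_rigid h"
  unfolding line_rigid_def
proof (intro allI impI)
  fix z e a :: "real^'a" and b s t
  assume *: "\<forall>t\<in>{0..1}. h (z + t *\<^sub>R e) \<bullet> a = b + t * s"
  have "analytic_curve (\<lambda>t. z + t *\<^sub>R e)"
    unfolding analytic_curve_def using analytic_fun_affine by simp
  then have "analytic_curve (\<lambda>t. h (z + t *\<^sub>R e))"
    using assms unfolding preserves_analytic_curves_def by blast
  then have "analytic_fun (\<lambda>t. \<Sum>i\<in>UNIV. h (z + t *\<^sub>R e) $ i * a $ i)"
    unfolding analytic_curve_def by (intro analytic_fun_sum analytic_fun_cmult) auto
  then have "analytic_fun (\<lambda>t. h (z + t *\<^sub>R e) \<bullet> a)" by (simp add: inner_vec_def)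
  from analytic_fun_identity[OF this] * show "h (z + t *\<^sub>R e) \<bullet> a = b + t * s" by blast
qed

lemma real_analytic_has_derivative:
  fixes g :: "real^'n \<Rightarrow> real"
  assumes g: "real_analytic g"
  shows "\<exists>D. (g has_derivative D) (at a)"
proof -
  obtain r cf where r: "r > 0" and sum: "\<And>x. x \<in> ball a r \<Longrightarrow>
      ((\<lambda>\<alpha>. cf \<alpha> * (\<Prod>i\<in>UNIV. (x $ i - a $ i) ^ \<alpha> i)) has_sum g x) UNIV"
    using g unfolding real_analytic_def by metis
  obtain \<rho> where \<rho>: "\<rho> > 0" "\<And>x. (\<And>i. \<bar>x $ i - a $ i\<bar> \<le> \<rho>) \<Longrightarrow> x \<in> ball a r"
    "(\<lambda>\<alpha>. \<bar>cf \<alpha>\<bar> * (\<Prod>i\<in>UNIV. \<rho> ^ \<alpha> i)) summable_on UNIV"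
    using power_series_majorant[OF r sum] by blast
  let ?M = "\<lambda>\<alpha>. \<bar>cf \<alpha>\<bar> * (\<Prod>i\<in>UNIV. \<rho> ^ \<alpha> i)"
  let ?e = "\<lambda>(k::'n) i. if i = k then 1 else (0::nat)"
  \<comment> \<open>The multi-indices of degree at most one; the others form the remainder.\<close>
  let ?A = "insert (\<lambda>_. 0) (range ?e)"
  define D where "D = (\<lambda>v :: real^'n. \<Sum>k\<in>UNIV. cf (?e k) * v $ k)"
  have finA: "finite ?A" by simp
  have summ: "?M summable_on (UNIV - ?A)" using \<rho>(3) summable_on_subset_banach by blast
  define C where "C = (\<Sum>\<^sub>\<infinity>\<alpha>\<in>UNIV - ?A. ?M \<alpha>) / \<rho>\<^sup>2"
  have inj: "inj ?e" by (auto simp: inj_on_def fun_eq_iff split: if_splits)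
  have notin: "(\<lambda>_. 0) \<notin> range ?e"
  proof
    assume "(\<lambda>_. 0) \<in> range ?e"
    then obtain k where "(\<lambda>_. 0) = ?e k" by blast
    from fun_cong[OF this, of k] show False by simp
  qed
  have est: "\<bar>g y - (cf (\<lambda>_. 0) + D (y - a))\<bar> \<le> C * (norm (y - a))\<^sup>2" if y: "norm (y - a) \<le> \<rho>" for y
  proof -
    define h where "h = y - a"
    let ?T = "\<lambda>\<alpha>. cf \<alpha> * (\<Prod>i\<in>UNIV. (h $ i) ^ \<alpha> i)"
    have hi: "\<bar>h $ i\<bar> \<le> norm h" for i by (rule component_le_norm_cart)
    have "((\<lambda>\<alpha>. cf \<alpha> * (\<Prod>i\<in>UNIV. (y $ i - a $ i) ^ \<alpha> i)) has_sum g y) UNIV"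
      using y hi order_trans by (intro sum \<rho>(2)) (fastforce simp: h_def)
    then have "(?T has_sum g y) UNIV" by (simp add: h_def)
    moreover have "(?T has_sum (\<Sum>\<alpha>\<in>?A. ?T \<alpha>)) ?A" by (rule has_sum_finite[OF finA])
    ultimately have T: "(?T has_sum (g y - (\<Sum>\<alpha>\<in>?A. ?T \<alpha>))) (UNIV - ?A)" by (rule has_sum_Diff) simp
    have "(\<Sum>\<alpha>\<in>?A. ?T \<alpha>) = ?T (\<lambda>_. 0) + (\<Sum>\<alpha>\<in>range ?e. ?T \<alpha>)"
      using notin by (intro sum.insert) auto
    also have "(\<Sum>\<alpha>\<in>range ?e. ?T \<alpha>) = (\<Sum>k\<in>UNIV. ?T (?e k))" using inj by (rule sum.reindex_cong) auto
    also have "\<dots> = D h"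
      unfolding D_def
    proof (rule sum.cong[OF refl])
      fix k
      have "(\<Prod>i\<in>UNIV. (h $ i) ^ ?e k i) = (\<Prod>i\<in>UNIV. if i = k then h $ i else 1)"
        by (intro prod.cong) auto
      then show "?T (?e k) = cf (?e k) * h $ k" by simp
    qed
    finally have A: "(\<Sum>\<alpha>\<in>?A. ?T \<alpha>) = cf (\<lambda>_. 0) + D h" by simp
    \<comment> \<open>Scaling the cube by \<open>q \<le> 1\<close> multiplies a term of degree at
      least two by at most the square of \<open>q\<close>, so the majorant yields a quadratic
      remainder.\<close>
    define q where "q = norm h / \<rho>"
    have q: "0 \<le> q" "q \<le> 1" using y \<rho>(1) by (auto simp: q_def h_def)
    have bound: "\<bar>?T \<alpha>\<bar> \<le> q\<^sup>2 * ?M \<alpha>" if "\<alpha> \<in> UNIV - ?A" for \<alpha>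
    proof -
      have "2 \<le> (\<Sum>i\<in>UNIV. \<alpha> i)"
      proof -
        have "\<alpha> \<noteq> (\<lambda>_. 0)" using that by blast
        then obtain i where i: "\<alpha> i \<noteq> 0" by blast
        have "\<alpha> \<noteq> ?e i" using that by blast
        then obtain j where "\<alpha> j \<noteq> ?e i j" by (auto simp: fun_eq_iff)
        then have "(j \<noteq> i \<and> \<alpha> j \<ge> 1) \<or> \<alpha> i \<ge> 2" using i by (auto split: if_splits)
        moreover have "\<alpha> i + \<alpha> j \<le> (\<Sum>i\<in>UNIV. \<alpha> i)" if "j \<noteq> i"
          using sum_mono2[of UNIV "{i, j}" \<alpha>] that by auto
        moreover have "\<alpha> i \<le> (\<Sum>i\<in>UNIV. \<alpha> i)" by (rule member_le_sum) auto
        ultimately show ?thesis using i by force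
      qed
      have "\<bar>?T \<alpha>\<bar> = \<bar>cf \<alpha>\<bar> * (\<Prod>i\<in>UNIV. \<bar>h $ i\<bar> ^ \<alpha> i)" by (simp add: abs_mult abs_prod power_abs)
      also have "\<dots> \<le> \<bar>cf \<alpha>\<bar> * (\<Prod>i\<in>UNIV. (q * \<rho>) ^ \<alpha> i)"
        using hi \<rho>(1) by (intro mult_left_mono prod_mono conjI power_mono) (auto simp: q_def)
      also have "(\<Prod>i\<in>UNIV. (q * \<rho>) ^ \<alpha> i) = q ^ (\<Sum>i\<in>UNIV. \<alpha> i) * (\<Prod>i\<in>UNIV. \<rho> ^ \<alpha> i)"
        by (simp add: power_mult_distrib prod.distrib power_sum)
      also have "q ^ (\<Sum>i\<in>UNIV. \<alpha> i) \<le> q\<^sup>2" using q \<open>2 \<le> (\<Sum>i\<in>UNIV. \<alpha> i)\<close> by (rule power_decreasing[rotated])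
      finally show ?thesis using \<rho>(1)
        by (simp add: mult_left_mono mult_right_mono prod_nonneg mult.left_commute)
    qed
    have "((\<lambda>\<alpha>. q\<^sup>2 * ?M \<alpha>) has_sum (q\<^sup>2 * (\<Sum>\<^sub>\<infinity>\<alpha>\<in>UNIV - ?A. ?M \<alpha>))) (UNIV - ?A)"
      by (intro has_sum_cmult_right has_sum_infsum summ)
    then have M: "((\<lambda>\<alpha>. q\<^sup>2 * ?M \<alpha>) has_sum (C * (norm h)\<^sup>2)) (UNIV - ?A)"
      using \<rho>(1) by (simp add: C_def q_def power_divide field_simps)
    have "g y - (\<Sum>\<alpha>\<in>?A. ?T \<alpha>) \<le> C * (norm h)\<^sup>2"
      by (rule has_sum_mono[OF T M]) (use bound in force)
    moreover have "((\<lambda>\<alpha>. - ?T \<alpha>) has_sum - (g y - (\<Sum>\<alpha>\<in>?A. ?T \<alpha>))) (UNIV - ?A)"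
      using T by (simp only: has_sum_uminus minus_minus)
    then have "- (g y - (\<Sum>\<alpha>\<in>?A. ?T \<alpha>)) \<le> C * (norm h)\<^sup>2"
      by (rule has_sum_mono[OF _ M]) (use bound in force)
    ultimately have "\<bar>g y - (\<Sum>\<alpha>\<in>?A. ?T \<alpha>)\<bar> \<le> C * (norm h)\<^sup>2" by linarith
    then show ?thesis unfolding A by (simp only: h_def)
  qed
  have D0: "D 0 = 0" by (simp add: D_def)
  have ga: "g a = cf (\<lambda>_. 0)" using est[of a] \<rho>(1) D0 by simp
  have C: "C \<ge> 0" unfolding C_def using \<rho>(1) by (intro divide_nonneg_nonneg infsum_nonneg mult_nonneg_nonneg prod_nonneg) auto
  have "bounded_linear D"
    unfolding D_def by (intro bounded_linear_sum bounded_linear_const_mult bounded_linear_vec_nth)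
  moreover have "\<exists>d>0. \<forall>y. norm (y - a) < d \<longrightarrow> norm (g y - g a - D (y - a)) \<le> \<epsilon> * norm (y - a)"
    if "\<epsilon> > 0" for \<epsilon>
  proof -
    let ?d = "min \<rho> (\<epsilon> / (C + 1))"
    have "norm (g y - g a - D (y - a)) \<le> \<epsilon> * norm (y - a)" if y: "norm (y - a) < ?d" for y
    proof -
      have "norm (g y - g a - D (y - a)) \<le> C * (norm (y - a))\<^sup>2"
        using est[of y] y ga by (simp add: algebra_simps)
      also have "\<dots> = C * norm (y - a) * norm (y - a)" by (simp add: power2_eq_square)
      also have "C * norm (y - a) \<le> (C + 1) * (\<epsilon> / (C + 1))"
        using y C by (intro mult_mono) auto
      also have "\<dots> = \<epsilon>" using C by simp
      finally show ?thesis by (simp add: mult_right_mono)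
    qed
    then show ?thesis using \<rho>(1) that C by (intro exI[of _ ?d]) auto
  qed
  ultimately have "(g has_derivative D) (at a)" unfolding has_derivative_at_alt by blast
  then show ?thesis by blast
qed

lemma real_analytic_map_has_derivative:
  fixes f :: "real^'n \<Rightarrow> real^'n"
  assumes "\<forall>i. real_analytic (\<lambda>x. f x $ i)"
  shows "\<exists>D. (f has_derivative D) (at a)"
proof -
  have "\<forall>i. \<exists>D. ((\<lambda>x. f x $ i) has_derivative D) (at a)"
    using real_analytic_has_derivative assms by blast
  from choice[OF this] obtain D where D: "\<forall>i. ((\<lambda>x. f x $ i) has_derivative D i) (at a)" ..
  have "(f has_derivative (\<lambda>v. \<chi> i. D i v)) (at a)"
    unfolding has_derivative_componentwise_within[of f]
    using D by (auto simp: Basis_vec_def inner_axis)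
  then show ?thesis by blast
qed

section \<open>Linear maps on the sum and sup norms\<close>

text \<open>These are the vertices of the dual unit ball, a cross-polytope; for
  \<open>sum_functionals\<close> it is a cube.\<close>

definition sup_functionals :: "(real^'n) set" where
  "sup_functionals = (\<lambda>(s, i). axis i s) ` ({1, - 1} \<times> UNIV)"

definition sum_functionals :: "(real^'n) set" where
  "sum_functionals = {a. \<forall>i. a $ i \<in> {1, - 1}}"

lemma axis_in_sup_functionals: "axis i 1 \<in> sup_functionals" "axis i (- 1) \<in> sup_functionals"
  unfolding sup_functionals_def by (auto intro: image_eqI)

interpretation sup_norm: polyhedral_norm "sup_functionals :: (real^'n) set"
proof
  show "finite (sup_functionals :: (real^'n) set)" unfolding sup_functionals_def by simp
  show "sup_functionals \<noteq> ({} :: (real^'n) set)" unfolding sup_functionals_def by simp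
  show "- a \<in> sup_functionals" if "a \<in> sup_functionals" for a :: "real^'n"
    using that axis_in_sup_functionals unfolding sup_functionals_def
    by (auto simp: axis_def vec_eq_iff image_iff)
  show "\<exists>a\<in>sup_functionals. x \<bullet> a \<noteq> 0" if "x \<noteq> 0" for x :: "real^'n"
  proof -
    obtain i where "x $ i \<noteq> 0" using \<open>x \<noteq> 0\<close> by (auto simp: vec_eq_iff)
    then show ?thesis using axis_in_sup_functionals(1)[of i] by (intro bexI[of _ "axis i 1"]) (auto simp: inner_axis)
  qed
qed

interpretation sum_norm: polyhedral_norm "sum_functionals :: (real^'n) set"
proof
  have "finite {f :: 'n \<Rightarrow> real. \<forall>i. f i \<in> {1, - 1}}"
    using finite_PiE[of "UNIV :: 'n set" "\<lambda>_. {1, - 1 :: real}"] by (simp add: PiE_def Pi_def extensional_def)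
  then have "finite (vec_lambda ` {f :: 'n \<Rightarrow> real. \<forall>i. f i \<in> {1, - 1}})" by simp
  moreover have "(sum_functionals :: (real^'n) set) \<subseteq> vec_lambda ` {f. \<forall>i. f i \<in> {1, - 1}}"
  proof
    fix a :: "real^'n" assume "a \<in> sum_functionals"
    then show "a \<in> vec_lambda ` {f. \<forall>i. f i \<in> {1, - 1}}"
      unfolding sum_functionals_def by (intro image_eqI[of _ _ "vec_nth a"]) (auto simp: vec_nth_inverse)
  qed
  ultimately show "finite (sum_functionals :: (real^'n) set)" by (rule finite_subset[rotated])
  have "(\<chi> i. 1) \<in> (sum_functionals :: (real^'n) set)" unfolding sum_functionals_def by simp
  then show "sum_functionals \<noteq> ({} :: (real^'n) set)" by blast
  show "- a \<in> sum_functionals" if "a \<in> sum_functionals" for a :: "real^'n"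
    using that unfolding sum_functionals_def by (auto simp: minus_equation_iff)
  show "\<exists>a\<in>sum_functionals. x \<bullet> a \<noteq> 0" if "x \<noteq> 0" for x :: "real^'n"
  proof -
    define a :: "real^'n" where "a = (\<chi> i. if x $ i \<ge> 0 then 1 else - 1)"
    have "x \<bullet> a = (\<Sum>i\<in>UNIV. \<bar>x $ i\<bar>)" unfolding inner_vec_def a_def by (intro sum.cong) auto
    moreover have "\<dots> \<noteq> 0" using \<open>x \<noteq> 0\<close> by (simp add: sum_nonneg_eq_0_iff vec_eq_iff)
    moreover have "a \<in> sum_functionals" unfolding sum_functionals_def a_def by simp
    ultimately show ?thesis by metis
  qed
qed

lemma sup_norm_eq:
  fixes x :: "real^'n"
  shows "sup_norm.N x = Max (range (\<lambda>i. \<bar>x $ i\<bar>))"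
proof (rule antisym)
  show "sup_norm.N x \<le> Max (range (\<lambda>i. \<bar>x $ i\<bar>))"
    unfolding sup_norm.N_le_iff
  proof
    fix a :: "real^'n" assume "a \<in> sup_functionals"
    then obtain i s where "a = axis i s" "s = 1 \<or> s = - 1" unfolding sup_functionals_def by auto
    then have "x \<bullet> a \<le> \<bar>x $ i\<bar>" by (auto simp: inner_axis)
    also have "\<dots> \<le> Max (range (\<lambda>i. \<bar>x $ i\<bar>))" by simp
    finally show "x \<bullet> a \<le> Max (range (\<lambda>i. \<bar>x $ i\<bar>))" .
  qed
  have "\<bar>x $ i\<bar> \<le> sup_norm.N x" for i
    using sup_norm.abs_inner_le_N[OF axis_in_sup_functionals(1), of x i] by (simp add: inner_axis)
  then show "Max (range (\<lambda>i. \<bar>x $ i\<bar>)) \<le> sup_norm.N x" by simp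
qed

lemma sum_norm_eq:
  fixes x :: "real^'n"
  shows "sum_norm.N x = (\<Sum>i\<in>UNIV. \<bar>x $ i\<bar>)"
proof (rule antisym)
  show "sum_norm.N x \<le> (\<Sum>i\<in>UNIV. \<bar>x $ i\<bar>)"
    unfolding sum_norm.N_le_iff
  proof
    fix a :: "real^'n" assume a: "a \<in> sum_functionals"
    have "x $ i * a $ i \<le> \<bar>x $ i\<bar>" for i
    proof -
      have "a $ i = 1 \<or> a $ i = - 1" using a unfolding sum_functionals_def by auto
      then show ?thesis by auto
    qed
    then show "x \<bullet> a \<le> (\<Sum>i\<in>UNIV. \<bar>x $ i\<bar>)" unfolding inner_vec_def by (intro sum_mono) auto
  qed
  define a :: "real^'n" where "a = (\<chi> i. if x $ i \<ge> 0 then 1 else - 1)"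
  have "(\<Sum>i\<in>UNIV. \<bar>x $ i\<bar>) = x \<bullet> a" unfolding inner_vec_def a_def by (intro sum.cong) auto
  also have "\<dots> \<le> sum_norm.N x" by (rule sum_norm.inner_le_N) (simp add: sum_functionals_def a_def)
  finally show "(\<Sum>i\<in>UNIV. \<bar>x $ i\<bar>) \<le> sum_norm.N x" .
qed

lemma component_le_sup_norm: "\<bar>x $ i\<bar> \<le> sup_norm.N x"
  unfolding sup_norm_eq by simp

lemma sup_norm_attained: "\<exists>i. \<bar>x $ i\<bar> = sup_norm.N x"
proof -
  have "Max (range (\<lambda>i. \<bar>x $ i\<bar>)) \<in> range (\<lambda>i. \<bar>x $ i\<bar>)" by (intro Max_in) auto
  then show ?thesis unfolding sup_norm_eq by force
qed

lemma perm_order: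
  fixes \<pi> :: "'n::finite \<Rightarrow> 'n"
  assumes "\<pi> permutes UNIV"
  shows "perm_order \<pi> > 0" "\<pi> ^^ perm_order \<pi> = id"
proof -
  have "permutation \<pi>" unfolding permutation_permutes using assms by (intro exI[of _ UNIV]) simp
  then obtain k where "\<pi> ^^ k = id" "k > 0" by (rule permutation_is_nilpotent)
  then have "\<exists>k. 0 < k \<and> \<pi> ^^ k = id" by blast
  from LeastI_ex[OF this] show "perm_order \<pi> > 0" "\<pi> ^^ perm_order \<pi> = id"
    unfolding perm_order_def by auto
qed

text \<open>On the space \<open>V\<close> of periodic vectors \<open>A\<close> is an isometry, and for a smallest set \<open>I\<close> of coordinates norming \<open>V\<close>
  every coordinate in \<open>I\<close> is an exposed point of the dual unit ball. So \<open>A\<close> permutes the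
  coordinates in \<open>I\<close> up to sign.\<close>

theorem sup_nonexp_linear_periods:
  fixes A :: "real^'n \<Rightarrow> real^'n"
  assumes lin: "linear A" and A: "sup_norm.nonexp A"
  shows "\<exists>\<pi>. \<pi> permutes (UNIV :: 'n set) \<and>
    (\<forall>v k. k \<ge> 1 \<longrightarrow> (A ^^ k) v = v \<longrightarrow> (A ^^ (2 * perm_order \<pi>)) v = v)"
proof -
  define V where "V = {v. \<exists>k\<ge>1. (A ^^ k) v = v}"
  have linp: "linear (A ^^ k)" for k
  proof (induction k)
    case 0
    show ?case using linear_id by (simp add: id_def)
  next
    case (Suc k)
    then show ?case unfolding funpow.simps by (rule linear_compose[OF _ lin])
  qed
  have per_mult: "(A ^^ (k * m)) v = v" if "(A ^^ k) v = v" for k m v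
    using that by (induction m) (auto simp: funpow_add)
  have V_add: "v + c *\<^sub>R u \<in> V" if vu: "v \<in> V" "u \<in> V" for v u c
  proof -
    obtain k m where k: "k \<ge> 1" "(A ^^ k) v = v" and m: "m \<ge> 1" "(A ^^ m) u = u"
      using vu unfolding V_def by blast
    have "(A ^^ (k * m)) (v + c *\<^sub>R u) = v + c *\<^sub>R u"
      using per_mult[OF k(2), of m] per_mult[OF m(2), of k]
      by (simp add: linear_add[OF linp] linear_scale[OF linp] mult.commute)
    moreover have "k * m \<ge> 1" using k(1) m(1) by simp
    ultimately show ?thesis unfolding V_def by blast
  qed
  have V0: "0 \<in> V" unfolding V_def using linear_0[OF linp, of 1] by (intro CollectI exI[of _ 1]) simp
  have V_A: "(A ^^ j) v \<in> V" if v: "v \<in> V" for v j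
  proof -
    obtain k where k: "k \<ge> 1" "(A ^^ k) v = v" using v unfolding V_def by blast
    then have "(A ^^ k) ((A ^^ j) v) = (A ^^ j) v"
      using sup_norm.funpow_commute[where h = A and k = k and j = j and w = v] by simp
    then show ?thesis using k(1) unfolding V_def by blast
  qed
  have V_onto: "\<exists>w\<in>V. A w = v" if v: "v \<in> V" for v
  proof -
    obtain k where k: "k \<ge> 1" "(A ^^ k) v = v" using v unfolding V_def by blast
    have "A ((A ^^ (k - 1)) v) = v" using k by (cases k) auto
    then show ?thesis using V_A[OF v] by blast
  qed
  have V_iso: "sup_norm.N (A v) = sup_norm.N v" if v: "v \<in> V" for v
  proof -
    have le: "sup_norm.N ((A ^^ j) u) \<le> sup_norm.N u" for j u
      using sup_norm.nonexpD[OF sup_norm.nonexp_funpow[OF A], of j u 0] linear_0[OF linp] by simp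
    obtain k where k: "k \<ge> 1" "(A ^^ k) v = v" using v unfolding V_def by blast
    have "v = (A ^^ (k - 1)) (A v)" using k by (cases k) (auto simp: funpow_swap1)
    then have "sup_norm.N v \<le> sup_norm.N (A v)" using le[of "k - 1" "A v"] by simp
    then show ?thesis using le[of 1 v] by simp
  qed
  \<comment> \<open>Only nonzero vectors are tested, so that the empty set qualifies when
    \<open>V\<close> is trivial and a smallest \<open>I\<close> still admits the strict peaks
    below.\<close>
  define Q where "Q = (\<lambda>I. \<forall>v\<in>V. v \<noteq> 0 \<longrightarrow> (\<forall>i. \<exists>j\<in>I. \<bar>v $ i\<bar> \<le> \<bar>v $ j\<bar>))"
  have "Q UNIV" unfolding Q_def by auto
  from ex_has_least_nat[of Q, OF this, of card]
  obtain I where I: "Q I" and least: "\<And>J. Q J \<Longrightarrow> card I \<le> card J" by blast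
  have QI: "\<exists>j\<in>I. \<bar>v $ j\<bar> = sup_norm.N v" if v: "v \<in> V" "v \<noteq> 0" for v
  proof -
    obtain l where l: "\<bar>v $ l\<bar> = sup_norm.N v" using sup_norm_attained by blast
    obtain j where "j \<in> I" "\<bar>v $ l\<bar> \<le> \<bar>v $ j\<bar>" using I v unfolding Q_def by blast
    then show ?thesis using l component_le_sup_norm[of v j] by (intro bexI[of _ j]) auto
  qed
  have peak: "\<exists>v\<in>V. v $ i > 0 \<and> v $ i = sup_norm.N v \<and> (\<forall>j\<in>I - {i}. \<bar>v $ j\<bar> < v $ i)"
    if i: "i \<in> I" for i
  proof -
    have "card (I - {i}) < card I" using i by (intro psubset_card_mono) auto
    \<comment> \<open>A vector not controlled by the other coordinates in \<open>I\<close> must peak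
      at \<open>i\<close>, and strictly.\<close>
    then have "\<not> Q (I - {i})" using least not_le by blast
    then obtain v l where v: "v \<in> V" "v \<noteq> 0" and "\<not> (\<exists>j\<in>I - {i}. \<bar>v $ l\<bar> \<le> \<bar>v $ j\<bar>)"
      unfolding Q_def by blast
    then have l: "\<bar>v $ j\<bar> < \<bar>v $ l\<bar>" if "j \<in> I - {i}" for j using that not_le by blast
    obtain j where j: "j \<in> I" "\<bar>v $ j\<bar> = sup_norm.N v" using QI[OF v] by blast
    have "j = i"
    proof (rule ccontr)
      assume "j \<noteq> i"
      then have "\<bar>v $ j\<bar> < \<bar>v $ l\<bar>" using l j(1) by blast
      then show False using j(2) component_le_sup_norm[of v l] by simp
    qed
    then have vi: "\<bar>v $ i\<bar> = sup_norm.N v" using j by simp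
    have pos: "sup_norm.N v > 0" using v(2) sup_norm.N_pos_iff by blast
    have less: "\<bar>v $ j\<bar> < sup_norm.N v" if "j \<in> I - {i}" for j
      using l[OF that] component_le_sup_norm[of v l] by simp
    have "- v \<in> V" using V_add[OF V0 v(1), of "- 1"] by simp
    show ?thesis
    proof (cases "v $ i > 0")
      case True
      then show ?thesis using vi pos less v(1) by (intro bexI[of _ v]) auto
    next
      case False
      then show ?thesis using vi pos less \<open>- v \<in> V\<close> by (intro bexI[of _ "- v"]) auto
    qed
  qed
  have perm: "\<exists>j\<in>I. \<exists>s\<in>{1, - 1}. \<forall>u\<in>V. A u $ i = s * u $ j" if i: "i \<in> I" for i
  proof -
    obtain v where v: "v \<in> V" "v $ i > 0" "v $ i = sup_norm.N v" "\<And>j. j \<in> I - {i} \<Longrightarrow> \<bar>v $ j\<bar> < v $ i"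
      using peak[OF i] by blast
    obtain w where w: "w \<in> V" "A w = v" using V_onto[OF v(1)] by blast
    have Nw: "sup_norm.N w = v $ i" using V_iso[OF w(1)] w(2) v(3) by simp
    have "w \<noteq> 0" using w(2) v(2) linear_0[OF lin] by auto
    then obtain j where j: "j \<in> I" "\<bar>w $ j\<bar> = v $ i" using QI[OF w(1)] Nw by auto
    define s where "s = sgn (w $ j)"
    have s: "s \<in> {1, - 1}" "s * w $ j = v $ i"
      using j(2) v(2) unfolding s_def by (auto simp: sgn_if abs_if split: if_splits)
    \<comment> \<open>Adding a small multiple of \<open>A u\<close> to \<open>v\<close> keeps the
      peak at \<open>i\<close>, so the norm is at most \<open>v $ i + e * A u $ i\<close>. The
      isometry turns this into a bound on coordinate \<open>j\<close> of
      \<open>w + e *\<^sub>R u\<close>; the terms without \<open>e\<close> cancel.\<close>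
    have ge: "s * u $ j \<le> A u $ i" if u: "u \<in> V" for u
    proof -
      let ?n = "sup_norm.N (A u)"
      have "\<exists>r>0. \<forall>j\<in>I - {i}. \<forall>x::real. x < r \<longrightarrow> \<bar>v $ j\<bar> + x < v $ i"
      proof (rule finite_common_radius[where d = "\<lambda>x. x"])
        show "\<exists>r>0. \<forall>x. x < r \<longrightarrow> \<bar>v $ j\<bar> + x < v $ i" if "j \<in> I - {i}" for j
          using v(4)[OF that] by (intro exI[of _ "v $ i - \<bar>v $ j\<bar>"]) auto
      qed simp
      then obtain r where r: "r > 0" "\<And>j x. j \<in> I - {i} \<Longrightarrow> x < r \<Longrightarrow> \<bar>v $ j\<bar> + x < v $ i" by blast
      define e where "e = min r (v $ i) / (2 * ?n + 1)"
      have n1: "2 * ?n + 1 > 0" using sup_norm.N_nonneg[of "A u"] by linarith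
      have e: "e > 0" using r(1) v(2) n1 by (simp add: e_def)
      have "e * (2 * ?n + 1) = min r (v $ i)" using n1 by (simp add: e_def)
      then have small: "2 * (e * ?n) < r" "2 * (e * ?n) < v $ i" using e by (auto simp: algebra_simps)
      have comp: "\<bar>e * A u $ l\<bar> \<le> e * ?n" for l
        using component_le_sup_norm[of "A u" l] e by (simp add: abs_mult)
      have bound: "\<bar>(v + e *\<^sub>R A u) $ l\<bar> \<le> v $ i + e * A u $ i" if l: "l \<in> I" for l
      proof (cases "l = i")
        case True
        then show ?thesis using comp[of i] small(2) e v(2) sup_norm.N_nonneg[of "A u"] by auto
      next
        case False
        then have "\<bar>v $ l\<bar> + 2 * (e * ?n) < v $ i" using r(2) l small(1) by blast
        then show ?thesis using comp[of l] comp[of i] by auto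
      qed
      have inV: "v + e *\<^sub>R A u \<in> V" using V_add[OF v(1)] V_A[OF u, of 1] by simp
      have nz: "v + e *\<^sub>R A u \<noteq> 0"
      proof
        assume "v + e *\<^sub>R A u = 0"
        then have "(v + e *\<^sub>R A u) $ i = 0" by simp
        then show False using comp[of i] small(2) v(2) by auto
      qed
      obtain l where l: "l \<in> I" "\<bar>(v + e *\<^sub>R A u) $ l\<bar> = sup_norm.N (v + e *\<^sub>R A u)"
        using QI[OF inV nz] by blast
      have "A (w + e *\<^sub>R u) = v + e *\<^sub>R A u" using w(2) by (simp add: linear_add[OF lin] linear_scale[OF lin])
      then have "sup_norm.N (w + e *\<^sub>R u) = sup_norm.N (v + e *\<^sub>R A u)"
        using V_iso[OF V_add[OF w(1) u], of e] by simp
      then have le: "sup_norm.N (w + e *\<^sub>R u) \<le> v $ i + e * A u $ i" using bound[OF l(1)] l(2) by simp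
      have "s * (w + e *\<^sub>R u) $ j \<le> \<bar>(w + e *\<^sub>R u) $ j\<bar>" using s(1) by auto
      also have "\<dots> \<le> sup_norm.N (w + e *\<^sub>R u)" by (rule component_le_sup_norm)
      also note le
      finally have "e * (s * u $ j) \<le> e * A u $ i" using s(2) by (simp add: algebra_simps)
      then show ?thesis using e by simp
    qed
    have "A u $ i = s * u $ j" if u: "u \<in> V" for u
    proof -
      have "- u \<in> V" using V_add[OF V0 u, of "- 1"] by simp
      from ge[OF this] have "A u $ i \<le> s * u $ j" by (simp add: linear_neg[OF lin])
      then show ?thesis using ge[OF u] by simp
    qed
    then show ?thesis using j(1) s(1) by blast
  qed
  have "\<forall>i\<in>I. \<exists>p. fst p \<in> I \<and> snd p \<in> {1, - 1 :: real} \<and> (\<forall>u\<in>V. A u $ i = snd p * u $ fst p)"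
  proof
    fix i assume "i \<in> I"
    from perm[OF this] obtain j s where "j \<in> I" "s \<in> {1, - 1 :: real}" "\<forall>u\<in>V. A u $ i = s * u $ j"
      by blast
    then show "\<exists>p. fst p \<in> I \<and> snd p \<in> {1, - 1 :: real} \<and> (\<forall>u\<in>V. A u $ i = snd p * u $ fst p)"
      by (intro exI[of _ "(j, s)"]) simp
  qed
  from bchoice[OF this] obtain p where
    p: "\<forall>i\<in>I. fst (p i) \<in> I \<and> snd (p i) \<in> {1, - 1 :: real} \<and> (\<forall>u\<in>V. A u $ i = snd (p i) * u $ fst (p i))" ..
  define \<sigma> s where "\<sigma> = fst \<circ> p" and "s = snd \<circ> p"
  have \<sigma>: "\<sigma> i \<in> I" "s i \<in> {1, - 1}" if "i \<in> I" for i
    using p that by (auto simp: \<sigma>_def s_def)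
  have \<sigma>3: "A u $ i = s i * u $ \<sigma> i" if "i \<in> I" "u \<in> V" for i u
    using p that by (auto simp: \<sigma>_def s_def)
  \<comment> \<open>Two coordinates with the same image would agree in absolute value on
    \<open>V\<close>, against the strict peak at one of them.\<close>
  have inj: "inj_on \<sigma> I"
  proof (rule inj_onI, rule ccontr)
    fix i i' assume i: "i \<in> I" "i' \<in> I" "\<sigma> i = \<sigma> i'" "i \<noteq> i'"
    obtain v where v: "v \<in> V" "v $ i > 0" "\<And>j. j \<in> I - {i} \<Longrightarrow> \<bar>v $ j\<bar> < v $ i"
      using peak[OF i(1)] by blast
    obtain w where w: "w \<in> V" "A w = v" using V_onto[OF v(1)] by blast
    have "\<bar>v $ i\<bar> = \<bar>w $ \<sigma> i\<bar>" "\<bar>v $ i'\<bar> = \<bar>w $ \<sigma> i\<bar>"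
      using \<sigma>3[OF i(1) w(1)] \<sigma>3[OF i(2) w(1)] \<sigma>(2)[OF i(1)] \<sigma>(2)[OF i(2)] w(2) i(3)
      by (auto simp: abs_mult)
    then show False using v(3)[of i'] v(2) i by simp
  qed
  define \<pi> where "\<pi> = (\<lambda>i. if i \<in> I then \<sigma> i else i)"
  have "\<sigma> ` I = I" using inj \<sigma>(1) by (intro endo_inj_surj) auto
  then have "bij_betw \<sigma> I I" using inj by (simp add: bij_betw_def)
  then have "bij_betw \<pi> I I" by (rule bij_betw_cong[THEN iffD1, rotated]) (simp add: \<pi>_def)
  then have "\<pi> permutes I" by (rule bij_imp_permutes) (simp add: \<pi>_def)
  then have \<pi>: "\<pi> permutes UNIV" by (rule permutes_subset) simp
  have \<pi>I: "(\<pi> ^^ k) i \<in> I" if "i \<in> I" for i k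
    using that \<sigma>(1) by (induction k) (auto simp: \<pi>_def)
  have iter: "\<exists>t\<in>{1, - 1}. \<forall>u\<in>V. (A ^^ k) u $ i = t * u $ ((\<pi> ^^ k) i)" if i: "i \<in> I" for i k
  proof (induction k)
    case 0
    show ?case by (intro bexI[of _ 1]) auto
  next
    case (Suc k)
    then obtain t where t: "t \<in> {1, - 1}" "\<And>u. u \<in> V \<Longrightarrow> (A ^^ k) u $ i = t * u $ ((\<pi> ^^ k) i)" by blast
    let ?j = "(\<pi> ^^ k) i"
    have "(A ^^ Suc k) u $ i = (t * s ?j) * u $ ((\<pi> ^^ Suc k) i)" if u: "u \<in> V" for u
    proof -
      have "(A ^^ Suc k) u $ i = (A ^^ k) (A u) $ i" by (simp add: funpow_swap1)
      also have "\<dots> = t * A u $ ?j" using t(2) V_A[OF u, of 1] by simp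
      also have "\<dots> = t * (s ?j * u $ (\<sigma> ?j))" using \<sigma>3[OF \<pi>I[OF i] u] by simp
      finally show ?thesis using \<pi>I[OF i, of k] by (simp add: \<pi>_def)
    qed
    moreover have "t * s ?j \<in> {1, - 1}" using t(1) \<sigma>(2)[OF \<pi>I[OF i, of k]] by auto
    ultimately show ?case by blast
  qed
  let ?n = "perm_order \<pi>"
  have fixV: "(A ^^ (2 * ?n)) v = v" if v: "v \<in> V" for v
  proof (rule ccontr)
    assume ne: "(A ^^ (2 * ?n)) v \<noteq> v"
    define d where "d = (A ^^ (2 * ?n)) v + (- 1) *\<^sub>R v"
    have d: "d \<in> V" unfolding d_def by (intro V_add V_A v)
    have "d $ i = 0" if i: "i \<in> I" for i
    proof -
      obtain t where t: "t \<in> {1, - 1}" "\<And>u. u \<in> V \<Longrightarrow> (A ^^ ?n) u $ i = t * u $ ((\<pi> ^^ ?n) i)"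
        using iter[OF i, of ?n] by blast
      have "(A ^^ (2 * ?n)) v = (A ^^ ?n) ((A ^^ ?n) v)"
        using funpow_add[of ?n ?n A] by (simp add: mult_2)
      then have "(A ^^ (2 * ?n)) v $ i = t * (t * v $ i)"
        using t(2)[OF V_A[OF v]] t(2)[OF v] perm_order(2)[OF \<pi>] by simp
      then show ?thesis using t(1) by (auto simp: d_def)
    qed
    moreover have "d \<noteq> 0" using ne by (simp add: d_def)
    then obtain j where "j \<in> I" "\<bar>d $ j\<bar> = sup_norm.N d" using QI[OF d] by blast
    ultimately show False using \<open>d \<noteq> 0\<close> sup_norm.N_eq_0_iff[of d] by simp
  qed
  show ?thesis
  proof (intro exI[of _ \<pi>] conjI allI impI)
    show "(A ^^ (2 * ?n)) v = v" if "k \<ge> 1" "(A ^^ k) v = v" for v k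
      by (rule fixV) (use that in \<open>auto simp: V_def\<close>)
  qed (rule \<pi>)
qed

lemma sup_nonexp_linear_converge:
  fixes A :: "real^'n \<Rightarrow> real^'n"
  assumes lin: "linear A" and A: "sup_norm.nonexp A"
  shows "\<exists>\<pi>. \<pi> permutes (UNIV :: 'n set) \<and> (\<forall>v. convergent (\<lambda>k. ((A ^^ (2 * perm_order \<pi>)) ^^ k) v))"
proof -
  obtain \<pi> where \<pi>: "\<pi> permutes (UNIV :: 'n set)"
    "\<And>v k. k \<ge> 1 \<Longrightarrow> (A ^^ k) v = v \<Longrightarrow> (A ^^ (2 * perm_order \<pi>)) v = v"
    using sup_nonexp_linear_periods[OF lin A] by blast
  have "2 * perm_order \<pi> \<ge> 1" using perm_order(1)[OF \<pi>(1)] by simp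
  then have "convergent (\<lambda>k. ((A ^^ (2 * perm_order \<pi>)) ^^ k) v)" for v
    by (intro sup_norm.linear_iterates_converge[OF lin A] \<pi>(2))
  then show ?thesis using \<pi>(1) by blast
qed

section \<open>Duality between the two norms\<close>

lemma inner_funpow_adjoint:
  fixes A :: "'a::euclidean_space \<Rightarrow> 'a"
  assumes "linear A"
  shows "(A ^^ n) x \<bullet> y = x \<bullet> (adjoint A ^^ n) y"
proof (induction n arbitrary: y)
  case (Suc n)
  have "(A ^^ Suc n) x \<bullet> y = (A ^^ n) x \<bullet> adjoint A y" by (simp add: adjoint_works[OF assms])
  also have "\<dots> = x \<bullet> (adjoint A ^^ Suc n) y" by (simp add: Suc.IH funpow_swap1)
  finally show ?case .
qed simp

text \<open>A coordinate of \<open>adjoint A y\<close> pairs \<open>y\<close> with a column of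
  \<open>A\<close>, whose sum norm is at most that of a unit vector.\<close>

lemma sum_nonexp_adjoint:
  fixes A :: "real^'n \<Rightarrow> real^'n"
  assumes lin: "linear A" and A: "sum_norm.nonexp A"
  shows "sup_norm.nonexp (adjoint A)"
proof -
  have le: "sup_norm.N (adjoint A y) \<le> sup_norm.N y" for y
  proof -
    obtain i where i: "\<bar>adjoint A y $ i\<bar> = sup_norm.N (adjoint A y)" using sup_norm_attained by blast
    let ?e = "axis i 1 :: real^'n"
    have "\<bar>adjoint A y $ i\<bar> = \<bar>A ?e \<bullet> y\<bar>"
      using adjoint_works[OF lin, of ?e y] by (simp add: inner_axis')
    also have "\<dots> \<le> (\<Sum>j\<in>UNIV. \<bar>A ?e $ j * y $ j\<bar>)" unfolding inner_vec_def by simp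
    also have "\<dots> \<le> (\<Sum>j\<in>UNIV. \<bar>A ?e $ j\<bar> * sup_norm.N y)"
      by (intro sum_mono) (simp add: abs_mult mult_left_mono component_le_sup_norm)
    also have "\<dots> = sum_norm.N (A ?e) * sup_norm.N y" by (simp add: sum_norm_eq sum_distrib_right)
    also have "sum_norm.N (A ?e) \<le> sum_norm.N ?e"
      using sum_norm.nonexpD[OF A, of ?e 0] linear_0[OF lin] by simp
    also have "sum_norm.N ?e = 1"
    proof -
      have "(\<Sum>j\<in>UNIV. \<bar>?e $ j\<bar>) = (\<Sum>j\<in>UNIV. if j = i then 1 else 0)"
        by (intro sum.cong) (auto simp: axis_def)
      then show ?thesis by (simp add: sum_norm_eq)
    qed
    finally show ?thesis using i by (simp add: mult_right_mono)
  qed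
  show ?thesis
    unfolding sup_norm.nonexp_def using le by (simp add: linear_diff[OF adjoint_linear[OF lin], symmetric])
qed

text \<open>Component \<open>i\<close> of an iterate of \<open>A\<close> at \<open>v\<close> is the
  inner product of \<open>v\<close> with the same iterate of the adjoint at \<open>axis i 1\<close>,
  which converges by the sup norm case.\<close>

lemma sum_nonexp_linear_converge:
  fixes A :: "real^'n \<Rightarrow> real^'n"
  assumes lin: "linear A" and A: "sum_norm.nonexp A"
  shows "\<exists>\<pi>. \<pi> permutes (UNIV :: 'n set) \<and> (\<forall>v. convergent (\<lambda>k. ((A ^^ (2 * perm_order \<pi>)) ^^ k) v))"
proof -
  let ?B = "adjoint A"
  obtain \<pi> where \<pi>: "\<pi> permutes (UNIV :: 'n set)" "\<And>v. convergent (\<lambda>k. ((?B ^^ (2 * perm_order \<pi>)) ^^ k) v)"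
    using sup_nonexp_linear_converge[OF adjoint_linear[OF lin] sum_nonexp_adjoint[OF lin A]] by blast
  let ?q = "2 * perm_order \<pi>"
  have "convergent (\<lambda>k. ((A ^^ ?q) ^^ k) v)" for v
  proof -
    have "\<exists>l. (\<lambda>k. ((A ^^ ?q) ^^ k) v $ i) \<longlonglongrightarrow> l" for i
    proof -
      obtain L where L: "(\<lambda>k. ((?B ^^ ?q) ^^ k) (axis i 1)) \<longlonglongrightarrow> L"
        using \<pi>(2) unfolding convergent_def by blast
      have "((A ^^ ?q) ^^ k) v $ i = v \<bullet> ((?B ^^ ?q) ^^ k) (axis i 1)" for k
        using inner_funpow_adjoint[OF lin, of "?q * k" v "axis i 1"]
        by (simp only: funpow_mult inner_axis inner_real_def mult_1_right)
      then show ?thesis using tendsto_inner[OF tendsto_const[of v] L] by auto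
    qed
    then obtain l where "\<And>i. (\<lambda>k. ((A ^^ ?q) ^^ k) v $ i) \<longlonglongrightarrow> l i" by metis
    then have "(\<lambda>k. ((A ^^ ?q) ^^ k) v) \<longlonglongrightarrow> (\<chi> i. l i)" by (intro vec_tendstoI) simp
    then show ?thesis unfolding convergent_def by blast
  qed
  then show ?thesis using \<pi>(1) by blast
qed

section \<open>Minimal periods and the assembly of the result\<close>

lemma periodic_minimal_period_dvd:
  assumes q: "q > 0" "(f ^^ q) z = z"
  shows "periodic_point f z \<and> minimal_period f z dvd q"
proof -
  define d where "d = (LEAST d. d > 0 \<and> (f ^^ d) z = z)"
  have d: "d > 0" "(f ^^ d) z = z"
    using LeastI[of "\<lambda>d. d > 0 \<and> (f ^^ d) z = z" q] q unfolding d_def by auto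
  have least: "d \<le> m" if "m > 0" "(f ^^ m) z = z" for m
    unfolding d_def using that by (intro Least_le) simp
  have modd: "(f ^^ k) z = (f ^^ (k mod d)) z" for k
    using funpow_mod_eq[OF d(2)] by metis
  have "d dvd q"
  proof (rule ccontr)
    assume "\<not> d dvd q"
    then have "q mod d > 0" by (simp add: mod_greater_zero_iff_not_dvd)
    moreover have "(f ^^ (q mod d)) z = z" using modd[of q] q(2) by simp
    ultimately show False using least[of "q mod d"] mod_less_divisor[OF d(1), of q] by simp
  qed
  have orbit: "orbit_of f z = (\<lambda>k. (f ^^ k) z) ` {..<d}"
  proof
    show "orbit_of f z \<subseteq> (\<lambda>k. (f ^^ k) z) ` {..<d}"
      unfolding orbit_of_def using modd mod_less_divisor[OF d(1)] by blast
  qed (auto simp: orbit_of_def)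
  have "inj_on (\<lambda>k. (f ^^ k) z) {..<d}"
  proof (rule linorder_inj_onI)
    fix i j assume ij: "i < j" "i \<in> {..<d}" "j \<in> {..<d}"
    show "(f ^^ i) z \<noteq> (f ^^ j) z"
    proof
      assume eq: "(f ^^ i) z = (f ^^ j) z"
      have "(f ^^ (d - j + i)) z = (f ^^ (d - j)) ((f ^^ j) z)" by (simp add: funpow_add eq)
      also have "\<dots> = z" using ij d(2) funpow_add[of "d - j" j f] by simp
      finally show False using least[of "d - j + i"] ij by simp
    qed
  qed auto
  then have "card (orbit_of f z) = d" unfolding orbit by (simp add: card_image)
  then show ?thesis
    using \<open>d dvd q\<close> by (simp add: periodic_point_def minimal_period_def orbit)
qed

lemma preserves_analytic_curves_average:
  fixes g :: "real^'n \<Rightarrow> real^'n"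
  assumes "preserves_analytic_curves g"
  shows "preserves_analytic_curves (polyhedral_norm.average g)"
  unfolding preserves_analytic_curves_def
proof (intro allI impI)
  fix c :: "real \<Rightarrow> real^'n" assume c: "analytic_curve c"
  then have "analytic_curve (\<lambda>t. g (c t))" using assms unfolding preserves_analytic_curves_def by blast
  then have "analytic_fun (\<lambda>t. (g (c t) $ i + c t $ i) * (1 / 2))" for i
    using c unfolding analytic_curve_def by (intro analytic_fun_cmult analytic_fun_add) auto
  then show "analytic_curve (\<lambda>t. polyhedral_norm.average g (c t))"
    \<comment> \<open>\<open>average\<close> does not involve the set of functionals, so its
      definition from one interpretation serves for both norms.\<close>
    unfolding analytic_curve_def sup_norm.average_def by (simp add: mult.commute)
qed

context
  fixes P :: "(real^'n) set" and f :: "real^'n \<Rightarrow> real^'n"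
  assumes poly: "polyhedral_norm P"
    and linear_converge: "\<And>A. linear A \<Longrightarrow> polyhedral_norm.nonexp P A \<Longrightarrow>
      \<exists>\<pi>. \<pi> permutes (UNIV :: 'n set) \<and> (\<forall>v. convergent (\<lambda>k. ((A ^^ (2 * perm_order \<pi>)) ^^ k) v))"
    and analytic: "\<forall>i. real_analytic (\<lambda>x. f x $ i)"
    and nonexp: "polyhedral_norm.nonexp P f"
    and fixed: "\<exists>x. f x = x"
begin

interpretation polyhedral_norm P by (rule poly)

text \<open>The derivative at a single fixed point determines \<open>q\<close> for all starting
  points; the particular norm enters through \<open>linear_converge\<close>.\<close>

lemma analytic_nonexp_iterates:
  "\<exists>q::nat. q > 0 \<and>
     (\<forall>x. convergent (\<lambda>k. (f ^^ (k * q)) x)) \<and>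
     (\<forall>x. periodic_point f (lim (\<lambda>k. (f ^^ (k * q)) x)) \<and>
          minimal_period f (lim (\<lambda>k. (f ^^ (k * q)) x)) dvd q) \<and>
     (\<exists>\<pi>. \<pi> permutes (UNIV :: 'n set) \<and> (q = perm_order \<pi> \<or> q = 2 * perm_order \<pi>))"
proof -
  obtain x0 where x0: "f x0 = x0" using fixed by blast
  obtain A where A: "(f has_derivative A) (at x0)"
    using real_analytic_map_has_derivative[OF analytic] by blast
  obtain \<pi> where \<pi>: "\<pi> permutes (UNIV :: 'n set)"
    "\<And>v. convergent (\<lambda>k. ((A ^^ (2 * perm_order \<pi>)) ^^ k) v)"
    using linear_converge[OF has_derivative_linear[OF A] derivative_nonexp[OF nonexp x0 A]] by blast
  define q where "q = 2 * perm_order \<pi>"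
  have q: "q > 0" using perm_order(1)[OF \<pi>(1)] by (simp add: q_def)
  have rigid: "line_rigid (average (f ^^ m) ^^ k)" for m k
    by (intro preserves_analytic_curves_line_rigid preserves_analytic_curves_funpow
        preserves_analytic_curves_average real_analytic_preserves_analytic_curves[OF analytic])
  have conv: "\<exists>y. (f ^^ q) y = y \<and> (\<lambda>k. (f ^^ (k * q)) x) \<longlonglongrightarrow> y" for x
    by (rule iterates_converge[OF nonexp x0 A \<pi>(2)[folded q_def] rigid])
  have "periodic_point f (lim (\<lambda>k. (f ^^ (k * q)) x)) \<and>
        minimal_period f (lim (\<lambda>k. (f ^^ (k * q)) x)) dvd q" for x
    using conv[of x] periodic_minimal_period_dvd[OF q] limI by metis
  moreover have "convergent (\<lambda>k. (f ^^ (k * q)) x)" for x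
    using conv[of x] unfolding convergent_def by blast
  ultimately show ?thesis using q \<pi>(1) q_def by blast
qed

end

lemma p_norm_sum: "p_norm 1 x = sum_norm.N x" for x :: "real^'n"
  unfolding p_norm_def sum_norm_eq by simp

lemma p_norm_sup: "p_norm \<infinity> x = sup_norm.N x" for x :: "real^'n"
  unfolding p_norm_def sup_norm_eq by simp

theorem theorem3p1:
  fixes f :: "real^'n \<Rightarrow> real^'n" and p :: ereal
  assumes "p \<in> {1, \<infinity>}"
    and "\<forall>i. real_analytic (\<lambda>x. f x $ i)"
    and "\<forall>x y. p_norm p (f x - f y) \<le> p_norm p (x - y)"
    and "\<exists>x. f x = x"
  shows "\<exists>q::nat. q > 0 \<and>
           (\<forall>x. convergent (\<lambda>k. (f ^^ (k * q)) x)) \<and>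
           (\<forall>x. periodic_point f (lim (\<lambda>k. (f ^^ (k * q)) x)) \<and>
                minimal_period f (lim (\<lambda>k. (f ^^ (k * q)) x)) dvd q) \<and>
           (\<exists>\<pi>. \<pi> permutes (UNIV :: 'n set) \<and> (q = perm_order \<pi> \<or> q = 2 * perm_order \<pi>))"
proof (cases "p = 1")
  case True
  then have "sum_norm.nonexp f" using assms(3) unfolding sum_norm.nonexp_def by (simp add: p_norm_sum)
  then show ?thesis
    using analytic_nonexp_iterates[OF sum_norm.polyhedral_norm_axioms sum_nonexp_linear_converge assms(2) _ assms(4)]
    by blast
next
  case False
  then have "p = \<infinity>" using assms(1) by simp
  then have "sup_norm.nonexp f" using assms(3) unfolding sup_norm.nonexp_def by (simp add: p_norm_sup)
  then show ?thesis
    using analytic_nonexp_iterates[OF sup_norm.polyhedral_norm_axioms sup_nonexp_linear_converge assms(2) _ assms(4)]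
    by blast
qed

end
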